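(* $\mathsf{Cospan}^{\leq}(\mathbb F)\cong\mathbb{CB}^{\leq}_{\emptyset}$ as preordered cartesian bicategories.
   Context: $\mathbb F$ is the category whose objects are the finite ordinals $n=\{0,\dots,n-1\}$ and whose arrows are all functions. $\mathsf{Cospan}^{\leq}(\mathbb F)$ has the finite ordinals as objects, arrows $n\to m$ the isomorphism classes of cospans $n\to A\leftarrow m$ in $\mathbb F$, composition by pushout, monoidal product by coproduct (sum of ordinals), and preorder $(n\to A\leftarrow m)\le(n\to B\leftarrow m)$ iff there is a function $B\to A$ commuting with the legs. Its monoid on $X$ is $X+X\xrightarrow{[\mathrm{id},\mathrm{id}]}X\xleftarrow{\mathrm{id}}X$ and $0\to X\xleftarrow{\mathrm{id}}X$, its comonoid the reversed cospans. A preordered cartesian bicategory is a symmetric monoidal category $(\mathcal B,\oplus,I)$ with preordered hom-sets (composition, $\oplus$ monotone), each object $X$ carrying a monoid $\mu_X:X\oplus X\to X,\eta_X:I\to X$ and comonoid $\delta_X:X\to X\oplus X,\varepsilon_X:X\to I$ forming a special commutative Frobenius bimonoid (diagrammatic order $;$: $(\delta_X\oplus\mathrm{id});(\mathrm{id}\oplus\mu_X)=\mu_X;\delta_X=(\mathrm{id}\oplus\delta_X);(\mu_X\oplus\mathrm{id})$, $\delta_X;\mu_X=\mathrm{id}_X$, plus (co)associativity, (co)unit and (co)commutativity), with $\mathrm{id}_X\le\varepsilon_X;\eta_X$, $\eta_X;\varepsilon_X\le\mathrm{id}_I$, $\mathrm{id}_X\le\delta_X;\mu_X$, $\mu_X;\delta_X\le\mathrm{id}_{X\oplus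 X}$, and every arrow $R:X\to Y$ satisfying $R;\delta_Y\le\delta_X;(R\oplus R)$, $R;\varepsilon_Y\le\varepsilon_X$. Morphisms: monoidal functors preserving preorders, monoids and comonoids. $\mathbb{CB}^{\leq}_{\emptyset}$: terms generated by constants $\delta:(1,2)$, $\varepsilon:(1,0)$, $\mu:(2,1)$, $\eta:(0,1)$, $\mathrm{id}_0:(0,0)$, $\mathrm{id}_1:(1,1)$, $\sigma:(2,2)$, sequential composition $c;d$ (sorts $(n,z),(z,m)\mapsto(n,m)$) and $c\oplus d$ (sorts $(n,m),(p,q)\mapsto(n+p,m+q)$). Arrows $n\to m$ are terms of sort $(n,m)$ modulo the smallest congruence generated by: strict symmetric monoidal category laws with symmetry generated by $\sigma$; $\delta;(\delta\oplus\mathrm{id}_1)=\delta;(\mathrm{id}_1\oplus\delta)$, $\delta;(\varepsilon\oplus\mathrm{id}_1)=\mathrm{id}_1$, $\delta;\sigma=\delta$; $(\mu\oplus\mathrm{id}_1);\mu=(\mathrm{id}_1\oplus\mu);\mu$, $(\eta\oplus\mathrm{id}_1);\mu=\mathrm{id}_1$, $\sigma;\mu=\mu$; $(\delta\oplus\mathrm{id}_1);(\mathrm{id}_1\oplus\mu)=\mu;\delta=(\mathrm{id}_1\oplus\delta);(\mu\oplus\mathrm{id}_1)$; $\delta;\mu=\mathrm{id}_1$. They are ordered by the smallest precongruence (preorder compatible with $;$ and $\oplus$) generated by $\mathrm{id}_1\le\varepsilon;\eta$, $\eta;\varepsilon\le\mathrm{id}_0$, $\mathrm{id}_1\le\delta;\mu$,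 $\mu;\delta\le\mathrm{id}_2$. *)

theory Defs
  imports Main "HOL-Library.FuncSet"
begin

section \<open>Preordered cartesian bicategories\<close>

text \<open>
  Composition is written in diagrammatic order and the monoidal product need not be strict.
  As usual, an arrow has a unique source and target; all operations are
  only constrained on well-typed arguments.
\<close>

record ('o, 'a) pcb_sig =
  obj :: "'o set"
  hom :: "'o \<Rightarrow> 'o \<Rightarrow> 'a set"
  idt :: "'o \<Rightarrow> 'a"
  seqc :: "'a \<Rightarrow> 'a \<Rightarrow> 'a"  (infixl ";;\<index>" 60)
  leq :: "'a \<Rightarrow> 'a \<Rightarrow> bool"  (infix "\<preceq>\<index>" 50)
  unit_obj :: 'o
  otensor :: "'o \<Rightarrow> 'o \<Rightarrow> 'o"  (infixl "\<boxplus>\<index>" 65)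
  tensor :: "'a \<Rightarrow> 'a \<Rightarrow> 'a"  (infixl "\<oplus>\<index>" 65)
  assoc :: "'o \<Rightarrow> 'o \<Rightarrow> 'o \<Rightarrow> 'a"
  assoc_inv :: "'o \<Rightarrow> 'o \<Rightarrow> 'o \<Rightarrow> 'a"
  lunit :: "'o \<Rightarrow> 'a"
  runit :: "'o \<Rightarrow> 'a"
  symm :: "'o \<Rightarrow> 'o \<Rightarrow> 'a"
  mu :: "'o \<Rightarrow> 'a"
  eta :: "'o \<Rightarrow> 'a"
  delta :: "'o \<Rightarrow> 'a"
  eps :: "'o \<Rightarrow> 'a"

locale category =
  fixes B :: "('o, 'a) pcb_sig" (structure)
  assumes hom_obj: "f \<in> hom B X Y \<Longrightarrow> X \<in> obj B \<and> Y \<in> obj B"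
    and hom_unique: "\<lbrakk>f \<in> hom B X Y; f \<in> hom B X' Y'\<rbrakk> \<Longrightarrow> X = X' \<and> Y = Y'"
    and idt_hom: "X \<in> obj B \<Longrightarrow> idt B X \<in> hom B X X"
    and seq_hom: "\<lbrakk>f \<in> hom B X Y; g \<in> hom B Y Z\<rbrakk> \<Longrightarrow> f ;; g \<in> hom B X Z"
    and idt_left: "f \<in> hom B X Y \<Longrightarrow> idt B X ;; f = f"
    and idt_right: "f \<in> hom B X Y \<Longrightarrow> f ;; idt B Y = f"
    and seq_assoc: "\<lbrakk>f \<in> hom B X Y; g \<in> hom B Y Z; h \<in> hom B Z W\<rbrakk>
      \<Longrightarrow> (f ;; g) ;; h = f ;; (g ;; h)"

definition invertible :: "('o, 'a) pcb_sig \<Rightarrow> 'o \<Rightarrow> 'o \<Rightarrow> 'a \<Rightarrow> bool" where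
  "invertible B X Y f \<longleftrightarrow> f \<in> hom B X Y \<and>
     (\<exists>g \<in> hom B Y X. f ;;\<^bsub>B\<^esub> g = idt B X \<and> g ;;\<^bsub>B\<^esub> f = idt B Y)"

locale symmetric_monoidal_category = category +
  assumes unit_obj: "unit_obj B \<in> obj B"
    and otensor_obj: "\<lbrakk>X \<in> obj B; Y \<in> obj B\<rbrakk> \<Longrightarrow> X \<boxplus> Y \<in> obj B"
    and tensor_hom: "\<lbrakk>f \<in> hom B X Y; g \<in> hom B X' Y'\<rbrakk> \<Longrightarrow> f \<oplus> g \<in> hom B (X \<boxplus> X') (Y \<boxplus> Y')"
    and tensor_idt: "\<lbrakk>X \<in> obj B; Y \<in> obj B\<rbrakk> \<Longrightarrow> idt B X \<oplus> idt B Y = idt B (X \<boxplus> Y)"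
    and interchange:
      "\<lbrakk>f \<in> hom B X Y; g \<in> hom B Y Z; f' \<in> hom B X' Y'; g' \<in> hom B Y' Z'\<rbrakk>
       \<Longrightarrow> (f ;; g) \<oplus> (f' ;; g') = (f \<oplus> f') ;; (g \<oplus> g')"
    and assoc_hom: "\<lbrakk>X \<in> obj B; Y \<in> obj B; Z \<in> obj B\<rbrakk>
      \<Longrightarrow> assoc B X Y Z \<in> hom B ((X \<boxplus> Y) \<boxplus> Z) (X \<boxplus> (Y \<boxplus> Z))"
    and assoc_inv_hom: "\<lbrakk>X \<in> obj B; Y \<in> obj B; Z \<in> obj B\<rbrakk>
      \<Longrightarrow> assoc_inv B X Y Z \<in> hom B (X \<boxplus> (Y \<boxplus> Z)) ((X \<boxplus> Y) \<boxplus> Z)"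
    and assoc_assoc_inv: "\<lbrakk>X \<in> obj B; Y \<in> obj B; Z \<in> obj B\<rbrakk>
      \<Longrightarrow> assoc B X Y Z ;; assoc_inv B X Y Z = idt B ((X \<boxplus> Y) \<boxplus> Z)"
    and assoc_inv_assoc: "\<lbrakk>X \<in> obj B; Y \<in> obj B; Z \<in> obj B\<rbrakk>
      \<Longrightarrow> assoc_inv B X Y Z ;; assoc B X Y Z = idt B (X \<boxplus> (Y \<boxplus> Z))"
    and lunit_invertible: "X \<in> obj B \<Longrightarrow> invertible B (unit_obj B \<boxplus> X) X (lunit B X)"
    and runit_invertible: "X \<in> obj B \<Longrightarrow> invertible B (X \<boxplus> unit_obj B) X (runit B X)"
    and assoc_natural:
      "\<lbrakk>f \<in> hom B X X'; g \<in> hom B Y Y'; h \<in> hom B Z Z'\<rbrakk>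
       \<Longrightarrow> ((f \<oplus> g) \<oplus> h) ;; assoc B X' Y' Z' = assoc B X Y Z ;; (f \<oplus> (g \<oplus> h))"
    and lunit_natural: "f \<in> hom B X Y \<Longrightarrow> (idt B (unit_obj B) \<oplus> f) ;; lunit B Y = lunit B X ;; f"
    and runit_natural: "f \<in> hom B X Y \<Longrightarrow> (f \<oplus> idt B (unit_obj B)) ;; runit B Y = runit B X ;; f"
    and pentagon:
      "\<lbrakk>W \<in> obj B; X \<in> obj B; Y \<in> obj B; Z \<in> obj B\<rbrakk>
       \<Longrightarrow> (assoc B W X Y \<oplus> idt B Z) ;; assoc B W (X \<boxplus> Y) Z ;; (idt B W \<oplus> assoc B X Y Z)
         = assoc B (W \<boxplus> X) Y Z ;; assoc B W X (Y \<boxplus> Z)"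
    and triangle:
      "\<lbrakk>X \<in> obj B; Y \<in> obj B\<rbrakk>
       \<Longrightarrow> assoc B X (unit_obj B) Y ;; (idt B X \<oplus> lunit B Y) = runit B X \<oplus> idt B Y"
    and symm_hom: "\<lbrakk>X \<in> obj B; Y \<in> obj B\<rbrakk> \<Longrightarrow> symm B X Y \<in> hom B (X \<boxplus> Y) (Y \<boxplus> X)"
    and symm_natural:
      "\<lbrakk>f \<in> hom B X X'; g \<in> hom B Y Y'\<rbrakk>
       \<Longrightarrow> (f \<oplus> g) ;; symm B X' Y' = symm B X Y ;; (g \<oplus> f)"
    and symm_symm: "\<lbrakk>X \<in> obj B; Y \<in> obj B\<rbrakk> \<Longrightarrow> symm B X Y ;; symm B Y X = idt B (X \<boxplus> Y)"
    and hexagon: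
      "\<lbrakk>X \<in> obj B; Y \<in> obj B; Z \<in> obj B\<rbrakk>
       \<Longrightarrow> assoc B X Y Z ;; symm B X (Y \<boxplus> Z) ;; assoc B Y Z X
         = (symm B X Y \<oplus> idt B Z) ;; assoc B Y X Z ;; (idt B Y \<oplus> symm B X Z)"

locale preordered_cartesian_bicategory = symmetric_monoidal_category +
  assumes leq_refl: "f \<in> hom B X Y \<Longrightarrow> f \<preceq> f"
    and leq_trans: "\<lbrakk>f \<in> hom B X Y; g \<in> hom B X Y; h \<in> hom B X Y; f \<preceq> g; g \<preceq> h\<rbrakk> \<Longrightarrow> f \<preceq> h"
    and seq_mono:
      "\<lbrakk>f \<in> hom B X Y; f' \<in> hom B X Y; g \<in> hom B Y Z; g' \<in> hom B Y Z; f \<preceq> f'; g \<preceq> g'\<rbrakk>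
       \<Longrightarrow> f ;; g \<preceq> f' ;; g'"
    and tensor_mono:
      "\<lbrakk>f \<in> hom B X Y; f' \<in> hom B X Y; g \<in> hom B Z W; g' \<in> hom B Z W; f \<preceq> f'; g \<preceq> g'\<rbrakk>
       \<Longrightarrow> f \<oplus> g \<preceq> f' \<oplus> g'"
    and mu_hom: "X \<in> obj B \<Longrightarrow> mu B X \<in> hom B (X \<boxplus> X) X"
    and eta_hom: "X \<in> obj B \<Longrightarrow> eta B X \<in> hom B (unit_obj B) X"
    and mu_assoc: "X \<in> obj B \<Longrightarrow>
      (mu B X \<oplus> idt B X) ;; mu B X = assoc B X X X ;; (idt B X \<oplus> mu B X) ;; mu B X"
    and mu_lunit: "X \<in> obj B \<Longrightarrow> (eta B X \<oplus> idt B X) ;; mu B X = lunit B X"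
    and mu_runit: "X \<in> obj B \<Longrightarrow> (idt B X \<oplus> eta B X) ;; mu B X = runit B X"
    and mu_comm: "X \<in> obj B \<Longrightarrow> symm B X X ;; mu B X = mu B X"
    and delta_hom: "X \<in> obj B \<Longrightarrow> delta B X \<in> hom B X (X \<boxplus> X)"
    and eps_hom: "X \<in> obj B \<Longrightarrow> eps B X \<in> hom B X (unit_obj B)"
    and delta_assoc: "X \<in> obj B \<Longrightarrow>
      delta B X ;; (delta B X \<oplus> idt B X) ;; assoc B X X X = delta B X ;; (idt B X \<oplus> delta B X)"
    and delta_lunit: "X \<in> obj B \<Longrightarrow> delta B X ;; (eps B X \<oplus> idt B X) ;; lunit B X = idt B X"
    and delta_runit: "X \<in> obj B \<Longrightarrow> delta B X ;; (idt B X \<oplus> eps B X) ;; runit B X = idt B X"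
    and delta_comm: "X \<in> obj B \<Longrightarrow> delta B X ;; symm B X X = delta B X"
    and frobenius_left: "X \<in> obj B \<Longrightarrow>
      (delta B X \<oplus> idt B X) ;; assoc B X X X ;; (idt B X \<oplus> mu B X) = mu B X ;; delta B X"
    and frobenius_right: "X \<in> obj B \<Longrightarrow>
      (idt B X \<oplus> delta B X) ;; assoc_inv B X X X ;; (mu B X \<oplus> idt B X) = mu B X ;; delta B X"
    and special: "X \<in> obj B \<Longrightarrow> delta B X ;; mu B X = idt B X"
    and eps_eta: "X \<in> obj B \<Longrightarrow> idt B X \<preceq> eps B X ;; eta B X"
    and eta_eps: "X \<in> obj B \<Longrightarrow> eta B X ;; eps B X \<preceq> idt B (unit_obj B)"
    and delta_mu: "X \<in> obj B \<Longrightarrow> idt B X \<preceq> delta B X ;; mu B X"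
    and mu_delta: "X \<in> obj B \<Longrightarrow> mu B X ;; delta B X \<preceq> idt B (X \<boxplus> X)"
    and delta_lax: "R \<in> hom B X Y \<Longrightarrow> R ;; delta B Y \<preceq> delta B X ;; (R \<oplus> R)"
    and eps_lax: "R \<in> hom B X Y \<Longrightarrow> R ;; eps B Y \<preceq> eps B X"

text \<open>
  Morphisms are (strong, symmetric) monoidal functors, with invertible comparison arrows
  \<open>on_tensor F X Y : F X \<boxplus> F Y \<rightarrow> F (X \<boxplus> Y)\<close> and \<open>on_unit F : I \<rightarrow> F I\<close>.
  Monoids and comonoids are preserved up to these comparison arrows.
\<close>

record ('o, 'a, 'p, 'b) monoidal_map =
  on_obj :: "'o \<Rightarrow> 'p"
  on_arr :: "'a \<Rightarrow> 'b"
  on_tensor :: "'o \<Rightarrow> 'o \<Rightarrow> 'b"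
  on_unit :: 'b

locale pcb_morphism =
  dom: preordered_cartesian_bicategory B + cod: preordered_cartesian_bicategory C
  for B :: "('o, 'a) pcb_sig" and C :: "('p, 'b) pcb_sig"
    and F :: "('o, 'a, 'p, 'b) monoidal_map" +
  assumes map_obj: "X \<in> obj B \<Longrightarrow> on_obj F X \<in> obj C"
    and map_hom: "f \<in> hom B X Y \<Longrightarrow> on_arr F f \<in> hom C (on_obj F X) (on_obj F Y)"
    and map_idt: "X \<in> obj B \<Longrightarrow> on_arr F (idt B X) = idt C (on_obj F X)"
    and map_seq: "\<lbrakk>f \<in> hom B X Y; g \<in> hom B Y Z\<rbrakk>
      \<Longrightarrow> on_arr F (f ;;\<^bsub>B\<^esub> g) = on_arr F f ;;\<^bsub>C\<^esub> on_arr F g"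
    and map_leq: "\<lbrakk>f \<in> hom B X Y; g \<in> hom B X Y; f \<preceq>\<^bsub>B\<^esub> g\<rbrakk> \<Longrightarrow> on_arr F f \<preceq>\<^bsub>C\<^esub> on_arr F g"
    and on_unit_invertible:
      "invertible C (unit_obj C) (on_obj F (unit_obj B)) (on_unit F)"
    and on_tensor_invertible:
      "\<lbrakk>X \<in> obj B; Y \<in> obj B\<rbrakk>
       \<Longrightarrow> invertible C (on_obj F X \<boxplus>\<^bsub>C\<^esub> on_obj F Y) (on_obj F (X \<boxplus>\<^bsub>B\<^esub> Y)) (on_tensor F X Y)"
    and on_tensor_natural:
      "\<lbrakk>f \<in> hom B X X'; g \<in> hom B Y Y'\<rbrakk>
       \<Longrightarrow> (on_arr F f \<oplus>\<^bsub>C\<^esub> on_arr F g) ;;\<^bsub>C\<^esub> on_tensor F X' Y'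
         = on_tensor F X Y ;;\<^bsub>C\<^esub> on_arr F (f \<oplus>\<^bsub>B\<^esub> g)"
    and on_tensor_assoc:
      "\<lbrakk>X \<in> obj B; Y \<in> obj B; Z \<in> obj B\<rbrakk>
       \<Longrightarrow> (on_tensor F X Y \<oplus>\<^bsub>C\<^esub> idt C (on_obj F Z)) ;;\<^bsub>C\<^esub> on_tensor F (X \<boxplus>\<^bsub>B\<^esub> Y) Z
             ;;\<^bsub>C\<^esub> on_arr F (assoc B X Y Z)
         = assoc C (on_obj F X) (on_obj F Y) (on_obj F Z)
             ;;\<^bsub>C\<^esub> (idt C (on_obj F X) \<oplus>\<^bsub>C\<^esub> on_tensor F Y Z) ;;\<^bsub>C\<^esub> on_tensor F X (Y \<boxplus>\<^bsub>B\<^esub> Z)"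
    and on_tensor_lunit:
      "X \<in> obj B \<Longrightarrow> (on_unit F \<oplus>\<^bsub>C\<^esub> idt C (on_obj F X)) ;;\<^bsub>C\<^esub> on_tensor F (unit_obj B) X
          ;;\<^bsub>C\<^esub> on_arr F (lunit B X) = lunit C (on_obj F X)"
    and on_tensor_runit:
      "X \<in> obj B \<Longrightarrow> (idt C (on_obj F X) \<oplus>\<^bsub>C\<^esub> on_unit F) ;;\<^bsub>C\<^esub> on_tensor F X (unit_obj B)
          ;;\<^bsub>C\<^esub> on_arr F (runit B X) = runit C (on_obj F X)"
    and on_tensor_symm:
      "\<lbrakk>X \<in> obj B; Y \<in> obj B\<rbrakk>
       \<Longrightarrow> on_tensor F X Y ;;\<^bsub>C\<^esub> on_arr F (symm B X Y)
         = symm C (on_obj F X) (on_obj F Y) ;;\<^bsub>C\<^esub> on_tensor F Y X"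
    and map_mu: "X \<in> obj B \<Longrightarrow> on_tensor F X X ;;\<^bsub>C\<^esub> on_arr F (mu B X) = mu C (on_obj F X)"
    and map_eta: "X \<in> obj B \<Longrightarrow> on_unit F ;;\<^bsub>C\<^esub> on_arr F (eta B X) = eta C (on_obj F X)"
    and map_delta: "X \<in> obj B \<Longrightarrow> delta C (on_obj F X) ;;\<^bsub>C\<^esub> on_tensor F X X = on_arr F (delta B X)"
    and map_eps: "X \<in> obj B \<Longrightarrow> eps C (on_obj F X) ;;\<^bsub>C\<^esub> on_unit F = on_arr F (eps B X)"

text \<open>The composite of \<open>F\<close> and \<open>G\<close>, with its comparison arrows, is the identity monoidal functor.\<close>

definition left_inverse ::
  "('o, 'a) pcb_sig \<Rightarrow> ('o, 'a, 'p, 'b) monoidal_map \<Rightarrow> ('p, 'b, 'o, 'a) monoidal_map \<Rightarrow> bool" where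
  "left_inverse B F G \<longleftrightarrow>
     (\<forall>X \<in> obj B. on_obj G (on_obj F X) = X) \<and>
     (\<forall>X \<in> obj B. \<forall>Y \<in> obj B. \<forall>f \<in> hom B X Y. on_arr G (on_arr F f) = f) \<and>
     (\<forall>X \<in> obj B. \<forall>Y \<in> obj B.
        on_tensor G (on_obj F X) (on_obj F Y) ;;\<^bsub>B\<^esub> on_arr G (on_tensor F X Y)
          = idt B (X \<boxplus>\<^bsub>B\<^esub> Y)) \<and>
     on_unit G ;;\<^bsub>B\<^esub> on_arr G (on_unit F) = idt B (unit_obj B)"

definition pcb_isomorphic :: "('o, 'a) pcb_sig \<Rightarrow> ('p, 'b) pcb_sig \<Rightarrow> bool"
    (infix "\<cong>\<^sub>p\<^sub>c\<^sub>b" 50) where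
  "B \<cong>\<^sub>p\<^sub>c\<^sub>b C \<longleftrightarrow>
     (\<exists>F G. pcb_morphism B C F \<and> pcb_morphism C B G \<and> left_inverse B F G \<and> left_inverse C G F)"


section \<open>Cospans of finite ordinals\<close>

text \<open>Functions between finite ordinals are represented by their extensional HOL functions.\<close>

definition Fn :: "nat \<Rightarrow> nat \<Rightarrow> (nat \<Rightarrow> nat) set" where
  "Fn n m = {..<n} \<rightarrow>\<^sub>E {..<m}"

definition fn_id :: "nat \<Rightarrow> nat \<Rightarrow> nat" where
  "fn_id n = restrict (\<lambda>i. i) {..<n}"

text \<open>\<open>fn_id 0\<close> is also the unique function from \<open>0\<close> to any ordinal.\<close>

definition fn_copair :: "nat \<Rightarrow> nat \<Rightarrow> (nat \<Rightarrow> nat) \<Rightarrow> (nat \<Rightarrow> nat) \<Rightarrow> nat \<Rightarrow> nat" where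
  "fn_copair n m f g = restrict (\<lambda>i. if i < n then f i else g (i - n)) {..<n + m}"

definition is_pushout ::
  "nat \<Rightarrow> nat \<Rightarrow> nat \<Rightarrow> (nat \<Rightarrow> nat) \<Rightarrow> (nat \<Rightarrow> nat) \<Rightarrow> nat \<Rightarrow> (nat \<Rightarrow> nat) \<Rightarrow> (nat \<Rightarrow> nat) \<Rightarrow> bool" where
  "is_pushout k A B f g P i j \<longleftrightarrow>
     i \<in> Fn A P \<and> j \<in> Fn B P \<and> compose {..<k} i f = compose {..<k} j g \<and>
     (\<forall>Q. \<forall>u \<in> Fn A Q. \<forall>v \<in> Fn B Q. compose {..<k} u f = compose {..<k} v g \<longrightarrow>
        (\<exists>!h. h \<in> Fn P Q \<and> compose {..<A} h i = u \<and> compose {..<B} h j = v))"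

record cospan =
  src :: nat
  tgt :: nat
  apex :: nat
  lleg :: "nat \<Rightarrow> nat"
  rleg :: "nat \<Rightarrow> nat"

definition cospans :: "nat \<Rightarrow> nat \<Rightarrow> cospan set" where
  "cospans n m = {c. src c = n \<and> tgt c = m \<and> lleg c \<in> Fn n (apex c) \<and> rleg c \<in> Fn m (apex c)}"

definition cospan_map :: "cospan \<Rightarrow> cospan \<Rightarrow> (nat \<Rightarrow> nat) \<Rightarrow> bool" where
  "cospan_map c d h \<longleftrightarrow> src c = src d \<and> tgt c = tgt d \<and> h \<in> Fn (apex c) (apex d) \<and>
     compose {..<src c} h (lleg c) = lleg d \<and> compose {..<tgt c} h (rleg c) = rleg d"

definition cospan_iso :: "cospan \<Rightarrow> cospan \<Rightarrow> bool" where
  "cospan_iso c d \<longleftrightarrow> (\<exists>h. cospan_map c d h \<and> bij_betw h {..<apex c} {..<apex d})"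

definition cospan_class :: "cospan \<Rightarrow> cospan set" where
  "cospan_class c = {d \<in> cospans (src c) (tgt c). cospan_iso c d}"

definition cospan_pushout :: "cospan \<Rightarrow> cospan \<Rightarrow> cospan \<Rightarrow> bool" where
  "cospan_pushout c d e \<longleftrightarrow> tgt c = src d \<and> src e = src c \<and> tgt e = tgt d \<and>
     (\<exists>i j. is_pushout (tgt c) (apex c) (apex d) (rleg c) (lleg d) (apex e) i j \<and>
        lleg e = compose {..<src c} i (lleg c) \<and> rleg e = compose {..<tgt d} j (rleg d))"

definition cospan_sum :: "cospan \<Rightarrow> cospan \<Rightarrow> cospan" where
  "cospan_sum c d =
     \<lparr>src = src c + src d, tgt = tgt c + tgt d, apex = apex c + apex d,
      lleg = fn_copair (src c) (src d) (lleg c) (\<lambda>i. apex c + lleg d i),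
      rleg = fn_copair (tgt c) (tgt d) (rleg c) (\<lambda>i. apex c + rleg d i)\<rparr>"

definition fn_cospan :: "nat \<Rightarrow> nat \<Rightarrow> (nat \<Rightarrow> nat) \<Rightarrow> cospan set" where
  "fn_cospan n m f = cospan_class \<lparr>src = n, tgt = m, apex = m, lleg = f, rleg = fn_id m\<rparr>"

definition fn_cospan_op :: "nat \<Rightarrow> nat \<Rightarrow> (nat \<Rightarrow> nat) \<Rightarrow> cospan set" where
  "fn_cospan_op n m f = cospan_class \<lparr>src = m, tgt = n, apex = m, lleg = fn_id m, rleg = f\<rparr>"

text \<open>
  Arrows are isomorphism classes. The composite of two classes consists of all cospans
  that arise as a pushout composite of representatives.
\<close>

definition Cospan :: "(nat, cospan set) pcb_sig" where
  "Cospan =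
     \<lparr>obj = UNIV,
      hom = (\<lambda>n m. cospan_class ` cospans n m),
      idt = (\<lambda>n. fn_cospan n n (fn_id n)),
      seqc = (\<lambda>a b. {e. \<exists>c \<in> a. \<exists>d \<in> b. cospan_pushout c d e}),
      leq = (\<lambda>a b. \<exists>c \<in> a. \<exists>d \<in> b. \<exists>h. cospan_map d c h),
      unit_obj = 0,
      otensor = (+),
      tensor = (\<lambda>a b. \<Union>c \<in> a. \<Union>d \<in> b. cospan_class (cospan_sum c d)),
      assoc = (\<lambda>n m k. fn_cospan (n + m + k) (n + m + k) (fn_id (n + m + k))),
      assoc_inv = (\<lambda>n m k. fn_cospan (n + m + k) (n + m + k) (fn_id (n + m + k))),
      lunit = (\<lambda>n. fn_cospan n n (fn_id n)),
      runit = (\<lambda>n. fn_cospan n n (fn_id n)),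
      symm = (\<lambda>n m. fn_cospan (n + m) (m + n) (fn_copair n m (\<lambda>i. m + i) (\<lambda>i. i))),
      mu = (\<lambda>n. fn_cospan (n + n) n (fn_copair n n (fn_id n) (fn_id n))),
      eta = (\<lambda>n. fn_cospan 0 n (fn_id 0)),
      delta = (\<lambda>n. fn_cospan_op (n + n) n (fn_copair n n (fn_id n) (fn_id n))),
      eps = (\<lambda>n. fn_cospan_op 0 n (fn_id 0))\<rparr>"


section \<open>The syntactic bicategory on the empty signature\<close>

datatype cb_term =
    Delta | Eps | Mu | Eta | Id0 | Id1 | Sigma1
  | Seq cb_term cb_term  (infixl "\<Zsemi>" 60)
  | Sum cb_term cb_term  (infixl "\<uplus>" 65)

inductive has_sort :: "cb_term \<Rightarrow> nat \<Rightarrow> nat \<Rightarrow> bool" where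
  "has_sort Delta 1 2"
| "has_sort Eps 1 0"
| "has_sort Mu 2 1"
| "has_sort Eta 0 1"
| "has_sort Id0 0 0"
| "has_sort Id1 1 1"
| "has_sort Sigma1 2 2"
| "\<lbrakk>has_sort c n k; has_sort d k m\<rbrakk> \<Longrightarrow> has_sort (c \<Zsemi> d) n m"
| "\<lbrakk>has_sort c n m; has_sort d p q\<rbrakk> \<Longrightarrow> has_sort (c \<uplus> d) (n + p) (m + q)"

text \<open>Identities, symmetries, monoids and comonoids on \<open>n\<close> are the usual ones
  generated by those on \<open>1\<close>; \<open>sym1_tm n\<close> is the symmetry of \<open>n\<close> and \<open>1\<close>.\<close>

primrec id_tm :: "nat \<Rightarrow> cb_term" where
  "id_tm 0 = Id0"
| "id_tm (Suc n) = id_tm n \<uplus> Id1"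

primrec sym1_tm :: "nat \<Rightarrow> cb_term" where
  "sym1_tm 0 = Id1"
| "sym1_tm (Suc n) = (id_tm n \<uplus> Sigma1) \<Zsemi> (sym1_tm n \<uplus> Id1)"

primrec sym_tm :: "nat \<Rightarrow> nat \<Rightarrow> cb_term" where
  "sym_tm n 0 = id_tm n"
| "sym_tm n (Suc m) = (sym_tm n m \<uplus> Id1) \<Zsemi> (id_tm m \<uplus> sym1_tm n)"

primrec mu_tm :: "nat \<Rightarrow> cb_term" where
  "mu_tm 0 = Id0"
| "mu_tm (Suc n) = (id_tm n \<uplus> sym_tm 1 n \<uplus> Id1) \<Zsemi> (mu_tm n \<uplus> Mu)"

primrec eta_tm :: "nat \<Rightarrow> cb_term" where
  "eta_tm 0 = Id0"
| "eta_tm (Suc n) = eta_tm n \<uplus> Eta"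

primrec delta_tm :: "nat \<Rightarrow> cb_term" where
  "delta_tm 0 = Id0"
| "delta_tm (Suc n) = (delta_tm n \<uplus> Delta) \<Zsemi> (id_tm n \<uplus> sym_tm n 1 \<uplus> Id1)"

primrec eps_tm :: "nat \<Rightarrow> cb_term" where
  "eps_tm 0 = Id0"
| "eps_tm (Suc n) = eps_tm n \<uplus> Eps"

text \<open>\<open>cb_eq n m\<close> is the congruence on terms of sort \<open>(n, m)\<close>. The laws for \<open>sym_tm\<close>
  are those of a strict symmetry; \<open>cb_hexagon\<close> and \<open>cb_sym_generator\<close> already follow from the
  definition of \<open>sym_tm\<close> and the other laws.\<close>

inductive cb_eq :: "nat \<Rightarrow> nat \<Rightarrow> cb_term \<Rightarrow> cb_term \<Rightarrow> bool" where
  cb_refl: "has_sort c n m \<Longrightarrow> cb_eq n m c c"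
| cb_sym: "cb_eq n m c d \<Longrightarrow> cb_eq n m d c"
| cb_trans: "\<lbrakk>cb_eq n m c d; cb_eq n m d e\<rbrakk> \<Longrightarrow> cb_eq n m c e"
| cb_cong_seq: "\<lbrakk>cb_eq n k c c'; cb_eq k m d d'\<rbrakk> \<Longrightarrow> cb_eq n m (c \<Zsemi> d) (c' \<Zsemi> d')"
| cb_cong_sum: "\<lbrakk>cb_eq n m c c'; cb_eq p q d d'\<rbrakk>
    \<Longrightarrow> cb_eq (n + p) (m + q) (c \<uplus> d) (c' \<uplus> d')"
| cb_seq_assoc: "\<lbrakk>has_sort c n k; has_sort d k l; has_sort e l m\<rbrakk>
    \<Longrightarrow> cb_eq n m ((c \<Zsemi> d) \<Zsemi> e) (c \<Zsemi> (d \<Zsemi> e))"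
| cb_seq_id_left: "has_sort c n m \<Longrightarrow> cb_eq n m (id_tm n \<Zsemi> c) c"
| cb_seq_id_right: "has_sort c n m \<Longrightarrow> cb_eq n m (c \<Zsemi> id_tm m) c"
| cb_sum_assoc: "\<lbrakk>has_sort c n m; has_sort d p q; has_sort e r s\<rbrakk>
    \<Longrightarrow> cb_eq (n + p + r) (m + q + s) ((c \<uplus> d) \<uplus> e) (c \<uplus> (d \<uplus> e))"
| cb_sum_id_left: "has_sort c n m \<Longrightarrow> cb_eq n m (Id0 \<uplus> c) c"
| cb_sum_id_right: "has_sort c n m \<Longrightarrow> cb_eq n m (c \<uplus> Id0) c"
| cb_interchange: "\<lbrakk>has_sort c n k; has_sort d k m; has_sort c' p l; has_sort d' l q\<rbrakk>
    \<Longrightarrow> cb_eq (n + p) (m + q) ((c \<Zsemi> d) \<uplus> (c' \<Zsemi> d')) ((c \<uplus> c') \<Zsemi> (d \<uplus> d'))"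
| cb_sym_natural: "\<lbrakk>has_sort c n m; has_sort d p q\<rbrakk>
    \<Longrightarrow> cb_eq (n + p) (q + m) ((c \<uplus> d) \<Zsemi> sym_tm m q) (sym_tm n p \<Zsemi> (d \<uplus> c))"
| cb_sym_sym: "cb_eq (n + m) (n + m) (sym_tm n m \<Zsemi> sym_tm m n) (id_tm (n + m))"
| cb_hexagon: "cb_eq (n + m + k) (m + k + n)
    (sym_tm n (m + k)) ((sym_tm n m \<uplus> id_tm k) \<Zsemi> (id_tm m \<uplus> sym_tm n k))"
| cb_sym_generator: "cb_eq 2 2 (sym_tm 1 1) Sigma1"
| cb_delta_assoc: "cb_eq 1 3 (Delta \<Zsemi> (Delta \<uplus> Id1)) (Delta \<Zsemi> (Id1 \<uplus> Delta))"
| cb_delta_unit: "cb_eq 1 1 (Delta \<Zsemi> (Eps \<uplus> Id1)) Id1"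
| cb_delta_comm: "cb_eq 1 2 (Delta \<Zsemi> Sigma1) Delta"
| cb_mu_assoc: "cb_eq 3 1 ((Mu \<uplus> Id1) \<Zsemi> Mu) ((Id1 \<uplus> Mu) \<Zsemi> Mu)"
| cb_mu_unit: "cb_eq 1 1 ((Eta \<uplus> Id1) \<Zsemi> Mu) Id1"
| cb_mu_comm: "cb_eq 2 1 (Sigma1 \<Zsemi> Mu) Mu"
| cb_frobenius_left: "cb_eq 2 2 ((Delta \<uplus> Id1) \<Zsemi> (Id1 \<uplus> Mu)) (Mu \<Zsemi> Delta)"
| cb_frobenius_right: "cb_eq 2 2 ((Id1 \<uplus> Delta) \<Zsemi> (Mu \<uplus> Id1)) (Mu \<Zsemi> Delta)"
| cb_special: "cb_eq 1 1 (Delta \<Zsemi> Mu) Id1"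

text \<open>The precongruence on arrows, presented on representatives.\<close>

inductive cb_le :: "nat \<Rightarrow> nat \<Rightarrow> cb_term \<Rightarrow> cb_term \<Rightarrow> bool" where
  cb_le_eq: "cb_eq n m c d \<Longrightarrow> cb_le n m c d"
| cb_le_trans: "\<lbrakk>cb_le n m c d; cb_le n m d e\<rbrakk> \<Longrightarrow> cb_le n m c e"
| cb_le_seq: "\<lbrakk>cb_le n k c c'; cb_le k m d d'\<rbrakk> \<Longrightarrow> cb_le n m (c \<Zsemi> d) (c' \<Zsemi> d')"
| cb_le_sum: "\<lbrakk>cb_le n m c c'; cb_le p q d d'\<rbrakk>
    \<Longrightarrow> cb_le (n + p) (m + q) (c \<uplus> d) (c' \<uplus> d')"
| cb_le_eps_eta: "cb_le 1 1 Id1 (Eps \<Zsemi> Eta)"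
| cb_le_eta_eps: "cb_le 0 0 (Eta \<Zsemi> Eps) Id0"
| cb_le_delta_mu: "cb_le 1 1 Id1 (Delta \<Zsemi> Mu)"
| cb_le_mu_delta: "cb_le 2 2 (Mu \<Zsemi> Delta) (id_tm 2)"

definition cb_class :: "cb_term \<Rightarrow> cb_term set" where
  "cb_class c = {d. \<exists>n m. cb_eq n m c d}"

definition CB :: "(nat, cb_term set) pcb_sig" where
  "CB =
     \<lparr>obj = UNIV,
      hom = (\<lambda>n m. cb_class ` {c. has_sort c n m}),
      idt = (\<lambda>n. cb_class (id_tm n)),
      seqc = (\<lambda>a b. \<Union>c \<in> a. \<Union>d \<in> b. cb_class (c \<Zsemi> d)),
      leq = (\<lambda>a b. \<exists>c \<in> a. \<exists>d \<in> b. \<exists>n m. cb_le n m c d),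
      unit_obj = 0,
      otensor = (+),
      tensor = (\<lambda>a b. \<Union>c \<in> a. \<Union>d \<in> b. cb_class (c \<uplus> d)),
      assoc = (\<lambda>n m k. cb_class (id_tm (n + m + k))),
      assoc_inv = (\<lambda>n m k. cb_class (id_tm (n + m + k))),
      lunit = (\<lambda>n. cb_class (id_tm n)),
      runit = (\<lambda>n. cb_class (id_tm n)),
      symm = (\<lambda>n m. cb_class (sym_tm n m)),
      mu = (\<lambda>n. cb_class (mu_tm n)),
      eta = (\<lambda>n. cb_class (eta_tm n)),
      delta = (\<lambda>n. cb_class (delta_tm n)),
      eps = (\<lambda>n. cb_class (eps_tm n))\<rparr>"

end

theory Submission
  imports Defs "HOL-Combinatorics.Permutations"
begin

text \<open>
  Interpreting terms in cospans is functorial because \<open>Cospan\<close> is itself a cartesian bicategory; the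
  point is completeness. A term built from \<open>Mu\<close>, \<open>Eta\<close> and \<open>Sigma1\<close> denotes a function between
  ordinals and equals a canonical term that adds the inputs one at a time, so it is determined by that
  function. Frobenius and speciality move all comonoid generators behind all monoid generators, so
  every arrow factors as \<open>M ; W\<^sup>o\<^sup>p\<close> with \<open>M\<close>, \<open>W\<close> monoid arrows, that is, as a cospan; isomorphic cospans
  differ by a permutation \<open>P\<close>, which satisfies \<open>P ; P\<^sup>o\<^sup>p = id\<close>. A map of cospans \<open>h\<close> rewrites the smaller arrow
  as \<open>M ; H ; H\<^sup>o\<^sup>p ; W\<^sup>o\<^sup>p\<close>, and \<open>H ; H\<^sup>o\<^sup>p \<le> id\<close> follows from the generating inequalities. The axioms
  for \<open>CB\<close> on arbitrary objects are then pulled back from \<open>Cospan\<close>.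
\<close>

section \<open>Pointwise description of cospans\<close>

text \<open>The passage to canonical forms never records which function results: carrying a
  generator through a canonical term only shows that some function exists, and the interpretation as
  cospans recovers it afterwards. Once monoid arrows are known to be determined by their functions,
  further equations between them can be checked pointwise. Factorization amounts to computing
  pushouts one generator at a time. Only \<open>Mu\<close> and \<open>Eta\<close> arriving behind a
  reversed monoid arrow can obstruct it. \<open>Eta\<close> has no inputs and slides past. For
  \<open>Mu\<close>, the two inputs of the canonical term that meet it either land in one wire,
  where speciality cancels the copy against a merge, or in two wires, which a permutation brings to
  the end, where Frobenius leaves merges followed by one copy. Faithfulness of the interpretation is
  thus available before \<open>CB\<close> is known to be a bicategory, so its laws on
  \<open>n\<close> wires can be imported without an induction over \<open>mu_tm\<close>. On the
  cospan side the obstacle is that a composite collects all pushouts of all representatives; it is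
  first reduced to one arbitrarily chosen pushout.\<close>

definition maps :: "(nat \<Rightarrow> nat) \<Rightarrow> nat \<Rightarrow> nat \<Rightarrow> bool" where
  "maps f n m \<longleftrightarrow> (\<forall>i<n. f i < m)"

lemma mapsD: "maps f n m \<Longrightarrow> i < n \<Longrightarrow> f i < m"
  by (simp add: maps_def)

lemma restrict_Fn: "restrict f {..<n} \<in> Fn n m \<longleftrightarrow> maps f n m"
  by (auto simp: Fn_def maps_def PiE_iff)

lemma Fn_maps: "f \<in> Fn n m \<Longrightarrow> maps f n m \<and> restrict f {..<n} = f"
  by (auto simp: Fn_def maps_def PiE_iff extensional_restrict)

lemma restrict_eq_iff: "restrict f {..<n} = restrict g {..<n} \<longleftrightarrow> (\<forall>i<n. f i = g i)"
  by (auto simp: restrict_def fun_eq_iff)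

text \<open>Legs are restricted only here. Elsewhere they are arbitrary HOL functions of which only
  the values below the bound matter, so they can be composed and compared pointwise.\<close>

definition cmk :: "nat \<Rightarrow> nat \<Rightarrow> nat \<Rightarrow> (nat \<Rightarrow> nat) \<Rightarrow> (nat \<Rightarrow> nat) \<Rightarrow> cospan" where
  "cmk n m A l r = \<lparr>src = n, tgt = m, apex = A, lleg = restrict l {..<n}, rleg = restrict r {..<m}\<rparr>"

definition mk :: "nat \<Rightarrow> nat \<Rightarrow> nat \<Rightarrow> (nat \<Rightarrow> nat) \<Rightarrow> (nat \<Rightarrow> nat) \<Rightarrow> cospan set" where
  "mk n m A l r = cospan_class (cmk n m A l r)"

definition ciso where
  "ciso n m A l r B l' r' h \<longleftrightarrow> bij_betw h {..<A} {..<B} \<and> (\<forall>i<n. h (l i) = l' i) \<and> (\<forall>i<m. h (r i) = r' i)"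

lemma cmk_sel [simp]: "src (cmk n m A l r) = n" "tgt (cmk n m A l r) = m" "apex (cmk n m A l r) = A"
    "lleg (cmk n m A l r) = restrict l {..<n}" "rleg (cmk n m A l r) = restrict r {..<m}"
  by (simp_all add: cmk_def)

lemma cmk_cospans: "cmk n m A l r \<in> cospans n' m' \<longleftrightarrow> n = n' \<and> m = m' \<and> maps l n A \<and> maps r m A"
  by (auto simp: cospans_def restrict_Fn)

lemma cospans_cmkE:
  assumes "c \<in> cospans n m"
  obtains A l r where "c = cmk n m A l r" "maps l n A" "maps r m A"
proof
  show "c = cmk n m (apex c) (lleg c) (rleg c)"
    using assms by (auto simp: cmk_def cospans_def dest!: Fn_maps)
qed (use assms in \<open>auto simp: cospans_def dest: Fn_maps\<close>)

lemma cospan_map_cmk: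
  assumes "maps l n A" "maps r m A"
  shows "cospan_map (cmk n m A l r) (cmk n' m' B l' r') h \<longleftrightarrow> n = n' \<and> m = m' \<and> h \<in> Fn A B \<and>
    (\<forall>i<n. h (l i) = l' i) \<and> (\<forall>i<m. h (r i) = r' i)"
  using assms by (auto simp: cospan_map_def compose_def restrict_eq_iff)

lemma cospan_iso_cmk:
  assumes "maps l n A" "maps r m A"
  shows "cospan_iso (cmk n m A l r) (cmk n' m' B l' r') \<longleftrightarrow>
    n = n' \<and> m = m' \<and> (\<exists>h. ciso n m A l r B l' r' h)"
proof
  assume "cospan_iso (cmk n m A l r) (cmk n' m' B l' r')"
  then show "n = n' \<and> m = m' \<and> (\<exists>h. ciso n m A l r B l' r' h)"
    by (auto simp: cospan_iso_def cospan_map_cmk[OF assms] ciso_def)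
next
  assume "n = n' \<and> m = m' \<and> (\<exists>h. ciso n m A l r B l' r' h)"
  then obtain h where h: "n = n'" "m = m'" "ciso n m A l r B l' r' h" by blast
  have "bij_betw (restrict h {..<A}) {..<A} {..<B}"
    using h(3) bij_betw_cong[of "{..<A}" "restrict h {..<A}" h] by (simp add: ciso_def)
  moreover have "restrict h {..<A} \<in> Fn A B"
    using h(3) by (auto simp: restrict_Fn maps_def ciso_def bij_betw_def)
  ultimately show "cospan_iso (cmk n m A l r) (cmk n' m' B l' r')"
    unfolding cospan_iso_def cospan_map_cmk[OF assms]
    using h assms by (intro exI[of _ "restrict h {..<A}"]) (auto simp: ciso_def maps_def)
qed

text \<open>Puts every element of a class into \<open>cmk\<close> form together with an isomorphism,
  which turns statements about classes into statements about representatives.\<close>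

lemma mem_mk:
  assumes "maps l n A" "maps r m A"
  shows "c \<in> mk n m A l r \<longleftrightarrow>
    (\<exists>B l' r' h. c = cmk n m B l' r' \<and> maps l' n B \<and> maps r' m B \<and> ciso n m A l r B l' r' h)"
proof
  assume "c \<in> mk n m A l r"
  then have c: "c \<in> cospans n m" "cospan_iso (cmk n m A l r) c"
    by (auto simp: mk_def cospan_class_def)
  then show "\<exists>B l' r' h. c = cmk n m B l' r' \<and> maps l' n B \<and> maps r' m B \<and> ciso n m A l r B l' r' h"
    by (metis cospans_cmkE cospan_iso_cmk[OF assms])
next
  assume "\<exists>B l' r' h. c = cmk n m B l' r' \<and> maps l' n B \<and> maps r' m B \<and> ciso n m A l r B l' r' h"
  then show "c \<in> mk n m A l r"
    using cospan_iso_cmk[OF assms] by (auto simp: mk_def cospan_class_def cmk_cospans)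
qed

lemma ciso_refl: "ciso n m A l r A l r (\<lambda>x. x)"
  by (simp add: ciso_def bij_betw_def inj_on_def)

lemma ciso_sym:
  assumes "ciso n m A l r B l' r' h" "maps l n A" "maps r m A"
  shows "ciso n m B l' r' A l r (inv_into {..<A} h)"
proof -
  have b: "bij_betw h {..<A} {..<B}" using assms by (simp add: ciso_def)
  have "inv_into {..<A} h (h x) = x" if "x < A" for x
    using b that by (simp add: bij_betw_inv_into_left)
  with assms show ?thesis
    unfolding ciso_def using bij_betw_inv_into[OF b] by (metis mapsD)
qed

lemma ciso_trans:
  assumes "ciso n m A l r B l' r' h" "ciso n m B l' r' C l'' r'' h'"
  shows "ciso n m A l r C l'' r'' (h' \<circ> h)"
  using assms bij_betw_trans[of h _ _ h'] unfolding ciso_def by auto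

lemma mk_eqI:
  assumes "ciso n m A l r B l' r' h" "maps l n A" "maps r m A"
  shows "mk n m A l r = mk n m B l' r'"
proof -
  have m: "maps l' n B" "maps r' m B"
    using assms unfolding ciso_def maps_def bij_betw_def by (metis imageI lessThan_iff)+
  have s: "ciso n m B l' r' A l r (inv_into {..<A} h)" using ciso_sym[OF assms] .
  show ?thesis
    unfolding set_eq_iff mem_mk[OF assms(2,3)] mem_mk[OF m]
    using ciso_trans[OF s] ciso_trans[OF assms(1)] by blast
qed

lemma mk_cong:
  assumes "n = n'" "m = m'" "A = A'" "\<And>i. i < n \<Longrightarrow> l i = l' i" "\<And>i. i < m \<Longrightarrow> r i = r' i"
  shows "mk n m A l r = mk n' m' A' l' r'"
proof -
  have "restrict l {..<n} = restrict l' {..<n}" "restrict r {..<m} = restrict r' {..<m}"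
    using assms by (auto simp: restrict_eq_iff)
  then show ?thesis using assms by (simp add: mk_def cmk_def)
qed

lemma mk_self: "maps l n A \<Longrightarrow> maps r m A \<Longrightarrow> cmk n m A l r \<in> mk n m A l r"
  using mem_mk ciso_refl by blast

text \<open>Besides the isomorphism this yields uniqueness of source and target for arrows of
  \<open>Cospan\<close>.\<close>

lemma mk_eqD:
  assumes "mk n m A l r = mk n' m' B l' r'" "maps l n A" "maps r m A" "maps l' n' B" "maps r' m' B"
  shows "n = n' \<and> m = m' \<and> (\<exists>h. ciso n m A l r B l' r' h)"
proof -
  have "cmk n' m' B l' r' \<in> mk n m A l r"
    using mk_self[of l' n' B r' m'] assms by simp
  then have "cospan_iso (cmk n m A l r) (cmk n' m' B l' r')"
    by (simp add: mk_def cospan_class_def)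
  then show ?thesis using cospan_iso_cmk[OF assms(2,3)] by blast
qed

lemma hom_Cospan: "f \<in> hom Cospan n m \<longleftrightarrow> (\<exists>A l r. maps l n A \<and> maps r m A \<and> f = mk n m A l r)"
proof
  assume "f \<in> hom Cospan n m"
  then obtain c where "c \<in> cospans n m" "f = cospan_class c" by (auto simp: Cospan_def)
  then show "\<exists>A l r. maps l n A \<and> maps r m A \<and> f = mk n m A l r"
    by (metis cospans_cmkE mk_def)
next
  assume "\<exists>A l r. maps l n A \<and> maps r m A \<and> f = mk n m A l r"
  then show "f \<in> hom Cospan n m"
    by (auto simp: Cospan_def mk_def cmk_cospans)
qed

lemma mk_hom: "maps l n A \<Longrightarrow> maps r m A \<Longrightarrow> mk n m A l r \<in> hom Cospan n m"
  by (auto simp: hom_Cospan)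

text \<open>The order quantifies over representatives. Conjugating a map of cospans with the
  isomorphisms to the given representatives shows that the choice is immaterial; note that the map
  runs from the larger arrow to the smaller one.\<close>

lemma leq_mk:
  assumes "maps l n A" "maps r m A" "maps l' n B" "maps r' m B"
  shows "mk n m A l r \<preceq>\<^bsub>Cospan\<^esub> mk n m B l' r' \<longleftrightarrow>
    (\<exists>h. maps h B A \<and> (\<forall>i<n. h (l' i) = l i) \<and> (\<forall>i<m. h (r' i) = r i))"
proof
  assume "mk n m A l r \<preceq>\<^bsub>Cospan\<^esub> mk n m B l' r'"
  then obtain c d h where "c \<in> mk n m A l r" "d \<in> mk n m B l' r'" and h: "cospan_map d c h"
    by (auto simp: Cospan_def)
  then obtain A1 l1 r1 h1 B1 l2 r2 h2 where
    c: "c = cmk n m A1 l1 r1" "maps l1 n A1" "maps r1 m A1" "ciso n m A l r A1 l1 r1 h1" and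
    d: "d = cmk n m B1 l2 r2" "maps l2 n B1" "maps r2 m B1" "ciso n m B l' r' B1 l2 r2 h2"
    using assms by (auto simp: mem_mk)
  define g where "g = inv_into {..<A} h1"
  have g: "ciso n m A1 l1 r1 A l r g" using ciso_sym[OF c(4) assms(1,2)] by (simp add: g_def)
  have hh: "h \<in> Fn B1 A1" "\<And>i. i < n \<Longrightarrow> h (l2 i) = l1 i" "\<And>i. i < m \<Longrightarrow> h (r2 i) = r1 i"
    using h unfolding c(1) d(1) by (auto simp: cospan_map_cmk[OF d(2,3)])
  have "maps h B1 A1" using hh(1) Fn_maps by blast
  moreover have "maps g A1 A" "maps h2 B B1"
    using g d(4) by (auto simp: maps_def ciso_def bij_betw_def)
  ultimately have "maps (g \<circ> h \<circ> h2) B A" by (simp add: maps_def)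
  moreover have "\<forall>i<n. (g \<circ> h \<circ> h2) (l' i) = l i" "\<forall>i<m. (g \<circ> h \<circ> h2) (r' i) = r i"
    using g d(4) hh by (auto simp: ciso_def)
  ultimately show "\<exists>h. maps h B A \<and> (\<forall>i<n. h (l' i) = l i) \<and> (\<forall>i<m. h (r' i) = r i)" by blast
next
  assume "\<exists>h. maps h B A \<and> (\<forall>i<n. h (l' i) = l i) \<and> (\<forall>i<m. h (r' i) = r i)"
  then obtain h where h: "maps h B A" "\<forall>i<n. h (l' i) = l i" "\<forall>i<m. h (r' i) = r i" by blast
  have "cospan_map (cmk n m B l' r') (cmk n m A l r) (restrict h {..<B})"
    using h assms by (auto simp: cospan_map_cmk restrict_Fn maps_def)
  then show "mk n m A l r \<preceq>\<^bsub>Cospan\<^esub> mk n m B l' r'"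
    using mk_self[OF assms(1,2)] mk_self[OF assms(3,4)] unfolding Cospan_def by (simp; blast)
qed

section \<open>Sums of cospans\<close>

definition cp :: "nat \<Rightarrow> (nat \<Rightarrow> nat) \<Rightarrow> (nat \<Rightarrow> nat) \<Rightarrow> nat \<Rightarrow> nat" where
  "cp n f g = (\<lambda>i. if i < n then f i else g (i - n))"

lemma maps_cp: "maps f n k \<Longrightarrow> maps g m k \<Longrightarrow> maps (cp n f g) (n + m) k"
  by (auto simp: maps_def cp_def)

lemma maps_cp_sum: "maps f n k \<Longrightarrow> maps g m j \<Longrightarrow> maps (cp n f (\<lambda>i. k + g i)) (n + m) (k + j)"
  by (fastforce simp: maps_def cp_def)

lemma sum_cmk: "cospan_sum (cmk n m A l r) (cmk n' m' B l' r') =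
  cmk (n + n') (m + m') (A + B) (cp n l (\<lambda>i. A + l' i)) (cp m r (\<lambda>i. A + r' i))"
  by (auto simp: cospan_sum_def cmk_def fn_copair_def cp_def restrict_def fun_eq_iff)

lemma bij_cp:
  assumes "bij_betw f {..<A} {..<A'}" "bij_betw g {..<B} {..<B'}"
  shows "bij_betw (cp A f (\<lambda>i. A' + g i)) {..<A + B} {..<A' + B'}"
proof -
  define h where "h = cp A f (\<lambda>i. A' + g i)"
  define h' where "h' = cp A' (inv_into {..<A} f) (\<lambda>i. A + inv_into {..<B} g i)"
  have f: "f x < A'" "inv_into {..<A} f (f x) = x" if "x < A" for x
    using assms(1) that by (auto simp: bij_betw_def)
  have g: "g x < B'" "inv_into {..<B} g (g x) = x" if "x < B" for x
    using assms(2) that by (auto simp: bij_betw_def)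
  have f': "inv_into {..<A} f x < A" "f (inv_into {..<A} f x) = x" if "x < A'" for x
    using bij_betwE[OF bij_betw_inv_into[OF assms(1)]] bij_betw_inv_into_right[OF assms(1)] that by auto
  have g': "inv_into {..<B} g x < B" "g (inv_into {..<B} g x) = x" if "x < B'" for x
    using bij_betwE[OF bij_betw_inv_into[OF assms(2)]] bij_betw_inv_into_right[OF assms(2)] that by auto
  have "h x < A' + B' \<and> h' (h x) = x" if "x < A + B" for x
    using f[of x] g[of "x - A"] that by (auto simp: h_def h'_def cp_def)
  moreover have "h' x < A + B \<and> h (h' x) = x" if "x < A' + B'" for x
    using f'[of x] g'[of "x - A'"] that by (auto simp: h_def h'_def cp_def)
  ultimately have "bij_betw h {..<A + B} {..<A' + B'}"
    by (intro bij_betw_byWitness[of _ h']) auto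
  then show ?thesis by (simp add: h_def)
qed

lemma tensor_mk:
  assumes "maps l n A" "maps r m A" "maps l' n' B" "maps r' m' B"
  shows "mk n m A l r \<oplus>\<^bsub>Cospan\<^esub> mk n' m' B l' r' =
    mk (n + n') (m + m') (A + B) (cp n l (\<lambda>i. A + l' i)) (cp m r (\<lambda>i. A + r' i))"
proof -
  have *: "cospan_class (cospan_sum c d) = mk (n + n') (m + m') (A + B) (cp n l (\<lambda>i. A + l' i)) (cp m r (\<lambda>i. A + r' i))"
    if cd: "c \<in> mk n m A l r" "d \<in> mk n' m' B l' r'" for c d
  proof -
    from cd assms obtain A1 l1 r1 h1 B1 l2 r2 h2 where
      c: "c = cmk n m A1 l1 r1" "maps l1 n A1" "maps r1 m A1" "ciso n m A l r A1 l1 r1 h1" and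
      d: "d = cmk n' m' B1 l2 r2" "maps l2 n' B1" "maps r2 m' B1" "ciso n' m' B l' r' B1 l2 r2 h2"
      by (auto simp: mem_mk)
    have "ciso (n + n') (m + m') (A + B) (cp n l (\<lambda>i. A + l' i)) (cp m r (\<lambda>i. A + r' i))
       (A1 + B1) (cp n l1 (\<lambda>i. A1 + l2 i)) (cp m r1 (\<lambda>i. A1 + r2 i)) (cp A h1 (\<lambda>i. A1 + h2 i))"
      using c(4) d(4) assms bij_cp[of h1 A A1 h2 B B1]
      by (auto simp: ciso_def cp_def maps_def)
    from mk_eqI[OF this maps_cp_sum maps_cp_sum] show ?thesis
      using assms by (simp add: c(1) d(1) sum_cmk flip: mk_def)
  qed
  have "cmk n m A l r \<in> mk n m A l r" "cmk n' m' B l' r' \<in> mk n' m' B l' r'"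
    using assms by (auto intro: mk_self)
  with * show ?thesis unfolding Cospan_def by (simp; blast)
qed

section \<open>Pushouts\<close>

text \<open>The uniqueness half of the universal property is replaced by joint surjectivity.\<close>

definition po where
  "po k A B f g P i j \<longleftrightarrow> maps f k A \<and> maps g k B \<and> maps i A P \<and> maps j B P \<and>
     (\<forall>x<k. i (f x) = j (g x)) \<and> (\<forall>p<P. (\<exists>a<A. i a = p) \<or> (\<exists>b<B. j b = p)) \<and>
     (\<forall>Q u v. maps u A Q \<and> maps v B Q \<and> (\<forall>x<k. u (f x) = v (g x)) \<longrightarrow>
        (\<exists>h. maps h P Q \<and> (\<forall>a<A. h (i a) = u a) \<and> (\<forall>b<B. h (j b) = v b)))"

lemma po_univ:
  assumes "po k A B f g P i j" "maps u A Q" "maps v B Q" "\<And>x. x < k \<Longrightarrow> u (f x) = v (g x)"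
  obtains h where "maps h P Q" "\<And>a. a < A \<Longrightarrow> h (i a) = u a" "\<And>b. b < B \<Longrightarrow> h (j b) = v b"
  using assms unfolding po_def by metis

text \<open>The two mediating maps are mutually inverse: their composites fix the images of the
  injections, and these cover the apex.\<close>

lemma po_iso:
  assumes p: "po k A B f g P i j" and p': "po k A B f g P' i' j'"
  shows "\<exists>h. bij_betw h {..<P} {..<P'} \<and> (\<forall>a<A. h (i a) = i' a) \<and> (\<forall>b<B. h (j b) = j' b)"
proof -
  obtain h where h: "maps h P P'" "\<And>a. a < A \<Longrightarrow> h (i a) = i' a" "\<And>b. b < B \<Longrightarrow> h (j b) = j' b"
    by (rule po_univ[OF p, of i' P' j']) (use p' in \<open>auto simp: po_def\<close>)
  obtain h' where h': "maps h' P' P" "\<And>a. a < A \<Longrightarrow> h' (i' a) = i a" "\<And>b. b < B \<Longrightarrow> h' (j' b) = j b"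
    by (rule po_univ[OF p', of i P j]) (use p in \<open>auto simp: po_def\<close>)
  have surj: "(\<exists>a<A. i a = x) \<or> (\<exists>b<B. j b = x)" if "x < P" for x using p that by (simp add: po_def)
  have surj': "(\<exists>a<A. i' a = x) \<or> (\<exists>b<B. j' b = x)" if "x < P'" for x using p' that by (simp add: po_def)
  have "h' (h x) = x" if "x < P" for x using surj[OF that] h(2,3) h'(2,3) by auto
  moreover have "h (h' x) = x" if "x < P'" for x using surj'[OF that] h(2,3) h'(2,3) by auto
  ultimately have "bij_betw h {..<P} {..<P'}"
    using h(1) h'(1) by (intro bij_betw_byWitness[of _ h']) (auto simp: maps_def)
  with h show ?thesis by blast
qed

text \<open>Being a pushout is invariant under bijections of all three objects. This is what allows
  other representatives, or another apex, to be used for the same composite.\<close>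

lemma po_transport:
  assumes p: "po k A B f g P i j"
    and a: "bij_betw \<alpha> {..<A} {..<A'}" and b: "bij_betw \<beta> {..<B} {..<B'}" and s: "bij_betw \<gamma> {..<P} {..<P'}"
    and fg: "\<And>x. x < k \<Longrightarrow> \<alpha> (f x) = f' x" "\<And>x. x < k \<Longrightarrow> \<beta> (g x) = g' x"
    and ij: "\<And>x. x < A \<Longrightarrow> i' (\<alpha> x) = \<gamma> (i x)" "\<And>x. x < B \<Longrightarrow> j' (\<beta> x) = \<gamma> (j x)"
  shows "po k A' B' f' g' P' i' j'"
proof -
  note q = p[unfolded po_def]
  have A': "x < A' \<longleftrightarrow> (\<exists>y<A. \<alpha> y = x)" for x
    using a unfolding bij_betw_def by (metis image_iff lessThan_iff)
  have B': "x < B' \<longleftrightarrow> (\<exists>y<B. \<beta> y = x)" for x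
    using b unfolding bij_betw_def by (metis image_iff lessThan_iff)
  have P': "x < P' \<longleftrightarrow> (\<exists>y<P. \<gamma> y = x)" for x
    using s unfolding bij_betw_def by (metis image_iff lessThan_iff)
  have univ: "\<exists>h. maps h P' Q \<and> (\<forall>a<A'. h (i' a) = u a) \<and> (\<forall>b<B'. h (j' b) = v b)"
    if uv: "maps u A' Q" "maps v B' Q" "\<forall>x<k. u (f' x) = v (g' x)" for Q u v
  proof -
    have "maps (u \<circ> \<alpha>) A Q" "maps (v \<circ> \<beta>) B Q"
      using uv(1,2) A' B' by (auto simp: maps_def)
    moreover have "(u \<circ> \<alpha>) (f x) = (v \<circ> \<beta>) (g x)" if "x < k" for x
      using uv(3) fg that by simp
    ultimately obtain h where h: "maps h P Q" "\<And>a. a < A \<Longrightarrow> h (i a) = (u \<circ> \<alpha>) a"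
        "\<And>b. b < B \<Longrightarrow> h (j b) = (v \<circ> \<beta>) b"
      using po_univ[OF p] by metis
    have inv: "inv_into {..<P} \<gamma> (\<gamma> x) = x" if "x < P" for x
      using s that by (simp add: bij_betw_inv_into_left)
    have iP: "i x < P" if "x < A" for x using q that by (simp add: maps_def)
    have jP: "j x < P" if "x < B" for x using q that by (simp add: maps_def)
    show ?thesis
      by (rule exI[of _ "h \<circ> inv_into {..<P} \<gamma>"])
        (use h in \<open>auto simp: maps_def A' B' P' ij inv iP jP\<close>)
  qed
  have "maps f' k A'" "maps g' k B'" using q fg by (auto simp: maps_def A' B')
  moreover have "maps i' A' P'"
    unfolding maps_def
  proof (intro allI impI)
    fix x assume "x < A'"
    then obtain y where "y < A" "\<alpha> y = x" using A' by blast
    then show "i' x < P'" using ij(1)[of y] q P' by (auto simp: maps_def)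
  qed
  moreover have "maps j' B' P'"
    unfolding maps_def
  proof (intro allI impI)
    fix x assume "x < B'"
    then obtain y where "y < B" "\<beta> y = x" using B' by blast
    then show "j' x < P'" using ij(2)[of y] q P' by (auto simp: maps_def)
  qed
  moreover have "\<forall>x<k. i' (f' x) = j' (g' x)"
  proof (intro allI impI)
    fix x assume x: "x < k"
    then have "f x < A" "g x < B" "i (f x) = j (g x)" using q by (auto simp: maps_def)
    then show "i' (f' x) = j' (g' x)" using ij fg x by metis
  qed
  moreover have "\<forall>p<P'. (\<exists>a<A'. i' a = p) \<or> (\<exists>b<B'. j' b = p)"
  proof (intro allI impI)
    fix p assume "p < P'"
    then obtain y where y: "y < P" "\<gamma> y = p" using P' by blast
    then consider a where "a < A" "i a = y" | b where "b < B" "j b = y" using q by blast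
    then show "(\<exists>a<A'. i' a = p) \<or> (\<exists>b<B'. j' b = p)"
      by cases (use ij y A' B' in blast)+
  qed
  ultimately show ?thesis unfolding po_def using univ by blast
qed

section \<open>Comparison with the universal property\<close>

lemma is_pushout_po:
  assumes "is_pushout k A B (restrict f {..<k}) (restrict g {..<k}) P i j" "maps f k A" "maps g k B"
  shows "po k A B f g P i j"
proof -
  note p = assms(1)[unfolded is_pushout_def]
  have ij: "maps i A P" "maps j B P" using p by (auto dest: Fn_maps)
  have comm: "\<forall>x<k. i (f x) = j (g x)"
    using p by (auto simp: compose_def restrict_eq_iff)
  have ex1: "\<exists>!h. h \<in> Fn P Q \<and> compose {..<A} h i = restrict u {..<A} \<and> compose {..<B} h j = restrict v {..<B}"
    if "maps u A Q" "maps v B Q" "\<forall>x<k. u (f x) = v (g x)" for Q u v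
  proof -
    have "compose {..<k} (restrict u {..<A}) (restrict f {..<k}) = compose {..<k} (restrict v {..<B}) (restrict g {..<k})"
      using that assms(2,3) by (auto simp: compose_def restrict_eq_iff maps_def)
    then show ?thesis using p that by (simp add: restrict_Fn)
  qed
  have univ: "\<exists>h. maps h P Q \<and> (\<forall>a<A. h (i a) = u a) \<and> (\<forall>b<B. h (j b) = v b)"
    if "maps u A Q" "maps v B Q" "\<forall>x<k. u (f x) = v (g x)" for Q u v
    using ex1_implies_ex[OF ex1[OF that]] ij
    by (auto simp: compose_def restrict_eq_iff dest: Fn_maps)
  have surj: "(\<exists>a<A. i a = p) \<or> (\<exists>b<B. j b = p)" if "p < P" for p
  proof (rule ccontr)
    assume n: "\<not> ((\<exists>a<A. i a = p) \<or> (\<exists>b<B. j b = p))"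
    \<comment> \<open>If both injections missed \<open>p\<close>, the constant map \<open>0\<close>
      and the indicator of \<open>p\<close> would be two mediating maps into the ordinal
      \<open>2\<close>.\<close>
    define h0 where "h0 = restrict (\<lambda>_. 0::nat) {..<P}"
    define h1 where "h1 = restrict (\<lambda>x. if x = p then 1 else 0::nat) {..<P}"
    have "\<exists>!h. h \<in> Fn P 2 \<and> compose {..<A} h i = restrict (\<lambda>_. 0) {..<A} \<and> compose {..<B} h j = restrict (\<lambda>_. 0) {..<B}"
      by (rule ex1) (auto simp: maps_def)
    moreover have "h0 \<in> Fn P 2 \<and> compose {..<A} h0 i = restrict (\<lambda>_. 0) {..<A} \<and> compose {..<B} h0 j = restrict (\<lambda>_. 0) {..<B}"
      using ij by (auto simp: h0_def restrict_Fn maps_def compose_def restrict_eq_iff)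
    moreover have "h1 \<in> Fn P 2 \<and> compose {..<A} h1 i = restrict (\<lambda>_. 0) {..<A} \<and> compose {..<B} h1 j = restrict (\<lambda>_. 0) {..<B}"
      using ij n by (auto simp: h1_def restrict_Fn maps_def compose_def restrict_eq_iff)
    ultimately have "h0 = h1" by blast
    then have "h0 p = h1 p" by simp
    then show False using that by (simp add: h0_def h1_def)
  qed
  show ?thesis unfolding po_def using assms(2,3) ij comm univ surj by blast
qed

lemma po_is_pushout:
  assumes p: "po k A B f g P i j"
  shows "is_pushout k A B (restrict f {..<k}) (restrict g {..<k}) P (restrict i {..<A}) (restrict j {..<B})"
proof -
  note q = p[unfolded po_def]
  have "\<exists>!h. h \<in> Fn P Q \<and> compose {..<A} h (restrict i {..<A}) = u \<and> compose {..<B} h (restrict j {..<B}) = v"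
    if "u \<in> Fn A Q" "v \<in> Fn B Q" and
      c: "compose {..<k} u (restrict f {..<k}) = compose {..<k} v (restrict g {..<k})" for Q u v
  proof -
    have u: "maps u A Q" "restrict u {..<A} = u" and v: "maps v B Q" "restrict v {..<B} = v"
      using Fn_maps that by auto
    have "u (f x) = v (g x)" if "x < k" for x
      using c that by (auto simp: compose_def restrict_eq_iff)
    then obtain h where h: "maps h P Q" "\<And>a. a < A \<Longrightarrow> h (i a) = u a" "\<And>b. b < B \<Longrightarrow> h (j b) = v b"
      using po_univ[OF p u(1) v(1)] by metis
    have eq: "compose {..<A} g (restrict i {..<A}) = u \<and> compose {..<B} g (restrict j {..<B}) = v \<longleftrightarrow>
      (\<forall>a<A. g (i a) = u a) \<and> (\<forall>b<B. g (j b) = v b)" for g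
      by (subst u(2)[symmetric], subst v(2)[symmetric]) (auto simp: compose_def restrict_eq_iff)
    show ?thesis unfolding eq
    proof (rule ex1I[of _ "restrict h {..<P}"])
      show "restrict h {..<P} \<in> Fn P Q \<and> (\<forall>a<A. restrict h {..<P} (i a) = u a) \<and> (\<forall>b<B. restrict h {..<P} (j b) = v b)"
        using h q by (auto simp: restrict_Fn maps_def)
      fix g assume g: "g \<in> Fn P Q \<and> (\<forall>a<A. g (i a) = u a) \<and> (\<forall>b<B. g (j b) = v b)"
      \<comment> \<open>Joint surjectivity is what makes the mediating map unique.\<close>
      have "g x = h x" if "x < P" for x
        using q that g h by metis
      then have "restrict g {..<P} = restrict h {..<P}" by (simp add: restrict_eq_iff)
      then show "g = restrict h {..<P}" using g Fn_maps by metis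
    qed
  qed
  moreover have "compose {..<k} (restrict i {..<A}) (restrict f {..<k}) = compose {..<k} (restrict j {..<B}) (restrict g {..<k})"
    using q by (auto simp: compose_def restrict_eq_iff maps_def)
  ultimately show ?thesis unfolding is_pushout_def using q by (simp add: restrict_Fn)
qed

text \<open>Two points are identified in the pushout iff every cocone identifies them.\<close>

lemma po_exists:
  assumes f: "maps f k A" and g: "maps g k B"
  obtains P i j where "po k A B f g P i j"
proof -
  define cocone where "cocone Q u v \<longleftrightarrow> maps u A Q \<and> maps v B Q \<and> (\<forall>x<k. u (f x) = v (g x))" for Q u v
  define R where "R = {(x, y). x < A + B \<and> y < A + B \<and> (\<forall>Q u v. cocone Q u v \<longrightarrow> cp A u v x = cp A u v y)}"
  have eq: "equiv {..<A + B} R"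
    by (rule equivI) (auto simp: R_def refl_on_def Relation.sym_def trans_def)
  have fin: "finite ({..<A + B} // R)" using eq by (intro finite_quotient) (auto simp: equiv_def refl_on_def R_def)
  \<comment> \<open>An arbitrary numbering of the equivalence classes turns the quotient into a
    finite ordinal.\<close>
  obtain e where e: "bij_betw e ({..<A + B} // R) {..<card ({..<A + B} // R)}"
    using ex_bij_betw_finite_nat[OF fin] by (auto simp: atLeast0LessThan)
  define P where "P = card ({..<A + B} // R)"
  define q where "q x = e (R `` {x})" for x
  have q: "q x < P" if "x < A + B" for x
    using e that by (auto simp: q_def P_def bij_betw_def quotientI)
  have q_eq: "q x = q y \<longleftrightarrow> (x, y) \<in> R" if "x < A + B" "y < A + B" for x y
  proof -
    have "R `` {x} \<in> {..<A + B} // R" "R `` {y} \<in> {..<A + B} // R" using that by (auto intro: quotientI)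
    then have "q x = q y \<longleftrightarrow> R `` {x} = R `` {y}"
      using e by (auto simp: q_def bij_betw_def dest: inj_onD)
    then show ?thesis using that eq_equiv_class_iff[OF eq, of x y] by simp
  qed
  have q_surj: "\<exists>x<A + B. q x = p" if "p < P" for p
  proof -
    have "p \<in> e ` ({..<A + B} // R)" using e that by (auto simp: bij_betw_def P_def)
    then show ?thesis by (auto simp: q_def elim!: quotientE)
  qed
  have "po k A B f g P q (\<lambda>b. q (A + b))"
    unfolding po_def
  proof (intro conjI allI impI)
    show "maps q A P" "maps (\<lambda>b. q (A + b)) B P" using q by (auto simp: maps_def)
    fix x assume x: "x < k"
    then have "f x < A" "g x < B" using f g by (auto simp: maps_def)
    then show "q (f x) = q (A + g x)"
      using x by (subst q_eq) (auto simp: R_def cp_def cocone_def)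
  next
    fix p assume "p < P"
    then obtain x where x: "x < A + B" "q x = p" using q_surj by blast
    show "(\<exists>a<A. q a = p) \<or> (\<exists>b<B. q (A + b) = p)"
    proof (cases "x < A")
      case False
      then have "x - A < B" "q (A + (x - A)) = p" using x by auto
      then show ?thesis by blast
    qed (use x in blast)
  next
    fix Q u v assume uv: "maps u A Q \<and> maps v B Q \<and> (\<forall>x<k. u (f x) = v (g x))"
    \<comment> \<open>The value is taken at any representative of the class; \<open>R\<close>
      relates exactly the points on which all cocones agree, so the choice does not matter.\<close>
    define h where "h p = cp A u v (SOME x. x < A + B \<and> q x = p)" for p
    have h: "h (q x) = cp A u v x" if "x < A + B" for x
    proof -
      have "(SOME y. y < A + B \<and> q y = q x) < A + B \<and> q (SOME y. y < A + B \<and> q y = q x) = q x"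
        by (rule someI[of _ x]) (use that in simp)
      then have "(SOME y. y < A + B \<and> q y = q x, x) \<in> R" using q_eq that by blast
      then show ?thesis using uv by (auto simp: R_def h_def cocone_def)
    qed
    show "\<exists>h. maps h P Q \<and> (\<forall>a<A. h (q a) = u a) \<and> (\<forall>b<B. h (q (A + b)) = v b)"
    proof (intro exI conjI)
      show "maps h P Q" unfolding maps_def
      proof (intro allI impI)
        fix p assume "p < P"
        then obtain x where x: "x < A + B" "q x = p" using q_surj by blast
        then have "h p = cp A u v x" using h by metis
        then show "h p < Q" using x uv maps_cp[of u A Q v B] by (simp add: maps_def)
      qed
    qed (auto simp: h cp_def)
  qed (use f g in auto)
  then show ?thesis by (rule that)
qed

text \<open>Any single pushout of the unrestricted legs computes the composite. An isomorphic copy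
  of the result is again a pushout composite, with the injections followed by the isomorphism.
  Conversely, the chosen pushout is transported to any other pair of representatives and compared
  there by \<open>po_iso\<close>.\<close>

lemma seq_mk:
  assumes p: "po k A B r l' P i j" and l: "maps l n A" and r': "maps r' m B"
  shows "mk n k A l r ;;\<^bsub>Cospan\<^esub> mk k m B l' r' = mk n m P (\<lambda>x. i (l x)) (\<lambda>x. j (r' x))"
proof -
  note q = p[unfolded po_def]
  have r: "maps r k A" and l': "maps l' k B" using q by auto
  have il: "maps (\<lambda>x. i (l x)) n P" "maps (\<lambda>x. j (r' x)) m P" using q l r' by (auto simp: maps_def)
  show ?thesis
  proof (intro set_eqI iffI)
    fix e assume "e \<in> mk n m P (\<lambda>x. i (l x)) (\<lambda>x. j (r' x))"
    then obtain P' el er h where e: "e = cmk n m P' el er" "maps el n P'" "maps er m P'"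
        "ciso n m P (\<lambda>x. i (l x)) (\<lambda>x. j (r' x)) P' el er h"
      by (auto simp: mem_mk[OF il])
    have "po k A B r l' P' (h \<circ> i) (h \<circ> j)"
      by (rule po_transport[OF p, of "\<lambda>x. x" A "\<lambda>x. x" B h])
        (use e(4) in \<open>auto simp: ciso_def bij_betw_def inj_on_def\<close>)
    then have "is_pushout k A B (restrict r {..<k}) (restrict l' {..<k}) P' (restrict (h \<circ> i) {..<A}) (restrict (h \<circ> j) {..<B})"
      by (rule po_is_pushout)
    moreover have "lleg e = compose {..<n} (restrict (h \<circ> i) {..<A}) (restrict l {..<n})"
      "rleg e = compose {..<m} (restrict (h \<circ> j) {..<B}) (restrict r' {..<m})"
      using e l r' by (auto simp: compose_def restrict_eq_iff ciso_def maps_def)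
    ultimately have "cospan_pushout (cmk n k A l r) (cmk k m B l' r') e"
      unfolding cospan_pushout_def using e(1) by fastforce
    then show "e \<in> mk n k A l r ;;\<^bsub>Cospan\<^esub> mk k m B l' r'"
      using mk_self[OF l r] mk_self[OF l' r'] by (auto simp: Cospan_def)
  next
    fix e assume "e \<in> mk n k A l r ;;\<^bsub>Cospan\<^esub> mk k m B l' r'"
    then obtain c d where cd: "c \<in> mk n k A l r" "d \<in> mk k m B l' r'" and e: "cospan_pushout c d e"
      by (auto simp: Cospan_def)
    obtain A1 l1 r1 \<alpha> where c: "c = cmk n k A1 l1 r1" "maps l1 n A1" "maps r1 k A1" "ciso n k A l r A1 l1 r1 \<alpha>"
      using cd(1) by (auto simp: mem_mk[OF l r])
    obtain B1 l2 r2 \<beta> where d: "d = cmk k m B1 l2 r2" "maps l2 k B1" "maps r2 m B1" "ciso k m B l' r' B1 l2 r2 \<beta>"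
      using cd(2) by (auto simp: mem_mk[OF l' r'])
    obtain i1 j1 where
      st: "src e = n" "tgt e = m" and
      ip: "is_pushout k A1 B1 (restrict r1 {..<k}) (restrict l2 {..<k}) (apex e) i1 j1" and
      legs: "lleg e = compose {..<n} i1 (restrict l1 {..<n})" "rleg e = compose {..<m} j1 (restrict r2 {..<m})"
      using e unfolding c(1) d(1) cospan_pushout_def by auto
    have p1: "po k A1 B1 r1 l2 (apex e) i1 j1"
      by (rule is_pushout_po[OF ip c(3) d(2)])
    have e_eq: "e = cmk n m (apex e) (\<lambda>x. i1 (l1 x)) (\<lambda>x. j1 (r2 x))"
      using st legs by (intro cospan.equality) (auto simp: cmk_def compose_def restrict_def)
    define \<alpha>' where "\<alpha>' = inv_into {..<A} \<alpha>"
    define \<beta>' where "\<beta>' = inv_into {..<B} \<beta>"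
    have \<alpha>: "bij_betw \<alpha> {..<A} {..<A1}" "\<And>x. x < A \<Longrightarrow> \<alpha>' (\<alpha> x) = x"
      using c(4) by (auto simp: ciso_def \<alpha>'_def bij_betw_inv_into_left)
    have \<beta>: "bij_betw \<beta> {..<B} {..<B1}" "\<And>x. x < B \<Longrightarrow> \<beta>' (\<beta> x) = x"
      using d(4) by (auto simp: ciso_def \<beta>'_def bij_betw_inv_into_left)
    have p2: "po k A1 B1 r1 l2 P (i \<circ> \<alpha>') (j \<circ> \<beta>')"
      by (rule po_transport[OF p \<alpha>(1) \<beta>(1), of "\<lambda>x. x"])
        (use c(4) d(4) \<alpha>(2) \<beta>(2) in \<open>auto simp: ciso_def bij_betw_def inj_on_def\<close>)
    obtain h where h: "bij_betw h {..<P} {..<apex e}" "\<And>a. a < A1 \<Longrightarrow> h (i (\<alpha>' a)) = i1 a"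
        "\<And>a. a < B1 \<Longrightarrow> h (j (\<beta>' a)) = j1 a"
      using po_iso[OF p2 p1] by auto
    have "h (i (l x)) = i1 (l1 x)" if "x < n" for x
    proof -
      have "\<alpha> (l x) = l1 x" "l x < A" "l1 x < A1" using c l that by (auto simp: ciso_def maps_def)
      then show ?thesis using h(2)[of "l1 x"] \<alpha>(2)[of "l x"] by simp
    qed
    moreover have "h (j (r' x)) = j1 (r2 x)" if "x < m" for x
    proof -
      have "\<beta> (r' x) = r2 x" "r' x < B" "r2 x < B1" using d r' that by (auto simp: ciso_def maps_def)
      then show ?thesis using h(3)[of "r2 x"] \<beta>(2)[of "r' x"] by simp
    qed
    ultimately have "ciso n m P (\<lambda>x. i (l x)) (\<lambda>x. j (r' x)) (apex e) (\<lambda>x. i1 (l1 x)) (\<lambda>x. j1 (r2 x)) h"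
      using h(1) by (auto simp: ciso_def)
    moreover have "maps (\<lambda>x. i1 (l1 x)) n (apex e)" "maps (\<lambda>x. j1 (r2 x)) m (apex e)"
      using p1 c d by (auto simp: po_def maps_def)
    ultimately show "e \<in> mk n m P (\<lambda>x. i (l x)) (\<lambda>x. j (r' x))"
      unfolding mem_mk[OF il] using e_eq by blast
  qed
qed

section \<open>The bicategory of cospans\<close>

abbreviation cseq (infixl "\<star>" 60) where "f \<star> g \<equiv> f ;;\<^bsub>Cospan\<^esub> g"
abbreviation cten (infixl "\<boxtimes>" 65) where "f \<boxtimes> g \<equiv> f \<oplus>\<^bsub>Cospan\<^esub> g"

text \<open>A function becomes a cospan whose right leg is the identity, and \<open>opc\<close> is
  the reversal. Every arrow is an \<open>fnc\<close> followed by an \<open>opc\<close>, and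
  composing with an \<open>fnc\<close> in front or an \<open>opc\<close> behind only changes one
  leg.\<close>

definition fnc :: "nat \<Rightarrow> nat \<Rightarrow> (nat \<Rightarrow> nat) \<Rightarrow> cospan set" where
  "fnc n m f = mk n m m f (\<lambda>i. i)"

definition opc :: "nat \<Rightarrow> nat \<Rightarrow> (nat \<Rightarrow> nat) \<Rightarrow> cospan set" where
  "opc n m f = mk m n m (\<lambda>i. i) f"

lemma maps_id [simp]: "maps (\<lambda>i. i) n n"
  by (simp add: maps_def)

lemma maps_0 [simp]: "maps f 0 n"
  by (simp add: maps_def)

lemma maps_comp: "maps f n k \<Longrightarrow> maps g k m \<Longrightarrow> maps (\<lambda>x. g (f x)) n m"
  by (simp add: maps_def)

lemma fn_cospan_fnc: "fn_cospan n m (restrict f {..<n}) = fnc n m f"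
  by (simp add: fn_cospan_def fnc_def mk_def cmk_def fn_id_def)

lemma fn_cospan_op_opc: "fn_cospan_op n m (restrict f {..<n}) = opc n m f"
  by (simp add: fn_cospan_op_def opc_def mk_def cmk_def fn_id_def)

lemma fn_id_restrict: "fn_id 0 = restrict (\<lambda>i. i) {..<0}" "fn_id n = restrict (\<lambda>i. i) {..<n}"
  by (simp_all add: fn_id_def)

lemma fn_copair_restrict: "fn_copair n m f g = restrict (cp n f g) {..<n + m}"
  by (simp add: fn_copair_def cp_def)

lemma fnc_cong: "(\<And>i. i < n \<Longrightarrow> f i = g i) \<Longrightarrow> fnc n m f = fnc n m g"
  unfolding fnc_def by (rule mk_cong) auto

lemma opc_cong: "(\<And>i. i < n \<Longrightarrow> f i = g i) \<Longrightarrow> opc n m f = opc n m g"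
  unfolding opc_def by (rule mk_cong) auto

lemma Cospan_simps [simp]:
  "obj Cospan = UNIV" "unit_obj Cospan = 0" "n \<boxplus>\<^bsub>Cospan\<^esub> m = n + m"
  "idt Cospan n = fnc n n (\<lambda>i. i)"
  "assoc Cospan n m k = fnc (n + m + k) (n + m + k) (\<lambda>i. i)"
  "assoc_inv Cospan n m k = fnc (n + m + k) (n + m + k) (\<lambda>i. i)"
  "lunit Cospan n = fnc n n (\<lambda>i. i)" "runit Cospan n = fnc n n (\<lambda>i. i)"
  "symm Cospan n m = fnc (n + m) (m + n) (cp n (\<lambda>i. m + i) (\<lambda>i. i))"
  "mu Cospan n = fnc (n + n) n (cp n (\<lambda>i. i) (\<lambda>i. i))"
  "eta Cospan n = fnc 0 n (\<lambda>i. i)"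
  "delta Cospan n = opc (n + n) n (cp n (\<lambda>i. i) (\<lambda>i. i))"
  "eps Cospan n = opc 0 n (\<lambda>i. i)"
proof -
  have *: "fnc (n + n) n (cp n (fn_id n) (fn_id n)) = fnc (n + n) n (cp n (\<lambda>i. i) (\<lambda>i. i))"
    "opc (n + n) n (cp n (fn_id n) (fn_id n)) = opc (n + n) n (cp n (\<lambda>i. i) (\<lambda>i. i))"
    by (intro fnc_cong opc_cong; auto simp: cp_def fn_id_def)+
  show "mu Cospan n = fnc (n + n) n (cp n (\<lambda>i. i) (\<lambda>i. i))"
    "delta Cospan n = opc (n + n) n (cp n (\<lambda>i. i) (\<lambda>i. i))"
    by (simp_all add: Cospan_def fn_copair_restrict * fn_cospan_fnc fn_cospan_op_opc)
qed (simp_all add: Cospan_def fn_id_restrict fn_cospan_fnc fn_cospan_op_opc fn_copair_restrict del: lessThan_0)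

lemma fnc_hom: "maps f n m \<Longrightarrow> fnc n m f \<in> hom Cospan n m"
  by (simp add: fnc_def mk_hom)

lemma opc_hom: "maps f n m \<Longrightarrow> opc n m f \<in> hom Cospan m n"
  by (simp add: opc_def mk_hom)

lemma maps_braid [simp]: "maps (cp n (\<lambda>i. m + i) (\<lambda>i. i)) (n + m) (m + n)"
  by (auto simp: maps_def cp_def)

lemma maps_fold [simp]: "maps (cp n (\<lambda>i. i) (\<lambda>i. i)) (n + n) n"
  by (auto simp: maps_def cp_def)

lemma po_id_left: "maps g k B \<Longrightarrow> po k k B (\<lambda>i. i) g B g (\<lambda>i. i)"
  by (auto simp: po_def)

lemma po_id_right: "maps f k A \<Longrightarrow> po k A k f (\<lambda>i. i) A (\<lambda>i. i) f"
  by (auto simp: po_def)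

lemma fnc_seq_mk:
  "maps f n k \<Longrightarrow> maps l k A \<Longrightarrow> maps r m A \<Longrightarrow> fnc n k f \<star> mk k m A l r = mk n m A (\<lambda>x. l (f x)) r"
  unfolding fnc_def by (rule seq_mk[OF po_id_left])

lemma mk_seq_opc:
  "maps l n A \<Longrightarrow> maps r k A \<Longrightarrow> maps f m k \<Longrightarrow> mk n k A l r \<star> opc m k f = mk n m A l (\<lambda>x. r (f x))"
  unfolding opc_def by (rule seq_mk[OF po_id_right])

lemma fnc_seq: "maps f n k \<Longrightarrow> maps g k m \<Longrightarrow> fnc n k f \<star> fnc k m g = fnc n m (\<lambda>x. g (f x))"
  using fnc_seq_mk[of f n k g m "\<lambda>i. i" m] by (simp flip: fnc_def)

lemma opc_seq: "maps f n k \<Longrightarrow> maps g k m \<Longrightarrow> opc k m g \<star> opc n k f = opc n m (\<lambda>x. g (f x))"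
  using mk_seq_opc[of "\<lambda>i. i" m m g k f n] by (simp flip: opc_def)

lemma fnc_seq_opc: "maps f n k \<Longrightarrow> maps g m k \<Longrightarrow> fnc n k f \<star> opc m k g = mk n m k f g"
  using fnc_seq_mk[of f n k "\<lambda>i. i" k g m] by (simp add: opc_def)

lemma opc_seq_fnc: "po k A B f g P i j \<Longrightarrow> opc k A f \<star> fnc k B g = mk A B P i j"
  unfolding opc_def fnc_def by (subst seq_mk) auto

lemma id_seq: "f \<in> hom Cospan n m \<Longrightarrow> fnc n n (\<lambda>i. i) \<star> f = f"
  by (auto simp: hom_Cospan fnc_seq_mk)

lemma fnc_id_opc: "fnc n n (\<lambda>i. i) = opc n n (\<lambda>i. i)"
  by (simp add: fnc_def opc_def)

lemma seq_id: "f \<in> hom Cospan n m \<Longrightarrow> f \<star> fnc m m (\<lambda>i. i) = f"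
  by (auto simp: hom_Cospan fnc_id_opc mk_seq_opc)

lemma fnc_tensor: "maps f n m \<Longrightarrow> maps g n' m' \<Longrightarrow>
    fnc n m f \<boxtimes> fnc n' m' g = fnc (n + n') (m + m') (cp n f (\<lambda>i. m + g i))"
  unfolding fnc_def by (subst tensor_mk; (intro mk_cong)?; auto simp: cp_def)

lemma opc_tensor: "maps f n m \<Longrightarrow> maps g n' m' \<Longrightarrow>
    opc n m f \<boxtimes> opc n' m' g = opc (n + n') (m + m') (cp n f (\<lambda>i. m + g i))"
  unfolding opc_def by (subst tensor_mk; (intro mk_cong)?; auto simp: cp_def)

section \<open>Associativity and interchange\<close>

lemma seq_in_hom:
  assumes "f \<in> hom Cospan n k" "g \<in> hom Cospan k m"
  shows "f \<star> g \<in> hom Cospan n m"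
proof -
  obtain A l r where f: "maps l n A" "maps r k A" "f = mk n k A l r" using assms(1) hom_Cospan by auto
  obtain B l' r' where g: "maps l' k B" "maps r' m B" "g = mk k m B l' r'" using assms(2) hom_Cospan by auto
  obtain P i j where p: "po k A B r l' P i j" by (rule po_exists[OF f(2) g(1)])
  have "maps i A P" "maps j B P" using p by (auto simp: po_def)
  then show ?thesis
    unfolding f g seq_mk[OF p f(1) g(2)] using f g by (intro mk_hom) (auto simp: maps_def)
qed

lemma tensor_in_hom:
  "f \<in> hom Cospan n m \<Longrightarrow> g \<in> hom Cospan n' m' \<Longrightarrow> f \<boxtimes> g \<in> hom Cospan (n + n') (m + m')"
  by (auto simp: hom_Cospan[of f] hom_Cospan[of g] tensor_mk intro!: mk_hom maps_cp_sum)

text \<open>Both bracketings compute a colimit of the same zigzag, so the apex \<open>T\<close> of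
  one serves for the other. Associativity of composition then holds with equal apices, and comparing
  the legs is enough.\<close>

lemma po_assoc:
  assumes p1: "po Y A B r l' P i j" and p2: "po Z B C r' l'' Q u v"
    and p3: "po Z P C (\<lambda>z. j (r' z)) l'' T a b"
  obtains d where "po Y A Q r (\<lambda>y. u (l' y)) T (\<lambda>x. a (i x)) d" "\<And>c. c < C \<Longrightarrow> d (v c) = b c"
proof -
  note q1 = p1[unfolded po_def] and q2 = p2[unfolded po_def] and q3 = p3[unfolded po_def]
  have aj: "maps (\<lambda>x. a (j x)) B T" "maps b C T" using q1 q3 by (auto simp: maps_def)
  \<comment> \<open>Induced out of the pushout \<open>Q\<close> by the cocone consisting of
    \<open>a\<close> after \<open>j\<close>, and \<open>b\<close>.\<close>
  obtain d where d: "maps d Q T" "\<And>y. y < B \<Longrightarrow> d (u y) = a (j y)" "\<And>c. c < C \<Longrightarrow> d (v c) = b c"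
    by (rule po_univ[OF p2 aj]) (use q3 in auto)
  have "po Y A Q r (\<lambda>y. u (l' y)) T (\<lambda>x. a (i x)) d"
    unfolding po_def
  proof (intro conjI allI impI)
    show "maps r Y A" "maps (\<lambda>y. u (l' y)) Y Q" "maps (\<lambda>x. a (i x)) A T" "maps d Q T"
      using q1 q2 q3 d by (auto simp: maps_def)
    show "a (i (r x)) = d (u (l' x))" if "x < Y" for x
      using q1 that d(2)[of "l' x"] by (auto simp: maps_def)
  next
    fix t assume "t < T"
    then consider p where "p < P" "a p = t" | c where "c < C" "b c = t" using q3 by blast
    then show "(\<exists>x<A. a (i x) = t) \<or> (\<exists>y<Q. d y = t)"
    proof cases
      case 1
      then consider x where "x < A" "i x = p" | y where "y < B" "j y = p" using q1 by blast
      then show ?thesis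
      proof cases
        case 1 then show ?thesis using \<open>a p = t\<close> by blast
      next
        case 2
        then have "d (u y) = t" "u y < Q" using d(2) \<open>a p = t\<close> q2 by (auto simp: maps_def)
        then show ?thesis by blast
      qed
    next
      case 2
      then have "d (v c) = t" "v c < Q" using d(3) q2 by (auto simp: maps_def)
      then show ?thesis by blast
    qed
  next
    fix S s w
    assume sw: "maps s A S \<and> maps w Q S \<and> (\<forall>x<Y. s (r x) = w (u (l' x)))"
    \<comment> \<open>The mediating map is built in two stages: \<open>s\<close> and
      \<open>w\<close> after \<open>u\<close> factor through \<open>P\<close> as \<open>e\<close>,
      then \<open>e\<close> and \<open>w\<close> after \<open>v\<close> factor through
      \<open>T\<close>.\<close>
    have m: "maps s A S" "maps (\<lambda>x. w (u x)) B S" using sw q2 by (auto simp: maps_def)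
    obtain e where e: "maps e P S" "\<And>x. x < A \<Longrightarrow> e (i x) = s x" "\<And>y. y < B \<Longrightarrow> e (j y) = w (u y)"
      by (rule po_univ[OF p1 m]) (use sw in auto)
    have m: "maps (\<lambda>x. w (v x)) C S" using sw q2 by (auto simp: maps_def)
    obtain g where g: "maps g T S" "\<And>x. x < P \<Longrightarrow> g (a x) = e x" "\<And>c. c < C \<Longrightarrow> g (b c) = w (v c)"
    proof (rule po_univ[OF p3 e(1) m])
      show "e (j (r' x)) = w (v (l'' x))" if "x < Z" for x
        using q2 e(3)[of "r' x"] that by (auto simp: maps_def)
    qed (rule that)
    have iP: "i x < P" if "x < A" for x using q1 that by (simp add: maps_def)
    have jP: "j x < P" if "x < B" for x using q1 that by (simp add: maps_def)
    have "g (d y) = w y" if y: "y < Q" for y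
    proof -
      consider z where "z < B" "u z = y" | c where "c < C" "v c = y" using q2 y by blast
      then show ?thesis
        by cases (use d(2,3) g(2,3) e(3) jP in auto)
    qed
    then show "\<exists>h. maps h T S \<and> (\<forall>x<A. h (a (i x)) = s x) \<and> (\<forall>b<Q. h (d b) = w b)"
      using g e(2) iP by (intro exI[of _ g]) auto
  qed
  with d(3) that show ?thesis by blast
qed

lemma cseq_assoc:
  assumes "f \<in> hom Cospan X Y" "g \<in> hom Cospan Y Z" "h \<in> hom Cospan Z W"
  shows "(f \<star> g) \<star> h = f \<star> (g \<star> h)"
proof -
  obtain A l r where f: "maps l X A" "maps r Y A" "f = mk X Y A l r" using assms(1) hom_Cospan by auto
  obtain B l' r' where g: "maps l' Y B" "maps r' Z B" "g = mk Y Z B l' r'" using assms(2) hom_Cospan by auto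
  obtain C l'' r'' where h: "maps l'' Z C" "maps r'' W C" "h = mk Z W C l'' r''" using assms(3) hom_Cospan by auto
  obtain P i j where p1: "po Y A B r l' P i j" by (rule po_exists[OF f(2) g(1)])
  obtain Q u v where p2: "po Z B C r' l'' Q u v" by (rule po_exists[OF g(2) h(1)])
  note q1 = p1[unfolded po_def] and q2 = p2[unfolded po_def]
  have jr: "maps (\<lambda>z. j (r' z)) Z P" "maps (\<lambda>x. i (l x)) X P"
    using q1 f g by (auto simp: maps_def)
  have vr: "maps (\<lambda>z. v (r'' z)) W Q" using q2 h by (auto simp: maps_def)
  obtain T a b where p3: "po Z P C (\<lambda>z. j (r' z)) l'' T a b" by (rule po_exists[OF jr(1) h(1)])
  obtain d where p4: "po Y A Q r (\<lambda>y. u (l' y)) T (\<lambda>x. a (i x)) d" "\<And>c. c < C \<Longrightarrow> d (v c) = b c"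
    by (rule po_assoc[OF p1 p2 p3], rule that)
  show ?thesis
    unfolding f g h seq_mk[OF p1 f(1) g(2)] seq_mk[OF p2 g(1) h(2)] seq_mk[OF p3 jr(2) h(2)] seq_mk[OF p4(1) f(1) vr]
    using p4(2) h(2) by (intro mk_cong) (auto simp: maps_def)
qed

text \<open>Coproducts commute with pushouts; this is the content of the interchange law. Each half
  of the mediating map comes from one summand.\<close>

lemma po_sum:
  assumes p: "po k A B f g P i j" and p': "po k' A' B' f' g' P' i' j'"
  shows "po (k + k') (A + A') (B + B') (cp k f (\<lambda>x. A + f' x)) (cp k g (\<lambda>x. B + g' x))
    (P + P') (cp A i (\<lambda>x. P + i' x)) (cp B j (\<lambda>x. P + j' x))"
proof -
  note q = p[unfolded po_def] and q' = p'[unfolded po_def]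
  have fA: "f x < A" "g x < B" if "x < k" for x using q that by (auto simp: maps_def)
  have iP: "i x < P" if "x < A" for x using q that by (auto simp: maps_def)
  have jP: "j x < P" if "x < B" for x using q that by (auto simp: maps_def)
  show ?thesis
    unfolding po_def
  proof (intro conjI allI impI)
    show "maps (cp k f (\<lambda>x. A + f' x)) (k + k') (A + A')" "maps (cp k g (\<lambda>x. B + g' x)) (k + k') (B + B')"
      "maps (cp A i (\<lambda>x. P + i' x)) (A + A') (P + P')" "maps (cp B j (\<lambda>x. P + j' x)) (B + B') (P + P')"
      using q q' by (auto intro: maps_cp_sum)
    show "cp A i (\<lambda>x. P + i' x) (cp k f (\<lambda>x. A + f' x) x) = cp B j (\<lambda>x. P + j' x) (cp k g (\<lambda>x. B + g' x) x)"
      if "x < k + k'" for x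
      using q q' that fA[of x] by (auto simp: cp_def)
  next
    fix y assume y: "y < P + P'"
    show "(\<exists>a<A + A'. cp A i (\<lambda>x. P + i' x) a = y) \<or> (\<exists>b<B + B'. cp B j (\<lambda>x. P + j' x) b = y)"
    proof (cases "y < P")
      case True
      then consider a where "a < A" "i a = y" | b where "b < B" "j b = y" using q by blast
      then show ?thesis
        by cases (auto simp: cp_def intro: trans_less_add1)
    next
      case False
      then have "y - P < P'" using y by auto
      then consider a where "a < A'" "i' a = y - P" | b where "b < B'" "j' b = y - P" using q' by blast
      then show ?thesis
      proof cases
        case 1
        then have "cp A i (\<lambda>x. P + i' x) (A + a) = y" "A + a < A + A'" using False by (auto simp: cp_def)
        then show ?thesis by blast
      next
        case 2
        then have "cp B j (\<lambda>x. P + j' x) (B + b) = y" "B + b < B + B'" using False by (auto simp: cp_def)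
        then show ?thesis by blast
      qed
    qed
  next
    fix Q u v
    assume uv: "maps u (A + A') Q \<and> maps v (B + B') Q \<and>
      (\<forall>x<k + k'. u (cp k f (\<lambda>x. A + f' x) x) = v (cp k g (\<lambda>x. B + g' x) x))"
    then have e: "u (cp k f (\<lambda>x. A + f' x) x) = v (cp k g (\<lambda>x. B + g' x) x)" if "x < k + k'" for x
      using that by blast
    have m: "maps u A Q" "maps v B Q" "maps (\<lambda>x. u (A + x)) A' Q" "maps (\<lambda>x. v (B + x)) B' Q"
      using uv by (auto simp: maps_def)
    obtain h where h: "maps h P Q" "\<And>a. a < A \<Longrightarrow> h (i a) = u a" "\<And>b. b < B \<Longrightarrow> h (j b) = v b"
    proof (rule po_univ[OF p m(1,2)])
      show "u (f x) = v (g x)" if "x < k" for x using e[of x] that by (simp add: cp_def)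
    qed (rule that)
    obtain h' where h': "maps h' P' Q" "\<And>a. a < A' \<Longrightarrow> h' (i' a) = u (A + a)" "\<And>b. b < B' \<Longrightarrow> h' (j' b) = v (B + b)"
    proof (rule po_univ[OF p' m(3,4)])
      show "u (A + f' x) = v (B + g' x)" if "x < k'" for x using e[of "k + x"] that by (simp add: cp_def)
    qed (rule that)
    show "\<exists>h. maps h (P + P') Q \<and> (\<forall>a<A + A'. h (cp A i (\<lambda>x. P + i' x) a) = u a) \<and>
      (\<forall>b<B + B'. h (cp B j (\<lambda>x. P + j' x) b) = v b)"
    proof (intro exI[of _ "cp P h h'"] conjI allI impI)
      show "maps (cp P h h') (P + P') Q" using h(1) h'(1) by (rule maps_cp)
      show "cp P h h' (cp A i (\<lambda>x. P + i' x) a) = u a" if "a < A + A'" for a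
        using that iP[of a] h(2)[of a] h'(2)[of "a - A"] by (auto simp: cp_def)
      show "cp P h h' (cp B j (\<lambda>x. P + j' x) b) = v b" if "b < B + B'" for b
        using that jP[of b] h(3)[of b] h'(3)[of "b - B"] by (auto simp: cp_def)
    qed
  qed
qed

lemma cinterchange:
  assumes "f \<in> hom Cospan X Y" "g \<in> hom Cospan Y Z" "f' \<in> hom Cospan X' Y'" "g' \<in> hom Cospan Y' Z'"
  shows "(f \<star> g) \<boxtimes> (f' \<star> g') = (f \<boxtimes> f') \<star> (g \<boxtimes> g')"
proof -
  obtain A l r where f: "maps l X A" "maps r Y A" "f = mk X Y A l r" using assms(1) hom_Cospan by auto
  obtain B s t where g: "maps s Y B" "maps t Z B" "g = mk Y Z B s t" using assms(2) hom_Cospan by auto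
  obtain A' l' r' where f': "maps l' X' A'" "maps r' Y' A'" "f' = mk X' Y' A' l' r'" using assms(3) hom_Cospan by auto
  obtain B' s' t' where g': "maps s' Y' B'" "maps t' Z' B'" "g' = mk Y' Z' B' s' t'" using assms(4) hom_Cospan by auto
  obtain P i j where p: "po Y A B r s P i j" by (rule po_exists[OF f(2) g(1)])
  obtain P' i' j' where p': "po Y' A' B' r' s' P' i' j'" by (rule po_exists[OF f'(2) g'(1)])
  have m: "maps (\<lambda>x. i (l x)) X P" "maps (\<lambda>x. j (t x)) Z P" "maps (\<lambda>x. i' (l' x)) X' P'" "maps (\<lambda>x. j' (t' x)) Z' P'"
    using p p' f g f' g' by (auto simp: po_def maps_def)
  show ?thesis
    unfolding f g f' g' seq_mk[OF p f(1) g(2)] seq_mk[OF p' f'(1) g'(2)]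
      tensor_mk[OF f(1,2) f'(1,2)] tensor_mk[OF g(1,2) g'(1,2)] tensor_mk[OF m]
      seq_mk[OF po_sum[OF p p'] maps_cp_sum[OF f(1) f'(1)] maps_cp_sum[OF g(2) g'(2)]]
    using f g by (intro mk_cong) (auto simp: cp_def maps_def)
qed

lemma ctensor_assoc:
  assumes "f \<in> hom Cospan X X'" "g \<in> hom Cospan Y Y'" "h \<in> hom Cospan Z Z'"
  shows "(f \<boxtimes> g) \<boxtimes> h = f \<boxtimes> (g \<boxtimes> h)"
proof -
  obtain A l r where f: "maps l X A" "maps r X' A" "f = mk X X' A l r" using assms(1) hom_Cospan by auto
  obtain B l' r' where g: "maps l' Y B" "maps r' Y' B" "g = mk Y Y' B l' r'" using assms(2) hom_Cospan by auto
  obtain C l'' r'' where h: "maps l'' Z C" "maps r'' Z' C" "h = mk Z Z' C l'' r''" using assms(3) hom_Cospan by auto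
  show ?thesis
    unfolding f g h using f g h
    by (simp add: tensor_mk maps_cp_sum) (intro mk_cong, auto simp: cp_def)
qed

lemma ctensor_id_left: "f \<in> hom Cospan n m \<Longrightarrow> fnc 0 0 (\<lambda>i. i) \<boxtimes> f = f"
  by (auto simp: hom_Cospan fnc_def tensor_mk cp_def)

lemma ctensor_id_right:
  assumes "f \<in> hom Cospan n m" shows "f \<boxtimes> fnc 0 0 (\<lambda>i. i) = f"
proof -
  obtain A l r where f: "maps l n A" "maps r m A" "f = mk n m A l r" using assms(1) hom_Cospan by auto
  show ?thesis unfolding f(3) fnc_def
    by (subst tensor_mk; (intro mk_cong)?; use f in \<open>auto simp: cp_def\<close>)
qed

text \<open>A bijection seen as a cospan is the reversal of its inverse. In reversed form the
  braiding can be composed behind an arrow without computing a pushout.\<close>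

lemma braid_opc: "fnc (n + m) (m + n) (cp n (\<lambda>i. m + i) (\<lambda>i. i)) = opc (m + n) (n + m) (cp m (\<lambda>i. n + i) (\<lambda>i. i))"
  unfolding fnc_def opc_def
proof (rule mk_eqI[of _ _ _ _ _ _ _ _ "cp m (\<lambda>i. n + i) (\<lambda>i. i)"])
  have "bij_betw (cp m (\<lambda>i. n + i) (\<lambda>i. i)) {..<m + n} {..<n + m}"
    by (rule bij_betw_byWitness[of _ "cp n (\<lambda>i. m + i) (\<lambda>i. i)"]) (auto simp: cp_def)
  then show "ciso (n + m) (m + n) (m + n) (cp n (\<lambda>i. m + i) (\<lambda>i. i)) (\<lambda>i. i)
     (n + m) (\<lambda>i. i) (cp m (\<lambda>i. n + i) (\<lambda>i. i)) (cp m (\<lambda>i. n + i) (\<lambda>i. i))"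
    by (auto simp: ciso_def cp_def)
qed auto

text \<open>After absorbing the braidings into the legs, the two sides have apices
  \<open>A + B\<close> and \<open>B + A\<close>, and the block exchange is an isomorphism between
  them.\<close>

lemma cbraid_natural:
  assumes "f \<in> hom Cospan X X'" "g \<in> hom Cospan Y Y'"
  shows "(f \<boxtimes> g) \<star> fnc (X' + Y') (Y' + X') (cp X' (\<lambda>i. Y' + i) (\<lambda>i. i)) =
    fnc (X + Y) (Y + X) (cp X (\<lambda>i. Y + i) (\<lambda>i. i)) \<star> (g \<boxtimes> f)"
proof -
  obtain A l r where f: "maps l X A" "maps r X' A" "f = mk X X' A l r" using assms(1) hom_Cospan by auto
  obtain B l' r' where g: "maps l' Y B" "maps r' Y' B" "g = mk Y Y' B l' r'" using assms(2) hom_Cospan by auto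
  have bij: "bij_betw (cp A (\<lambda>i. B + i) (\<lambda>i. i)) {..<A + B} {..<B + A}"
    by (rule bij_betw_byWitness[of _ "cp B (\<lambda>i. A + i) (\<lambda>i. i)"]) (auto simp: cp_def)
  show ?thesis
    unfolding braid_opc[of X' Y'] f(3) g(3) tensor_mk[OF f(1,2) g(1,2)] tensor_mk[OF g(1,2) f(1,2)]
      mk_seq_opc[OF maps_cp_sum[OF f(1) g(1)] maps_cp_sum[OF f(2) g(2)] maps_braid]
      fnc_seq_mk[OF maps_braid maps_cp_sum[OF g(1) f(1)] maps_cp_sum[OF g(2) f(2)]]
  proof (rule mk_eqI[of _ _ _ _ _ _ _ _ "cp A (\<lambda>i. B + i) (\<lambda>i. i)"])
    show "ciso (X + Y) (Y' + X') (A + B) (cp X l (\<lambda>i. A + l' i))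
     (\<lambda>x. cp X' r (\<lambda>i. A + r' i) (cp Y' (\<lambda>i. X' + i) (\<lambda>i. i) x)) (B + A)
     (\<lambda>x. cp Y l' (\<lambda>i. B + l i) (cp X (\<lambda>i. Y + i) (\<lambda>i. i) x))
     (cp Y' r' (\<lambda>i. B + r i)) (cp A (\<lambda>i. B + i) (\<lambda>i. i))"
      using f g bij by (auto simp: ciso_def cp_def maps_def)
    show "maps (\<lambda>x. cp X' r (\<lambda>i. A + r' i) (cp Y' (\<lambda>i. X' + i) (\<lambda>i. i) x)) (Y' + X') (A + B)"
      by (rule maps_comp[OF maps_braid maps_cp_sum[OF f(2) g(2)]])
  qed (rule maps_cp_sum[OF f(1) g(1)])
qed

section \<open>Symmetric monoidal structure\<close>

lemma cospan_category: "category Cospan"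
proof
  fix f X Y X' Y' assume "f \<in> hom Cospan X Y" "f \<in> hom Cospan X' Y'"
  then show "X = X' \<and> Y = Y'" unfolding hom_Cospan using mk_eqD by metis
qed (auto simp: fnc_hom id_seq seq_id seq_in_hom cseq_assoc)

lemma cospan_id_invertible: "invertible Cospan n n (fnc n n (\<lambda>i. i))"
  unfolding invertible_def by (auto simp: fnc_hom fnc_seq intro!: bexI[of _ "fnc n n (\<lambda>i. i)"])

lemma fnc_id_tensor [simp]: "fnc n n (\<lambda>i. i) \<boxtimes> fnc m m (\<lambda>i. i) = fnc (n + m) (n + m) (\<lambda>i. i)"
  by (simp add: fnc_tensor) (rule fnc_cong, simp add: cp_def)

lemma cospan_smc: "symmetric_monoidal_category Cospan"
proof -
  interpret category Cospan by (rule cospan_category)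
  show ?thesis
  proof (unfold_locales, goal_cases)
    case (3 f X Y g X' Y') then show ?case using tensor_in_hom by simp
  next
    case 4 then show ?case by simp
  next
    case 5 then show ?case by (simp add: cinterchange)
  next
    case (12 f X X' g Y Y' h Z Z')
    then have "f \<boxtimes> g \<boxtimes> h \<in> hom Cospan (X + Y + Z) (X' + Y' + Z')" by (intro tensor_in_hom)
    then show ?case using ctensor_assoc[OF 12] by (simp add: id_seq seq_id)
  next
    case 13 then show ?case by (simp add: ctensor_id_left id_seq seq_id)
  next
    case 14 then show ?case by (simp add: ctensor_id_right id_seq seq_id)
  next
    case 15 show ?case by (simp add: fnc_seq add.assoc)
  next
    case 16 show ?case by (simp add: fnc_seq add.assoc)
  next
    case 18 then show ?case by (simp add: cbraid_natural)
  next
    case (19 X Y)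
    show ?case
      unfolding Cospan_simps fnc_seq[OF maps_braid maps_braid] by (rule fnc_cong) (auto simp: cp_def)
  next
    case (20 X Y Z)
    let ?s = "\<lambda>n m. cp n (\<lambda>i. m + i) (\<lambda>i. i)"
    \<comment> \<open>The associators are identity cospans, so the hexagon is an equation between
      functions; \<open>s\<close> and \<open>s'\<close> relate these to the braidings tensored with
      identities.\<close>
    have s: "fnc (X + Y + Z) (Y + X + Z) (cp (X + Y) (?s X Y) (\<lambda>i. Y + X + i)) =
      fnc (X + Y) (Y + X) (?s X Y) \<boxtimes> fnc Z Z (\<lambda>i. i)"
      by (rule fnc_tensor[symmetric]) simp_all
    have s': "fnc (Y + (X + Z)) (Y + (Z + X)) (cp Y (\<lambda>i. i) (\<lambda>i. Y + ?s X Z i)) =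
      fnc Y Y (\<lambda>i. i) \<boxtimes> fnc (X + Z) (Z + X) (?s X Z)"
      by (rule fnc_tensor[symmetric]) simp_all
    have m: "maps (cp (X + Y) (?s X Y) (\<lambda>i. Y + X + i)) (X + Y + Z) (Y + X + Z)"
       "maps (cp Y (\<lambda>i. i) (\<lambda>i. Y + ?s X Z i)) (Y + (X + Z)) (Y + (Z + X))"
      using maps_cp_sum[OF maps_braid maps_id] maps_cp_sum[OF maps_id maps_braid] by auto
    have "fnc (X + Y + Z) (Y + X + Z) (cp (X + Y) (?s X Y) (\<lambda>i. Y + X + i)) \<star>
       fnc (Y + X + Z) (Y + X + Z) (\<lambda>i. i) \<star>
       fnc (Y + (X + Z)) (Y + (Z + X)) (cp Y (\<lambda>i. i) (\<lambda>i. Y + ?s X Z i)) =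
      fnc (X + Y + Z) (Y + Z + X) (\<lambda>x. cp Y (\<lambda>i. i) (\<lambda>i. Y + ?s X Z i) (cp (X + Y) (?s X Y) (\<lambda>i. Y + X + i) x))"
      using m by (simp add: fnc_seq add.assoc)
    also have "\<dots> = fnc (X + (Y + Z)) (Y + Z + X) (?s X (Y + Z))"
      unfolding add.assoc by (rule fnc_cong) (auto simp: cp_def)
    finally show ?case
      unfolding Cospan_simps s' add.assoc[of X Y Z] add.assoc[of Y Z X] add.assoc[of Y X Z]
      using id_seq[OF fnc_hom[OF maps_braid[of X "Y + Z"]]] seq_id[OF fnc_hom[OF maps_braid[of X "Y + Z"]]]
      by (simp only: add.assoc[of Y Z X] s[unfolded add.assoc[of X Y Z] add.assoc[of Y X Z]])
  qed (simp_all add: fnc_hom fnc_seq cospan_id_invertible add.assoc)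
qed

section \<open>Frobenius structure and order\<close>

lemma po_flip:
  assumes p: "po k A B f g P i j"
  shows "po k B A g f P j i"
proof -
  note q = p[unfolded po_def]
  show ?thesis
    unfolding po_def
  proof (intro conjI allI impI)
    show "maps g k B" "maps f k A" "maps j B P" "maps i A P" using q by blast+
    show "j (g x) = i (f x)" if "x < k" for x using q that by simp
    show "(\<exists>a<B. j a = y) \<or> (\<exists>b<A. i b = y)" if "y < P" for y using q that by blast
  next
    fix Q u v assume "maps u B Q \<and> maps v A Q \<and> (\<forall>x<k. u (g x) = v (f x))"
    then have vu: "maps v A Q" "maps u B Q" "\<And>x. x < k \<Longrightarrow> v (f x) = u (g x)" by auto
    obtain h where "maps h P Q" "\<And>a. a < A \<Longrightarrow> h (i a) = v a" "\<And>b. b < B \<Longrightarrow> h (j b) = u b"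
      by (rule po_univ[OF p vu(1,2)]) (use vu(3) in auto)
    then show "\<exists>h. maps h P Q \<and> (\<forall>a<B. h (j a) = u a) \<and> (\<forall>b<A. h (i b) = v b)" by blast
  qed
qed

text \<open>Laws among multiplications and units are equations of functions, those among
  comultiplications and counits of reversed functions. Explicit pushouts enter for Frobenius,
  speciality and \<open>eps\<close> followed by \<open>eta\<close>; arbitrary ones enter for
  monotonicity of composition and laxness of \<open>delta\<close>.\<close>

lemma cospan_pcb: "preordered_cartesian_bicategory Cospan"
proof -
  interpret symmetric_monoidal_category Cospan by (rule cospan_smc)
  let ?I = "\<lambda>i. i :: nat"
  let ?d = "\<lambda>n. cp n ?I ?I"
  have T: "fnc (n + k) (m + k) (cp n f (\<lambda>i. m + i)) = fnc n m f \<boxtimes> fnc k k ?I"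
    "fnc (k + n) (k + m) (cp k ?I (\<lambda>i. k + f i)) = fnc k k ?I \<boxtimes> fnc n m f"
    "opc (n + k) (m + k) (cp n f (\<lambda>i. m + i)) = opc n m f \<boxtimes> fnc k k ?I"
    "opc (k + n) (k + m) (cp k ?I (\<lambda>i. k + f i)) = fnc k k ?I \<boxtimes> opc n m f"
    if "maps f n m" for n m k f
    using fnc_tensor[OF that maps_id] fnc_tensor[OF maps_id that]
      opc_tensor[OF that maps_id, folded fnc_id_opc] opc_tensor[OF maps_id that, folded fnc_id_opc]
    by (simp_all only:)
  have M: "maps (cp n f (\<lambda>i. m + i)) (n + k) (m + k)" "maps (cp k ?I (\<lambda>i. k + f i)) (k + n) (k + m)"
    if "maps f n m" for n m k f
    using maps_cp_sum[OF that maps_id] maps_cp_sum[OF maps_id that] by auto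
  have frob: "po (n + n + n) (n + n) (n + n) (cp (n + n) (?d n) (\<lambda>i. n + i)) (cp n ?I (\<lambda>i. n + ?d n i)) n (?d n) (?d n)" for n
    unfolding po_def
  proof (intro conjI allI impI)
    show "maps (cp (n + n) (?d n) (\<lambda>i. n + i)) (n + n + n) (n + n)" by (rule M) simp
    show "maps (cp n ?I (\<lambda>i. n + ?d n i)) (n + n + n) (n + n)" using M(2)[OF maps_fold] by (simp add: add.assoc)
  next
    fix p assume "p < n"
    then show "(\<exists>a<n + n. ?d n a = p) \<or> (\<exists>b<n + n. ?d n b = p)"
      by (intro disjI1 exI[of _ p]) (simp add: cp_def)
  next
    fix Q u v
    assume uv: "maps u (n + n) Q \<and> maps v (n + n) Q \<and>
       (\<forall>x<n + n + n. u (cp (n + n) (?d n) (\<lambda>i. n + i) x) = v (cp n ?I (\<lambda>i. n + ?d n i) x))"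
    then have e: "u (cp (n + n) (?d n) (\<lambda>i. n + i) x) = v (cp n ?I (\<lambda>i. n + ?d n i) x)" if "x < n + n + n" for x
      using that by blast
    \<comment> \<open>Each of the three blocks of \<open>n + n + n\<close> contributes one equation.
      Together all four values at \<open>x\<close> coincide, so \<open>u\<close> on the first block
      is the mediating map.\<close>
    have 1: "u x = v x" "u x = v (n + x)" "u (n + x) = v (n + x)" if "x < n" for x
      using e[of x] e[of "n + x"] e[of "n + n + x"] that by (auto simp: cp_def)
    have 2: "u (?d n a) = u a" "u (?d n a) = v a" if "a < n + n" for a
    proof -
      have "u (?d n a) = u a \<and> u (?d n a) = v a"
      proof (cases "a < n")
        case True
        then show ?thesis using 1(1)[of a] by (simp add: cp_def)
      next
        case False
        then show ?thesis using 1[of "a - n"] that by (simp add: cp_def)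
      qed
      then show "u (?d n a) = u a" "u (?d n a) = v a" by simp_all
    qed
    have "maps u n Q" using uv by (simp add: maps_def)
    with 2 show "\<exists>h. maps h n Q \<and> (\<forall>a<n + n. h (?d n a) = u a) \<and> (\<forall>b<n + n. h (?d n b) = v b)"
      by (intro exI[of _ u]) simp
  qed (auto simp: cp_def maps_def)
  have spec: "po (n + n) n n (?d n) (?d n) n ?I ?I" for n
    unfolding po_def
  proof (intro conjI allI impI)
    fix Q u v
    assume uv: "maps u n Q \<and> maps v n Q \<and> (\<forall>x<n + n. u (?d n x) = v (?d n x))"
    then have "u x = v x" if "x < n" for x
      using that by (auto simp: cp_def dest: spec[of _ x])
    then show "\<exists>h. maps h n Q \<and> (\<forall>a<n. h a = u a) \<and> (\<forall>b<n. h b = v b)"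
      using uv by (intro exI[of _ u]) auto
  qed auto
  have muldel: "mu Cospan n \<star> delta Cospan n = mk (n + n) (n + n) n (?d n) (?d n)" for n
    by (simp add: fnc_seq_opc)
  have special': "delta Cospan n \<star> mu Cospan n = idt Cospan n" for n
    using opc_seq_fnc[OF spec] by (simp add: fnc_def)
  show ?thesis
  proof (unfold_locales, goal_cases)
    case (1 f X Y)
    then show ?case by (auto simp: hom_Cospan leq_mk intro!: exI[of _ ?I])
  next
    case (2 f X Y g h)
    then obtain A l r B l' r' C l'' r'' where
      m: "maps l X A" "maps r Y A" "f = mk X Y A l r" "maps l' X B" "maps r' Y B" "g = mk X Y B l' r'"
      "maps l'' X C" "maps r'' Y C" "h = mk X Y C l'' r''" by (auto simp: hom_Cospan)
    obtain h1 where h1: "maps h1 B A" "\<And>i. i < X \<Longrightarrow> h1 (l' i) = l i" "\<And>i. i < Y \<Longrightarrow> h1 (r' i) = r i"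
      using 2(4) unfolding m(3,6) leq_mk[OF m(1,2,4,5)] by blast
    obtain h2 where h2: "maps h2 C B" "\<And>i. i < X \<Longrightarrow> h2 (l'' i) = l' i" "\<And>i. i < Y \<Longrightarrow> h2 (r'' i) = r' i"
      using 2(5) unfolding m(6,9) leq_mk[OF m(4,5,7,8)] by blast
    have "maps (\<lambda>x. h1 (h2 x)) C A" using h1(1) h2(1) by (simp add: maps_def)
    with h1(2,3) h2(2,3) show ?case
      unfolding m(3,9) leq_mk[OF m(1,2,7,8)] by (intro exI[of _ "\<lambda>x. h1 (h2 x)"]) simp
  next
    case (3 f X Y f' g Z g')
    then obtain A l r A' l' r' B s t B' s' t' where
      f: "maps l X A" "maps r Y A" "f = mk X Y A l r" and f': "maps l' X A'" "maps r' Y A'" "f' = mk X Y A' l' r'" and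
      g: "maps s Y B" "maps t Z B" "g = mk Y Z B s t" and g': "maps s' Y B'" "maps t' Z B'" "g' = mk Y Z B' s' t'"
      by (auto simp: hom_Cospan)
    obtain P i j where p: "po Y A B r s P i j" by (rule po_exists[OF f(2) g(1)])
    obtain P' i' j' where p': "po Y A' B' r' s' P' i' j'" by (rule po_exists[OF f'(2) g'(1)])
    note q = p[unfolded po_def]
    obtain h1 where h1: "maps h1 A' A" "\<forall>i<X. h1 (l' i) = l i" "\<forall>i<Y. h1 (r' i) = r i"
      using 3(5) f f' by (auto simp: leq_mk)
    obtain h2 where h2: "maps h2 B' B" "\<forall>i<Y. h2 (s' i) = s i" "\<forall>i<Z. h2 (t' i) = t i"
      using 3(6) g g' by (auto simp: leq_mk)
    have uv: "maps (\<lambda>x. i (h1 x)) A' P" "maps (\<lambda>x. j (h2 x)) B' P" using h1 h2 q by (auto simp: maps_def)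
    \<comment> \<open>The comparison of the composites is induced out of \<open>P'\<close> by the
      two given maps followed by the injections \<open>i\<close> and \<open>j\<close>.\<close>
    obtain h where h: "maps h P' P" "\<And>a. a < A' \<Longrightarrow> h (i' a) = i (h1 a)" "\<And>a. a < B' \<Longrightarrow> h (j' a) = j (h2 a)"
      by (rule po_univ[OF p' uv]) (use h1 h2 q in auto)
    have m: "maps (\<lambda>x. i (l x)) X P" "maps (\<lambda>x. j (t x)) Z P" "maps (\<lambda>x. i' (l' x)) X P'" "maps (\<lambda>x. j' (t' x)) Z P'"
      using p p' f g f' g' by (auto simp: po_def maps_def)
    show ?case
      unfolding f(3) f'(3) g(3) g'(3) seq_mk[OF p f(1) g(2)] seq_mk[OF p' f'(1) g'(2)] leq_mk[OF m]
      using h h1 h2 f' g' by (intro exI[of _ h]) (auto simp: maps_def)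
  next
    case (4 f X Y f' g Z W g')
    then obtain A l r A' l' r' B s t B' s' t' where
      f: "maps l X A" "maps r Y A" "f = mk X Y A l r" and f': "maps l' X A'" "maps r' Y A'" "f' = mk X Y A' l' r'" and
      g: "maps s Z B" "maps t W B" "g = mk Z W B s t" and g': "maps s' Z B'" "maps t' W B'" "g' = mk Z W B' s' t'"
      by (auto simp: hom_Cospan)
    obtain h1 where h1: "maps h1 A' A" "\<forall>i<X. h1 (l' i) = l i" "\<forall>i<Y. h1 (r' i) = r i"
      using 4(5) f f' by (auto simp: leq_mk)
    obtain h2 where h2: "maps h2 B' B" "\<forall>i<Z. h2 (s' i) = s i" "\<forall>i<W. h2 (t' i) = t i"
      using 4(6) g g' by (auto simp: leq_mk)
    have "maps (cp A' h1 (\<lambda>i. A + h2 i)) (A' + B') (A + B)" using h1 h2 by (auto intro: maps_cp_sum)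
    moreover have "l' i < A'" if "i < X" for i using f' that by (simp add: maps_def)
    moreover have "r' i < A'" if "i < Y" for i using f' that by (simp add: maps_def)
    ultimately show ?case
      unfolding f(3) f'(3) g(3) g'(3) tensor_mk[OF f(1,2) g(1,2)] tensor_mk[OF f'(1,2) g'(1,2)]
        leq_mk[OF maps_cp_sum[OF f(1) g(1)] maps_cp_sum[OF f(2) g(2)] maps_cp_sum[OF f'(1) g'(1)] maps_cp_sum[OF f'(2) g'(2)]]
      using h1(2,3) h2(2,3)
      by (intro exI[of _ "cp A' h1 (\<lambda>i. A + h2 i)"] conjI) (simp_all add: cp_def)
  next
    case (7 X)
    have "(mu Cospan X \<boxtimes> idt Cospan X) \<star> mu Cospan X = fnc (X + X + X) X (\<lambda>x. ?d X (cp (X + X) (?d X) (\<lambda>i. X + i) x))"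
      unfolding Cospan_simps T(1)[OF maps_fold, symmetric] by (rule fnc_seq[OF M(1)[OF maps_fold] maps_fold])
    also have "\<dots> = fnc (X + X + X) X (\<lambda>x. ?d X (cp X ?I (\<lambda>i. X + ?d X i) x))"
      by (rule fnc_cong) (auto simp: cp_def)
    also have "\<dots> = fnc (X + (X + X)) (X + X) (cp X ?I (\<lambda>i. X + ?d X i)) \<star> fnc (X + X) X (?d X)"
      unfolding fnc_seq[OF M(2)[OF maps_fold] maps_fold] add.assoc ..
    also have "\<dots> = assoc Cospan X X X \<star> (idt Cospan X \<boxtimes> mu Cospan X) \<star> mu Cospan X"
      unfolding Cospan_simps T(2)[OF maps_fold, symmetric] add.assoc[of X X X]
      by (subst id_seq[OF fnc_hom[OF M(2)[OF maps_fold]]]) (rule refl)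
    finally show ?case .
  next
    case (8 X)
    have "fnc (0 + X) (X + X) (cp 0 ?I (\<lambda>i. X + i)) = fnc 0 X ?I \<boxtimes> fnc X X ?I" by (rule T) simp
    moreover have "fnc (0 + X) (X + X) (cp 0 ?I (\<lambda>i. X + i)) \<star> fnc (X + X) X (?d X) = fnc X X ?I"
      by (subst fnc_seq) (auto simp: maps_def cp_def)
    ultimately show ?case by simp
  next
    case (9 X)
    have "fnc (X + 0) (X + X) (cp X ?I (\<lambda>i. X + i)) = fnc X X ?I \<boxtimes> fnc 0 X ?I" by (rule T) simp
    moreover have "fnc (X + 0) (X + X) (cp X ?I (\<lambda>i. X + i)) \<star> fnc (X + X) X (?d X) = fnc X X ?I"
      by (subst fnc_seq; (simp add: maps_def cp_def; rule fnc_cong)?) (auto simp: maps_def cp_def)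
    ultimately show ?case by simp
  next
    case (10 X)
    show ?case unfolding Cospan_simps fnc_seq[OF maps_braid maps_fold] by (rule fnc_cong) (auto simp: cp_def)
  next
    case (13 X)
    have e: "delta Cospan X \<star> (delta Cospan X \<boxtimes> idt Cospan X) = opc (X + X + X) X (\<lambda>x. ?d X (cp (X + X) (?d X) (\<lambda>i. X + i) x))"
      unfolding Cospan_simps T(3)[OF maps_fold, symmetric] by (rule opc_seq[OF M(1)[OF maps_fold] maps_fold])
    have m: "maps (\<lambda>x. ?d X (cp (X + X) (?d X) (\<lambda>i. X + i) x)) (X + X + X) X"
      by (rule maps_comp[OF M(1)[OF maps_fold] maps_fold])
    have "delta Cospan X \<star> (delta Cospan X \<boxtimes> idt Cospan X) \<star> assoc Cospan X X X =
      opc (X + X + X) X (\<lambda>x. ?d X (cp (X + X) (?d X) (\<lambda>i. X + i) x))"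
      unfolding e using seq_id[OF opc_hom[OF m]] by simp
    also have "\<dots> = opc (X + X + X) X (\<lambda>x. ?d X (cp X ?I (\<lambda>i. X + ?d X i) x))"
      by (rule opc_cong) (auto simp: cp_def)
    also have "\<dots> = opc (X + X) X (?d X) \<star> opc (X + (X + X)) (X + X) (cp X ?I (\<lambda>i. X + ?d X i))"
      unfolding opc_seq[OF M(2)[OF maps_fold] maps_fold] add.assoc ..
    finally show ?case unfolding Cospan_simps T(4)[OF maps_fold] .
  next
    case (14 X)
    have "opc (0 + X) (X + X) (cp 0 ?I (\<lambda>i. X + i)) = opc 0 X ?I \<boxtimes> fnc X X ?I" by (rule T) simp
    moreover have "opc (X + X) X (?d X) \<star> opc (0 + X) (X + X) (cp 0 ?I (\<lambda>i. X + i)) = opc X X ?I"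
      by (subst opc_seq) (auto simp: maps_def cp_def)
    ultimately show ?case by (simp add: fnc_seq flip: fnc_id_opc)
  next
    case (15 X)
    have "opc (X + 0) (X + X) (cp X ?I (\<lambda>i. X + i)) = fnc X X ?I \<boxtimes> opc 0 X ?I" by (rule T) simp
    moreover have "opc (X + X) X (?d X) \<star> opc (X + 0) (X + X) (cp X ?I (\<lambda>i. X + i)) = opc X X ?I"
      by (subst opc_seq; (simp add: maps_def cp_def; rule opc_cong)?) (auto simp: maps_def cp_def)
    ultimately show ?case by (simp add: fnc_seq flip: fnc_id_opc)
  next
    case (16 X)
    show ?case unfolding Cospan_simps braid_opc opc_seq[OF maps_braid maps_fold] by (rule opc_cong) (auto simp: cp_def)
  next
    case (17 X)
    have "(delta Cospan X \<boxtimes> idt Cospan X) \<star> fnc (X + X + X) (X + X + X) ?I \<star> (idt Cospan X \<boxtimes> mu Cospan X) =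
      opc (X + X + X) (X + X) (cp (X + X) (?d X) (\<lambda>i. X + i)) \<star> fnc (X + X + X) (X + X) (cp X ?I (\<lambda>i. X + ?d X i))"
      unfolding Cospan_simps T(3)[OF maps_fold, symmetric] T(2)[OF maps_fold, symmetric]
      by (subst seq_id[OF opc_hom[OF M(1)[OF maps_fold]]]) (simp add: add.assoc)
    also have "\<dots> = mk (X + X) (X + X) X (?d X) (?d X)" by (rule opc_seq_fnc[OF frob])
    finally show ?case unfolding muldel by (simp only: Cospan_simps)
  next
    case (18 X)
    have m: "maps (cp X ?I (\<lambda>i. X + ?d X i)) (X + X + X) (X + X)" using M(2)[OF maps_fold] by (simp add: add.assoc)
    have "(idt Cospan X \<boxtimes> delta Cospan X) \<star> fnc (X + X + X) (X + X + X) ?I \<star> (mu Cospan X \<boxtimes> idt Cospan X) =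
      opc (X + X + X) (X + X) (cp X ?I (\<lambda>i. X + ?d X i)) \<star> fnc (X + X + X) (X + X) (cp (X + X) (?d X) (\<lambda>i. X + i))"
      unfolding Cospan_simps T(4)[OF maps_fold, symmetric] T(1)[OF maps_fold, symmetric]
      using seq_id[OF opc_hom[OF m]] by (simp add: add.assoc)
    also have "\<dots> = mk (X + X) (X + X) X (?d X) (?d X)" by (rule opc_seq_fnc[OF po_flip[OF frob]])
    finally show ?case unfolding muldel by (simp only: Cospan_simps)
  next
    case 19 show ?case by (rule special')
  next
    case (20 X)
    \<comment> \<open>A pushout over the empty ordinal is a coproduct; the map of cospans witnessing
      the inequality is then the fold \<open>X + X\<close> to \<open>X\<close>.\<close>
    have "po 0 X X ?I ?I (X + X) ?I (\<lambda>i. X + i)"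
      unfolding po_def
    proof (intro conjI allI impI)
      fix p assume "p < X + X"
      then show "(\<exists>a<X. a = p) \<or> (\<exists>b<X. X + b = p)" by (metis add_less_cancel_left le_add_diff_inverse linorder_not_less)
    next
      fix Q u v assume "maps u X Q \<and> maps v X Q \<and> (\<forall>x<0. u x = v x)"
      then show "\<exists>h. maps h (X + X) Q \<and> (\<forall>a<X. h a = u a) \<and> (\<forall>b<X. h (X + b) = v b)"
        by (intro exI[of _ "cp X u v"] conjI maps_cp) (auto simp: cp_def)
    qed (auto simp: maps_def)
    from opc_seq_fnc[OF this]
    have "eps Cospan X \<star> eta Cospan X = mk X X (X + X) ?I (\<lambda>i. X + i)" by simp
    moreover have "mk X X X ?I ?I \<preceq>\<^bsub>Cospan\<^esub> mk X X (X + X) ?I (\<lambda>i. X + i)"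
      by (subst leq_mk) (auto simp: maps_def cp_def intro!: exI[of _ "?d X"])
    ultimately show ?case by (simp add: fnc_def)
  next
    case (21 X)
    have "eta Cospan X \<star> eps Cospan X = mk 0 0 X ?I ?I" by (simp add: fnc_seq_opc)
    moreover have "mk 0 0 X ?I ?I \<preceq>\<^bsub>Cospan\<^esub> mk 0 0 0 ?I ?I" by (subst leq_mk) auto
    ultimately show ?case by (simp add: fnc_def)
  next
    case (22 X)
    have "fnc X X ?I \<preceq>\<^bsub>Cospan\<^esub> fnc X X ?I" unfolding fnc_def by (subst leq_mk) (auto intro!: exI[of _ ?I])
    then show ?case unfolding special' by simp
  next
    case (23 X)
    have "mk (X + X) (X + X) X (?d X) (?d X) \<preceq>\<^bsub>Cospan\<^esub> mk (X + X) (X + X) (X + X) ?I ?I"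
      by (subst leq_mk) (simp_all, rule exI[of _ "?d X"], simp)
    then show ?case unfolding muldel by (simp add: fnc_def)
  next
    case (24 R X Y)
    then obtain A l r where f: "maps l X A" "maps r Y A" "R = mk X Y A l r" by (auto simp: hom_Cospan)
    have ll: "maps (cp X l (\<lambda>i. A + l i)) (X + X) (A + A)" "maps (cp Y r (\<lambda>i. A + r i)) (Y + Y) (A + A)"
      using f by (auto intro: maps_cp_sum)
    obtain P i j where p: "po (X + X) X (A + A) (?d X) (cp X l (\<lambda>i. A + l i)) P i j"
      by (rule po_exists[OF maps_fold ll(1)])
    have lhs: "R \<star> delta Cospan Y = mk X (Y + Y) A l (\<lambda>x. r (?d Y x))"
      unfolding f(3) Cospan_simps using mk_seq_opc[OF f(1,2) maps_fold] .
    have rhs: "delta Cospan X \<star> (R \<boxtimes> R) = mk X (Y + Y) P i (\<lambda>x. j (cp Y r (\<lambda>i. A + r i) x))"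
      unfolding f(3) tensor_mk[OF f(1,2) f(1,2)] Cospan_simps opc_def
      by (rule seq_mk[OF p _ ll(2)]) simp
    \<comment> \<open>The witness of laxness is induced by the left leg \<open>l\<close> and the
      fold of \<open>A + A\<close>.\<close>
    obtain h where h: "maps h P A" "\<And>a. a < X \<Longrightarrow> h (i a) = l a" "\<And>b. b < A + A \<Longrightarrow> h (j b) = ?d A b"
      by (rule po_univ[OF p f(1) maps_fold]) (use f in \<open>auto simp: cp_def maps_def\<close>)
    have m: "maps (\<lambda>x. r (?d Y x)) (Y + Y) A" "maps i X P" "maps (\<lambda>x. j (cp Y r (\<lambda>i. A + r i) x)) (Y + Y) P"
      using p ll f maps_fold[of Y] by (auto simp: po_def maps_def)
    show ?case
      unfolding lhs rhs leq_mk[OF f(1) m]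
      using h ll(2) f(2) by (intro exI[of _ h]) (auto simp: maps_def cp_def)
  next
    case (25 R X Y)
    then obtain A l r where f: "maps l X A" "maps r Y A" "R = mk X Y A l r" by (auto simp: hom_Cospan)
    have "R \<star> eps Cospan Y = mk X 0 A l r"
      unfolding f(3) Cospan_simps using mk_seq_opc[OF f(1,2), of "\<lambda>i. i" 0] by simp
    \<comment> \<open>Here the left leg \<open>l\<close> itself is the required map.\<close>
    then show ?case
      using f by (simp add: opc_def leq_mk) blast
  qed (auto simp: fnc_hom opc_hom)
qed

declare One_nat_def [simp del]

section \<open>Arrows of the syntactic bicategory\<close>

text \<open>Source, target and well-typedness are total functions on terms, including ill-typed
  ones, so that they can be lifted to a quotient of all terms.\<close>

primrec dm_tm :: "cb_term \<Rightarrow> nat" where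
  "dm_tm Delta = 1" | "dm_tm Eps = 1" | "dm_tm Mu = 2" | "dm_tm Eta = 0"
| "dm_tm Id0 = 0" | "dm_tm Id1 = 1" | "dm_tm Sigma1 = 2"
| "dm_tm (c \<Zsemi> d) = dm_tm c" | "dm_tm (c \<uplus> d) = dm_tm c + dm_tm d"

primrec cd_tm :: "cb_term \<Rightarrow> nat" where
  "cd_tm Delta = 2" | "cd_tm Eps = 0" | "cd_tm Mu = 1" | "cd_tm Eta = 1"
| "cd_tm Id0 = 0" | "cd_tm Id1 = 1" | "cd_tm Sigma1 = 2"
| "cd_tm (c \<Zsemi> d) = cd_tm d" | "cd_tm (c \<uplus> d) = cd_tm c + cd_tm d"

primrec wf_tm :: "cb_term \<Rightarrow> bool" where
  "wf_tm Delta = True" | "wf_tm Eps = True" | "wf_tm Mu = True" | "wf_tm Eta = True"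
| "wf_tm Id0 = True" | "wf_tm Id1 = True" | "wf_tm Sigma1 = True"
| "wf_tm (c \<Zsemi> d) = (wf_tm c \<and> wf_tm d \<and> cd_tm c = dm_tm d)"
| "wf_tm (c \<uplus> d) = (wf_tm c \<and> wf_tm d)"

lemma has_sort_iff: "has_sort c n m \<longleftrightarrow> wf_tm c \<and> dm_tm c = n \<and> cd_tm c = m"
proof
  show "has_sort c n m \<Longrightarrow> wf_tm c \<and> dm_tm c = n \<and> cd_tm c = m"
    by (induction rule: has_sort.induct) auto
  have "wf_tm c \<Longrightarrow> has_sort c (dm_tm c) (cd_tm c)"
    by (induction c) (auto intro: has_sort.intros simp del: One_nat_def)
  then show "wf_tm c \<and> dm_tm c = n \<and> cd_tm c = m \<Longrightarrow> has_sort c n m" by blast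
qed

lemma id_tm_sort [simp]: "wf_tm (id_tm n)" "dm_tm (id_tm n) = n" "cd_tm (id_tm n) = n"
  by (induction n) auto

lemma sym1_tm_sort [simp]:
  "dm_tm (sym1_tm n) = Suc n" "cd_tm (sym1_tm n) = Suc n" "wf_tm (sym1_tm n)"
proof -
  show d: "dm_tm (sym1_tm n) = Suc n" for n by (induction n) auto
  show "cd_tm (sym1_tm n) = Suc n" by (induction n) auto
  show "wf_tm (sym1_tm n)" by (induction n) (auto simp: d)
qed

lemma sym_tm_sort [simp]:
  "dm_tm (sym_tm n m) = n + m" "cd_tm (sym_tm n m) = m + n" "wf_tm (sym_tm n m)"
proof -
  show d: "dm_tm (sym_tm n m) = n + m" for m by (induction m) auto
  show c: "cd_tm (sym_tm n m) = m + n" for m by (induction m) auto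
  show "wf_tm (sym_tm n m)" by (induction m) (auto simp: d c)
qed

lemma cb_eq_sort: "cb_eq n m c d \<Longrightarrow> has_sort c n m \<and> has_sort d n m"
  by (induction rule: cb_eq.induct) (auto simp: has_sort_iff)

text \<open>All ill-typed terms with the same outer sorts may be identified freely; this makes
  \<open>cbx\<close> a congruence on all terms, so that equality of arrows supports rewriting and the
  associativity laws hold without side conditions.\<close>

definition cbx :: "cb_term \<Rightarrow> cb_term \<Rightarrow> bool" where
  "cbx c d \<longleftrightarrow> wf_tm c = wf_tm d \<and> dm_tm c = dm_tm d \<and> cd_tm c = cd_tm d \<and>
     (wf_tm c \<longrightarrow> cb_eq (dm_tm c) (cd_tm c) c d)"

lemma cbx_refl: "cbx c c"
  by (simp add: cbx_def cb_refl has_sort_iff)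

lemma cb_eq_cbx: "cb_eq n m c d \<Longrightarrow> cbx c d"
  using cb_eq_sort[of n m c d] by (auto simp: cbx_def has_sort_iff)

\<comment> \<open>Terms modulo provable equality\<close>
quotient_type arr = cb_term / cbx
proof (rule equivpI)
  show "reflp cbx" by (simp add: reflp_def cbx_refl)
  show "symp cbx" by (auto simp: symp_def cbx_def intro: cb_sym)
  show "transp cbx" unfolding transp_def cbx_def using cb_trans by metis
qed

lift_definition dm :: "arr \<Rightarrow> nat" is dm_tm by (simp add: cbx_def)
lift_definition cd :: "arr \<Rightarrow> nat" is cd_tm by (simp add: cbx_def)
lift_definition ok :: "arr \<Rightarrow> bool" is wf_tm by (simp add: cbx_def)

lift_definition sq :: "arr \<Rightarrow> arr \<Rightarrow> arr" (infixr "\<rhd>" 60) is "(\<Zsemi>)"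
  by (auto simp: cbx_def intro: cb_cong_seq)
lift_definition pr :: "arr \<Rightarrow> arr \<Rightarrow> arr" (infixr "\<otimes>" 65) is "(\<uplus>)"
  by (auto simp: cbx_def intro: cb_cong_sum)

lift_definition idn :: "nat \<Rightarrow> arr" is id_tm .
lift_definition braid :: "nat \<Rightarrow> nat \<Rightarrow> arr" is sym_tm .
lift_definition cpy :: arr is Delta .
lift_definition dsc :: arr is Eps .
lift_definition mrg :: arr is Mu .
lift_definition unt :: arr is Eta .
lift_definition swp :: arr is Sigma1 .

lemma arr_sorts [simp]:
  "dm (f \<rhd> g) = dm f" "cd (f \<rhd> g) = cd g" "ok (f \<rhd> g) \<longleftrightarrow> ok f \<and> ok g \<and> cd f = dm g"
  "dm (f \<otimes> g) = dm f + dm g" "cd (f \<otimes> g) = cd f + cd g" "ok (f \<otimes> g) \<longleftrightarrow> ok f \<and> ok g"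
  "dm (idn n) = n" "cd (idn n) = n" "ok (idn n)"
  "dm (braid n m) = n + m" "cd (braid n m) = m + n" "ok (braid n m)"
  "dm cpy = 1" "cd cpy = 2" "ok cpy" "dm dsc = 1" "cd dsc = 0" "ok dsc"
  "dm mrg = 2" "cd mrg = 1" "ok mrg" "dm unt = 0" "cd unt = 1" "ok unt"
  "dm swp = 2" "cd swp = 2" "ok swp"
  by (transfer; simp)+

lemma sq_assoc [simp]: "(f \<rhd> g) \<rhd> h = f \<rhd> g \<rhd> h"
  by transfer (auto simp: cbx_def has_sort_iff intro: cb_seq_assoc)

lemma pr_assoc [simp]: "(f \<otimes> g) \<otimes> h = f \<otimes> g \<otimes> h"
  apply transfer
  subgoal for f g h
    using cb_sum_assoc[of f "dm_tm f" "cd_tm f" g "dm_tm g" "cd_tm g" h "dm_tm h" "cd_tm h"]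
    by (auto simp: cbx_def has_sort_iff add.assoc)
  done

lemma id_sq [simp]: "dm f = n \<Longrightarrow> idn n \<rhd> f = f"
  by transfer (auto simp: cbx_def has_sort_iff intro: cb_seq_id_left)

lemma sq_id [simp]: "cd f = n \<Longrightarrow> f \<rhd> idn n = f"
  by transfer (auto simp: cbx_def has_sort_iff intro: cb_seq_id_right)

lemma id0_pr [simp]: "idn 0 \<otimes> f = f"
  by transfer (auto simp: cbx_def has_sort_iff intro: cb_sum_id_left)

lemma pr_id0 [simp]: "f \<otimes> idn 0 = f"
  by transfer (auto simp: cbx_def has_sort_iff intro: cb_sum_id_right)

lemma interchange: "cd f = dm g \<Longrightarrow> cd f' = dm g' \<Longrightarrow> (f \<otimes> f') \<rhd> (g \<otimes> g') = (f \<rhd> g) \<otimes> (f' \<rhd> g')"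
  apply transfer
  subgoal for f g f' g'
    using cb_interchange[of f "dm_tm f" "cd_tm f" g "cd_tm g" f' "dm_tm f'" "cd_tm f'" g' "cd_tm g'"]
    by (auto simp: cbx_def has_sort_iff intro: cb_sym)
  done

text \<open>\<open>id_tm 1\<close> is \<open>Id0 \<uplus> Id1\<close>, so \<open>Id1\<close> becomes
  the identity on one wire only in the quotient.\<close>

lemma abs_arr_sums: "abs_arr Id0 = idn 0" "abs_arr Id1 = idn 1"
proof -
  show z: "abs_arr Id0 = idn 0" by (simp add: idn_def)
  have "idn 1 = abs_arr Id0 \<otimes> abs_arr Id1" by (simp add: idn_def pr.abs_eq One_nat_def)
  then show "abs_arr Id1 = idn 1" by (simp add: z)
qed

lemma id_pr_1: "idn n \<otimes> idn 1 = idn (Suc n)"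
  unfolding abs_arr_sums(2)[symmetric] by (simp add: idn.abs_eq pr.abs_eq)

lemma id_pr [simp]: "idn n \<otimes> idn m = idn (n + m)"
proof (induction m)
  case (Suc m)
  have "idn n \<otimes> idn (Suc m) = (idn n \<otimes> idn m) \<otimes> idn 1"
    by (simp only: id_pr_1[of m, symmetric] pr_assoc)
  then show ?case using Suc by (simp add: id_pr_1 del: pr_assoc)
qed simp

lemma id_pr_id_pr [simp]: "idn n \<otimes> idn m \<otimes> f = idn (n + m) \<otimes> f"
  by (simp flip: pr_assoc)

lemma braid_natural: "cd f = m \<Longrightarrow> cd g = q \<Longrightarrow> (f \<otimes> g) \<rhd> braid m q = braid (dm f) (dm g) \<rhd> (g \<otimes> f)"
  apply transfer
  subgoal for f m g q
    using cb_sym_natural[of f "dm_tm f" "cd_tm f" g "dm_tm g" "cd_tm g"]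
    by (auto simp: cbx_def has_sort_iff)
  done

lemma braid_braid [simp]: "braid n m \<rhd> braid m n = idn (n + m)"
  by transfer (use cb_sym_sym cb_eq_cbx in blast)

lemma hexagon: "braid n (m + k) = (braid n m \<otimes> idn k) \<rhd> (idn m \<otimes> braid n k)"
  by transfer (use cb_hexagon cb_eq_cbx in blast)

lemma braid_1_1: "braid 1 1 = swp"
  by transfer (use cb_sym_generator cb_eq_cbx in blast)

lemma cpy_assoc: "cpy \<rhd> (cpy \<otimes> idn 1) = cpy \<rhd> (idn 1 \<otimes> cpy)"
  unfolding abs_arr_sums[symmetric] by transfer (use cb_delta_assoc cb_eq_cbx in blast)

lemma cpy_unit: "cpy \<rhd> (dsc \<otimes> idn 1) = idn 1"
  unfolding abs_arr_sums[symmetric] by transfer (use cb_delta_unit cb_eq_cbx in blast)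

lemma cpy_comm: "cpy \<rhd> swp = cpy"
  by transfer (use cb_delta_comm cb_eq_cbx in blast)

lemma mrg_assoc: "(mrg \<otimes> idn 1) \<rhd> mrg = (idn 1 \<otimes> mrg) \<rhd> mrg"
  unfolding abs_arr_sums[symmetric] by transfer (use cb_mu_assoc cb_eq_cbx in blast)

lemma mrg_unit: "(unt \<otimes> idn 1) \<rhd> mrg = idn 1"
  unfolding abs_arr_sums[symmetric] by transfer (use cb_mu_unit cb_eq_cbx in blast)

lemma mrg_comm: "swp \<rhd> mrg = mrg"
  by transfer (use cb_mu_comm cb_eq_cbx in blast)

lemma frobenius_l: "(cpy \<otimes> idn 1) \<rhd> (idn 1 \<otimes> mrg) = mrg \<rhd> cpy"
  unfolding abs_arr_sums[symmetric] by transfer (use cb_frobenius_left cb_eq_cbx in blast)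

lemma frobenius_r: "(idn 1 \<otimes> cpy) \<rhd> (mrg \<otimes> idn 1) = mrg \<rhd> cpy"
  unfolding abs_arr_sums[symmetric] by transfer (use cb_frobenius_right cb_eq_cbx in blast)

lemma cpy_mrg: "cpy \<rhd> mrg = idn 1"
  unfolding abs_arr_sums[symmetric] by transfer (use cb_special cb_eq_cbx in blast)

section \<open>Canonical forms of monoid arrows\<close>

text \<open>Composites are normalized to the right; rewriting two adjacent layers inside one
  requires this form with a tail \<open>h\<close>.\<close>

lemma interchange': "cd f = dm g \<Longrightarrow> cd f' = dm g' \<Longrightarrow>
    (f \<otimes> f') \<rhd> (g \<otimes> g') \<rhd> h = ((f \<rhd> g) \<otimes> (f' \<rhd> g')) \<rhd> h"
  by (simp flip: sq_assoc add: interchange)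

lemma braid_0_right [simp]: "braid n 0 = idn n"
  by transfer (simp add: cbx_refl)

lemma braid_0_left [simp]: "braid 0 n = idn n"
  using braid_braid[of 0 n] by simp

lemma swp_swp [simp]: "swp \<rhd> swp = idn 2"
  using braid_braid[of 1 1] by (simp add: braid_1_1)

lemma id_pr_sq: "cd f = dm g \<Longrightarrow> idn n \<otimes> (f \<rhd> g) = (idn n \<otimes> f) \<rhd> (idn n \<otimes> g)"
  by (simp add: interchange)

lemma sq_pr_id: "cd f = dm g \<Longrightarrow> (f \<rhd> g) \<otimes> idn n = (f \<otimes> idn n) \<rhd> (g \<otimes> idn n)"
  by (simp add: interchange)

lemma slide: "dm f = n \<Longrightarrow> cd f = n' \<Longrightarrow> dm g = m \<Longrightarrow> cd g = m' \<Longrightarrow>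
    (f \<otimes> idn m) \<rhd> (idn n' \<otimes> g) = (idn n \<otimes> g) \<rhd> (f \<otimes> idn m')"
  by (simp add: interchange)

text \<open>The other hexagon follows by inverting the first: the candidate composes with
  \<open>braid k (n + m)\<close> to an identity, and that braiding has
  \<open>braid (n + m) k\<close> as inverse.\<close>

lemma hexagon': "braid (n + m) k = (idn n \<otimes> braid m k) \<rhd> (braid n k \<otimes> idn m)"
proof -
  let ?X = "(idn n \<otimes> braid m k) \<rhd> (braid n k \<otimes> idn m)"
  have "?X \<rhd> braid k (n + m) = (idn n \<otimes> braid m k) \<rhd> ((braid n k \<otimes> idn m) \<rhd> (braid k n \<otimes> idn m)) \<rhd> (idn n \<otimes> braid k m)"
    by (simp add: hexagon)
  also have "\<dots> = idn (n + (m + k))"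
    by (simp add: interchange)
  finally have "?X \<rhd> braid k (n + m) = idn (n + (m + k))" .
  then have "(?X \<rhd> braid k (n + m)) \<rhd> braid (n + m) k = idn (n + (m + k)) \<rhd> braid (n + m) k"
    by (rule arg_cong)
  then show ?thesis by (simp add: add.assoc)
qed

lemma braid_2_1: "braid 2 1 = (idn 1 \<otimes> swp) \<rhd> (swp \<otimes> idn 1)"
  using hexagon'[of 1 1 1] by (simp add: braid_1_1)

lemma braid_1_2: "braid 1 2 = (swp \<otimes> idn 1) \<rhd> (idn 1 \<otimes> swp)"
  using hexagon[of 1 1 1] by (simp add: braid_1_1)

text \<open>\<open>ins A x\<close> merges the last of \<open>A + 1\<close> wires into wire \<open>x\<close>.\<close>

definition jn :: "nat \<Rightarrow> arr" where
  "jn b = (idn 1 \<otimes> braid b 1) \<rhd> (mrg \<otimes> idn b)"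

definition ins :: "nat \<Rightarrow> nat \<Rightarrow> arr" where
  "ins A x = idn x \<otimes> jn (A - Suc x)"

lemma jn_sorts [simp]: "dm (jn b) = b + 2" "cd (jn b) = b + 1" "ok (jn b)"
  by (auto simp: jn_def)

lemma ins_sorts [simp]: "x < A \<Longrightarrow> dm (ins A x) = A + 1" "x < A \<Longrightarrow> cd (ins A x) = A" "ok (ins A x)"
  by (auto simp: ins_def)

lemma jn_0 [simp]: "jn 0 = mrg"
  by (simp add: jn_def)

lemma jn_1: "jn 1 = (idn 1 \<otimes> swp) \<rhd> (mrg \<otimes> idn 1)"
  by (simp add: jn_def braid_1_1)

text \<open>An arrow on the wires that the last wire crosses can be moved in front of the crossing
  and the merge, by naturality of the braiding.\<close>

lemma jn_natural:
  assumes "dm h = b" "cd h = c"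
  shows "jn b \<rhd> (idn 1 \<otimes> h) = (idn 1 \<otimes> h \<otimes> idn 1) \<rhd> jn c"
proof -
  have "jn b \<rhd> (idn 1 \<otimes> h) = (idn 1 \<otimes> braid b 1) \<rhd> (mrg \<otimes> idn b) \<rhd> (idn 1 \<otimes> h)"
    by (simp add: jn_def)
  also have "\<dots> = (idn 1 \<otimes> braid b 1) \<rhd> (idn 2 \<otimes> h) \<rhd> (mrg \<otimes> idn c)"
    using assms by (simp add: slide)
  also have "idn 2 \<otimes> h = idn 1 \<otimes> (idn 1 \<otimes> h)" by simp
  also have "(idn 1 \<otimes> braid b 1) \<rhd> (idn 1 \<otimes> (idn 1 \<otimes> h)) \<rhd> (mrg \<otimes> idn c) =
      (idn 1 \<otimes> (braid b 1 \<rhd> (idn 1 \<otimes> h))) \<rhd> (mrg \<otimes> idn c)"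
    using assms by (simp add: interchange' del: id_pr_id_pr)
  also have "braid b 1 \<rhd> (idn 1 \<otimes> h) = (h \<otimes> idn 1) \<rhd> braid c 1"
    using assms by (simp add: braid_natural)
  also have "(idn 1 \<otimes> ((h \<otimes> idn 1) \<rhd> braid c 1)) \<rhd> (mrg \<otimes> idn c) = (idn 1 \<otimes> h \<otimes> idn 1) \<rhd> jn c"
    using assms by (simp add: jn_def id_pr_sq)
  finally show ?thesis .
qed

text \<open>Crossing \<open>k + q\<close> wires means crossing the last \<open>q\<close> first. This
  separates the wires to the right of a layer from those on which the layer acts.\<close>

lemma jn_add: "jn (k + q) = (idn (k + 1) \<otimes> braid q 1) \<rhd> (jn k \<otimes> idn q)"
proof -
  have "jn (k + q) = (idn 1 \<otimes> ((idn k \<otimes> braid q 1) \<rhd> (braid k 1 \<otimes> idn q))) \<rhd> (mrg \<otimes> idn (k + q))"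
    by (simp add: jn_def hexagon')
  also have "\<dots> = (idn 1 \<otimes> idn k \<otimes> braid q 1) \<rhd> (idn 1 \<otimes> braid k 1 \<otimes> idn q) \<rhd> (mrg \<otimes> idn (k + q))"
    by (subst id_pr_sq) (simp_all del: id_pr_id_pr)
  also have "\<dots> = (idn (k + 1) \<otimes> braid q 1) \<rhd> ((idn 1 \<otimes> braid k 1) \<otimes> idn q) \<rhd> ((mrg \<otimes> idn k) \<otimes> idn q)"
    by (simp add: add.commute)
  also have "((idn 1 \<otimes> braid k 1) \<otimes> idn q) \<rhd> ((mrg \<otimes> idn k) \<otimes> idn q) = jn k \<otimes> idn q"
    unfolding jn_def by (rule sq_pr_id[symmetric]) simp
  finally show ?thesis .
qed

text \<open>A merge in front of \<open>g\<close> can be postponed until after \<open>g\<close>, with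
  the additional wire running alongside. The new position \<open>z\<close> is the value at
  \<open>y\<close> of the function that \<open>g\<close> denotes; leaving it existential avoids
  computing functions of composites syntactically.\<close>

definition absorbs :: "arr \<Rightarrow> bool" where
  "absorbs g \<longleftrightarrow> (\<forall>y<dm g. \<exists>z<cd g. ins (dm g) y \<rhd> g = (g \<otimes> idn 1) \<rhd> ins (cd g) z)"

lemma absorbs_unt: "absorbs unt"
  by (simp add: absorbs_def)

text \<open>Merging into the second input of \<open>mrg\<close> is associativity; for the first
  input the crossing is removed by commutativity as well.\<close>

lemma absorbs_mrg: "absorbs mrg"
proof -
  have "ins 2 0 \<rhd> mrg = (idn 1 \<otimes> swp) \<rhd> (mrg \<otimes> idn 1) \<rhd> mrg"
    by (simp add: ins_def jn_1 flip: One_nat_def)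
  also have "\<dots> = (idn 1 \<otimes> (swp \<rhd> mrg)) \<rhd> mrg"
    by (simp add: mrg_assoc interchange')
  also have "\<dots> = (mrg \<otimes> idn 1) \<rhd> ins 1 0"
    by (simp add: mrg_assoc mrg_comm ins_def)
  finally have "ins 2 0 \<rhd> mrg = (mrg \<otimes> idn 1) \<rhd> ins 1 0" .
  moreover have "ins 2 1 \<rhd> mrg = (mrg \<otimes> idn 1) \<rhd> ins 1 0"
    by (simp add: ins_def mrg_assoc)
  ultimately show ?thesis
    by (auto simp: absorbs_def less_2_cases_iff simp flip: One_nat_def)
qed

lemma absorbs_swp: "absorbs swp"
proof -
  have "ins 2 0 \<rhd> swp = (idn 1 \<otimes> swp) \<rhd> (mrg \<otimes> idn 1) \<rhd> braid 1 1"
    by (simp add: ins_def jn_1 braid_1_1 flip: One_nat_def)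
  also have "\<dots> = (idn 1 \<otimes> swp) \<rhd> (idn 1 \<otimes> swp) \<rhd> (swp \<otimes> idn 1) \<rhd> (idn 1 \<otimes> mrg)"
    by (simp add: braid_natural braid_2_1)
  also have "\<dots> = (swp \<otimes> idn 1) \<rhd> ins 2 1"
    by (simp add: interchange' ins_def)
  finally have 0: "ins 2 0 \<rhd> swp = (swp \<otimes> idn 1) \<rhd> ins 2 1" .
  have "ins 2 1 \<rhd> swp = (idn 1 \<otimes> mrg) \<rhd> braid 1 1"
    by (simp add: ins_def braid_1_1)
  also have "\<dots> = (swp \<otimes> idn 1) \<rhd> ins 2 0"
    by (simp add: braid_natural braid_1_2 ins_def jn_1 flip: One_nat_def)
  finally have 1: "ins 2 1 \<rhd> swp = (swp \<otimes> idn 1) \<rhd> ins 2 0" .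
  show ?thesis unfolding absorbs_def
  proof (intro allI impI)
    fix y assume "y < dm swp"
    then consider "y = 0" | "y = 1" by (auto simp: less_2_cases_iff One_nat_def)
    then show "\<exists>z<cd swp. ins (dm swp) y \<rhd> swp = (swp \<otimes> idn 1) \<rhd> ins (cd swp) z"
      by cases (use 0 1 in \<open>auto intro: exI[of _ 0] exI[of _ 1]\<close>)
  qed
qed

text \<open>Absorption is inherited by a generator between identities. If wire \<open>x\<close> is
  left of \<open>g\<close>, then \<open>g\<close> sits on crossed wires and
  \<open>jn_natural\<close> applies; if it enters \<open>g\<close>, \<open>jn_add\<close> splits off
  the \<open>q\<close> wires to the right; if it is right of \<open>g\<close>, the merge and
  \<open>g\<close> act on disjoint wires.\<close>

lemma ins_layer:
  assumes g: "absorbs g" and x: "x < a + dm g + q"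
  obtains y where "y < a + cd g + q"
    "ins (a + dm g + q) x \<rhd> (idn a \<otimes> g \<otimes> idn q) = ((idn a \<otimes> g \<otimes> idn q) \<otimes> idn 1) \<rhd> ins (a + cd g + q) y"
proof -
  consider "x < a" | "a \<le> x" "x < a + dm g" | "a + dm g \<le> x" by linarith
  then show thesis
  proof cases
    case 1
    define p where "p = a - Suc x"
    have a: "a = x + (1 + p)" using 1 by (simp add: p_def)
    define h where "h = idn p \<otimes> g \<otimes> idn q"
    have h: "dm h = p + dm g + q" "cd h = p + cd g + q" by (simp_all add: h_def)
    have L: "idn a \<otimes> g \<otimes> idn q = idn x \<otimes> idn 1 \<otimes> h"
      by (simp add: h_def a add.assoc)
    have "ins (a + dm g + q) x = idn x \<otimes> jn (p + dm g + q)" "ins (a + cd g + q) x = idn x \<otimes> jn (p + cd g + q)"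
      by (simp_all add: ins_def a add.assoc)
    moreover have "(idn x \<otimes> jn (p + dm g + q)) \<rhd> (idn x \<otimes> idn 1 \<otimes> h) =
        (idn x \<otimes> idn 1 \<otimes> h \<otimes> idn 1) \<rhd> (idn x \<otimes> jn (p + cd g + q))"
      using jn_natural[OF h] h by (simp add: interchange del: id_pr_id_pr)
    ultimately show ?thesis
      using that[of x] 1 by (simp add: L del: id_pr_id_pr)
  next
    case 2
    define y where "y = x - a"
    define k where "k = dm g - Suc y"
    have y: "x = a + y" "y < dm g" and k: "dm g = y + (k + 1)" using 2 by (auto simp: y_def k_def)
    obtain z where z: "z < cd g" "ins (dm g) y \<rhd> g = (g \<otimes> idn 1) \<rhd> ins (cd g) z"
      using g y by (auto simp: absorbs_def)
    define l where "l = cd g - Suc z"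
    have l: "cd g = z + (l + 1)" using z by (simp add: l_def)
    have ik: "ins (dm g + q) y = (idn (dm g) \<otimes> braid q 1) \<rhd> (ins (dm g) y \<otimes> idn q)"
      by (simp add: ins_def k jn_add id_pr_sq)
    have il: "ins (cd g + q) z = (idn (cd g) \<otimes> braid q 1) \<rhd> (ins (cd g) z \<otimes> idn q)"
      by (simp add: ins_def l jn_add id_pr_sq)
    have "ins (dm g + q) y \<rhd> (g \<otimes> idn q) = (idn (dm g) \<otimes> braid q 1) \<rhd> ((ins (dm g) y \<rhd> g) \<otimes> idn q)"
      unfolding ik using y by (simp add: interchange)
    also have "\<dots> = (idn (dm g) \<otimes> braid q 1) \<rhd> (g \<otimes> idn (1 + q)) \<rhd> (ins (cd g) z \<otimes> idn q)"
      unfolding z(2) using z(1) by (subst sq_pr_id) simp_all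
    also have "\<dots> = (g \<otimes> idn (q + 1)) \<rhd> (idn (cd g) \<otimes> braid q 1) \<rhd> (ins (cd g) z \<otimes> idn q)"
      by (simp add: interchange' add.commute)
    also have "\<dots> = ((g \<otimes> idn q) \<otimes> idn 1) \<rhd> ins (cd g + q) z"
      unfolding il by simp
    finally have *: "ins (dm g + q) y \<rhd> (g \<otimes> idn q) = ((g \<otimes> idn q) \<otimes> idn 1) \<rhd> ins (cd g + q) z" .
    have "ins (a + dm g + q) x = idn a \<otimes> ins (dm g + q) y" "ins (a + cd g + q) (a + z) = idn a \<otimes> ins (cd g + q) z"
      by (simp_all add: ins_def y(1))
    moreover have "(idn a \<otimes> ins (dm g + q) y) \<rhd> (idn a \<otimes> (g \<otimes> idn q)) =
       (idn a \<otimes> ((g \<otimes> idn q) \<otimes> idn 1)) \<rhd> (idn a \<otimes> ins (cd g + q) z)"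
      using * y z by (simp add: interchange del: pr_assoc)
    ultimately show ?thesis
      using that[of "a + z"] z(1) by simp
  next
    case 3
    define y where "y = x - a - dm g"
    have y: "x = a + dm g + y" "y < q" using 3 x by (auto simp: y_def)
    have e: "ins (a + dm g + q) x = idn (a + dm g) \<otimes> ins q y" "ins (a + cd g + q) (a + cd g + y) = idn (a + cd g) \<otimes> ins q y"
      by (simp_all add: ins_def y(1))
    have "(idn (a + dm g) \<otimes> ins q y) \<rhd> ((idn a \<otimes> g) \<otimes> idn q) = ((idn a \<otimes> g) \<otimes> idn (q + 1)) \<rhd> (idn (a + cd g) \<otimes> ins q y)"
      using y by (simp add: interchange del: pr_assoc)
    then show ?thesis
      using that[of "a + cd g + y"] y(2) by (simp add: e)
  qed
qed

section \<open>Canonical terms\<close>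

primrec unts :: "nat \<Rightarrow> arr" where
  "unts 0 = idn 0"
| "unts (Suc n) = unts n \<otimes> unt"

lemma unts_sorts [simp]: "dm (unts n) = 0" "cd (unts n) = n" "ok (unts n)"
  by (induction n) auto

lemma unts_1 [simp]: "unts 1 = unt"
  by (simp add: One_nat_def)

lemma unts_add: "unts (n + m) = unts n \<otimes> unts m"
  by (induction m) (simp_all flip: pr_assoc)

text \<open>Every output starts as a unit, so an input is always merged into an existing wire and no
  case distinction on the image of \<open>\<phi>\<close> arises.\<close>

primrec can :: "nat \<Rightarrow> nat \<Rightarrow> (nat \<Rightarrow> nat) \<Rightarrow> arr" where
  "can 0 A \<phi> = unts A"
| "can (Suc n) A \<phi> = (can n A \<phi> \<otimes> idn 1) \<rhd> ins A (\<phi> n)"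

lemma can_sorts [simp]: "maps \<phi> n A \<Longrightarrow> dm (can n A \<phi>) = n" "maps \<phi> n A \<Longrightarrow> cd (can n A \<phi>) = A"
    "maps \<phi> n A \<Longrightarrow> ok (can n A \<phi>)"
  by (induction n) (auto simp: maps_def)

lemma can_cong: "(\<And>i. i < n \<Longrightarrow> \<phi> i = \<psi> i) \<Longrightarrow> can n A \<phi> = can n A \<psi>"
  by (induction n) auto

text \<open>The layer travels backwards through the insertions, last input first, and finally meets
  the initial units, where the second hypothesis on \<open>g\<close> dissolves it.\<close>

lemma can_layer:
  assumes g: "absorbs g" "unts (dm g) \<rhd> g = unts (cd g)"
  shows "maps \<phi> n (a + dm g + q) \<Longrightarrow>
    \<exists>\<psi>. maps \<psi> n (a + cd g + q) \<and> can n (a + dm g + q) \<phi> \<rhd> (idn a \<otimes> g \<otimes> idn q) = can n (a + cd g + q) \<psi>"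
proof (induction n)
  case 0
  have "(unts a \<otimes> unts (dm g) \<otimes> unts q) \<rhd> (idn a \<otimes> g \<otimes> idn q) = unts a \<otimes> unts (cd g) \<otimes> unts q"
    using g(2) by (simp add: interchange)
  then show ?case by (simp add: unts_add)
next
  case (Suc n)
  let ?L = "idn a \<otimes> g \<otimes> idn q"
  have m: "maps \<phi> n (a + dm g + q)" "\<phi> n < a + dm g + q" using Suc.prems by (auto simp: maps_def)
  obtain \<psi> where \<psi>: "maps \<psi> n (a + cd g + q)" "can n (a + dm g + q) \<phi> \<rhd> ?L = can n (a + cd g + q) \<psi>"
    using Suc.IH[OF m(1)] by blast
  obtain y where y: "y < a + cd g + q" "ins (a + dm g + q) (\<phi> n) \<rhd> ?L = (?L \<otimes> idn 1) \<rhd> ins (a + cd g + q) y"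
    using ins_layer[OF g(1) m(2)] by blast
  let ?\<psi> = "\<psi>(n := y)"
  have c: "can n (a + cd g + q) ?\<psi> = can n (a + cd g + q) \<psi>" by (rule can_cong) simp
  have "can (Suc n) (a + dm g + q) \<phi> \<rhd> ?L = (can n (a + dm g + q) \<phi> \<otimes> idn 1) \<rhd> (?L \<otimes> idn 1) \<rhd> ins (a + cd g + q) y"
    using y(2) by simp
  also have "\<dots> = can (Suc n) (a + cd g + q) ?\<psi>"
    using m \<psi>(2) by (simp add: interchange' c del: pr_assoc)
  finally have "can (Suc n) (a + dm g + q) \<phi> \<rhd> ?L = can (Suc n) (a + cd g + q) ?\<psi>" .
  moreover have "maps ?\<psi> (Suc n) (a + cd g + q)" using \<psi>(1) y(1) by (auto simp: maps_def less_Suc_eq)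
  ultimately show ?case by blast
qed

inductive_set Mon :: "arr set" where
  Mon_id: "idn n \<in> Mon"
| Mon_mrg: "mrg \<in> Mon"
| Mon_unt: "unt \<in> Mon"
| Mon_swp: "swp \<in> Mon"
| Mon_sq: "f \<in> Mon \<Longrightarrow> g \<in> Mon \<Longrightarrow> cd f = dm g \<Longrightarrow> f \<rhd> g \<in> Mon"
| Mon_pr: "f \<in> Mon \<Longrightarrow> g \<in> Mon \<Longrightarrow> f \<otimes> g \<in> Mon"

lemma Mon_ok: "f \<in> Mon \<Longrightarrow> ok f"
  by (induction rule: Mon.induct) auto

text \<open>The identities on both sides make the induction work: a parallel composite is split into
  two successive layers, each widened by the wires of the other.\<close>

lemma can_sq_layer:
  "f \<in> Mon \<Longrightarrow> maps \<phi> n (a + dm f + q) \<Longrightarrow>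
    \<exists>\<psi>. maps \<psi> n (a + cd f + q) \<and> can n (a + dm f + q) \<phi> \<rhd> (idn a \<otimes> f \<otimes> idn q) = can n (a + cd f + q) \<psi>"
proof (induction f arbitrary: a q \<phi> rule: Mon.induct)
  case (Mon_id k)
  then show ?case by (intro exI[of _ \<phi>]) (simp add: add.assoc)
next
  case Mon_mrg
  have "unt \<otimes> unt = unt \<rhd> (unt \<otimes> idn 1)"
    using interchange[of "idn 0" unt unt "idn 1"] by simp
  then have "unts (dm mrg) \<rhd> mrg = unt \<rhd> (unt \<otimes> idn 1) \<rhd> mrg"
    by (simp add: numeral_2_eq_2)
  also have "\<dots> = unts (cd mrg)" by (simp add: mrg_unit)
  finally show ?case using can_layer[OF absorbs_mrg] Mon_mrg by blast
next
  case Mon_unt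
  have "unts (dm unt) \<rhd> unt = unts (cd unt)" by simp
  then show ?case using can_layer[OF absorbs_unt] Mon_unt by blast
next
  case Mon_swp
  have "unts (dm swp) \<rhd> swp = (unt \<otimes> unt) \<rhd> braid 1 1"
    by (simp add: numeral_2_eq_2 braid_1_1)
  also have "\<dots> = unts (cd swp)" by (simp add: braid_natural numeral_2_eq_2)
  finally show ?case using can_layer[OF absorbs_swp] Mon_swp by blast
next
  case (Mon_sq f g)
  obtain \<psi> where \<psi>: "maps \<psi> n (a + cd f + q)" "can n (a + dm f + q) \<phi> \<rhd> (idn a \<otimes> f \<otimes> idn q) = can n (a + cd f + q) \<psi>"
    using Mon_sq.IH(1)[of \<phi> a q] Mon_sq.prems by auto
  obtain \<chi> where \<chi>: "maps \<chi> n (a + cd g + q)" "can n (a + dm g + q) \<psi> \<rhd> (idn a \<otimes> g \<otimes> idn q) = can n (a + cd g + q) \<chi>"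
    using Mon_sq.IH(2)[of \<psi> a q] \<psi>(1) Mon_sq.hyps by auto
  have "idn a \<otimes> (f \<rhd> g) \<otimes> idn q = (idn a \<otimes> f \<otimes> idn q) \<rhd> (idn a \<otimes> g \<otimes> idn q)"
    using Mon_sq.hyps by (simp add: interchange)
  then have "can n (a + dm (f \<rhd> g) + q) \<phi> \<rhd> (idn a \<otimes> (f \<rhd> g) \<otimes> idn q) = can n (a + cd g + q) \<chi>"
    using \<psi>(2) \<chi>(2) Mon_sq.hyps by (simp flip: sq_assoc)
  with \<chi>(1) show ?case by auto
next
  case (Mon_pr f g)
  obtain \<psi> where \<psi>: "maps \<psi> n (a + cd f + (dm g + q))"
     "can n (a + dm f + (dm g + q)) \<phi> \<rhd> (idn a \<otimes> f \<otimes> idn (dm g + q)) = can n (a + cd f + (dm g + q)) \<psi>"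
    using Mon_pr.IH(1)[of \<phi> a "dm g + q"] Mon_pr.prems by (auto simp: add.assoc)
  obtain \<chi> where \<chi>: "maps \<chi> n (a + cd f + cd g + q)"
     "can n (a + cd f + dm g + q) \<psi> \<rhd> (idn (a + cd f) \<otimes> g \<otimes> idn q) = can n (a + cd f + cd g + q) \<chi>"
    using Mon_pr.IH(2)[of \<psi> "a + cd f" q] \<psi>(1) by (auto simp: add.assoc)
  have "idn a \<otimes> (f \<otimes> g) \<otimes> idn q = (idn a \<otimes> f \<otimes> idn (dm g + q)) \<rhd> (idn (a + cd f) \<otimes> g \<otimes> idn q)"
    by (simp add: interchange flip: id_pr id_pr_id_pr)
  then have "can n (a + dm (f \<otimes> g) + q) \<phi> \<rhd> (idn a \<otimes> (f \<otimes> g) \<otimes> idn q) = can n (a + cd f + cd g + q) \<chi>"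
    using \<psi>(2) \<chi>(2) by (simp add: add.assoc flip: sq_assoc)
  with \<chi>(1) show ?case by (auto simp: add.assoc)
qed

text \<open>For one more wire, put a unit next to the canonical form of the identity and merge the
  last input into it; the unit law cancels the two.\<close>

lemma id_can: "\<exists>\<phi>. maps \<phi> n n \<and> idn n = can n n \<phi>"
proof (induction n)
  case 0
  then show ?case by simp
next
  case (Suc n)
  then obtain \<phi> where \<phi>: "maps \<phi> n n" "idn n = can n n \<phi>" by blast
  obtain \<psi> where \<psi>: "maps \<psi> n (Suc n)" "idn n \<rhd> (idn n \<otimes> unt) = can n (Suc n) \<psi>"
    using can_sq_layer[OF Mon_unt, of \<phi> n n 0] \<phi>(1) by (auto simp: \<phi>(2)[symmetric] Suc_eq_plus1)
  let ?\<psi> = "\<psi>(n := n)"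
  have c: "can n (Suc n) ?\<psi> = can n (Suc n) \<psi>" by (rule can_cong) simp
  have "can (Suc n) (Suc n) ?\<psi> = (idn n \<otimes> unt \<otimes> idn 1) \<rhd> (idn n \<otimes> mrg)"
    unfolding can.simps c \<psi>(2)[symmetric] by (simp add: ins_def)
  also have "\<dots> = idn (Suc n)" by (simp add: interchange mrg_unit Suc_eq_plus1)
  finally have "idn (Suc n) = can (Suc n) (Suc n) ?\<psi>" by simp
  moreover have "maps ?\<psi> (Suc n) (Suc n)" using \<psi>(1) by (auto simp: maps_def less_Suc_eq)
  ultimately show ?case by blast
qed

lemma Mon_can:
  assumes "f \<in> Mon"
  obtains \<phi> where "maps \<phi> (dm f) (cd f)" "f = can (dm f) (cd f) \<phi>"
proof -
  obtain \<phi> where \<phi>: "maps \<phi> (dm f) (dm f)" "idn (dm f) = can (dm f) (dm f) \<phi>" using id_can by blast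
  obtain \<psi> where \<psi>: "maps \<psi> (dm f) (cd f)" "can (dm f) (dm f) \<phi> \<rhd> f = can (dm f) (cd f) \<psi>"
    using can_sq_layer[OF assms, of \<phi> "dm f" 0 0] \<phi>(1) by auto
  have "f = can (dm f) (cd f) \<psi>" unfolding \<psi>(2)[symmetric] \<phi>(2)[symmetric] by simp
  with \<psi>(1) show thesis by (rule that)
qed

section \<open>Interpretation of terms as cospans\<close>

lemma fnc_tensor_id: "maps f n m \<Longrightarrow> fnc n m f \<boxtimes> fnc k k (\<lambda>i. i) = fnc (n + k) (m + k) (cp n f (\<lambda>i. m + i))"
  by (simp add: fnc_tensor)

lemma id_tensor_fnc: "maps f n m \<Longrightarrow> fnc k k (\<lambda>i. i) \<boxtimes> fnc n m f = fnc (k + n) (k + m) (cp k (\<lambda>i. i) (\<lambda>i. k + f i))"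
  by (simp add: fnc_tensor)

lemma maps_cp_id: "maps f n m \<Longrightarrow> maps (cp n f (\<lambda>i. m + i)) (n + k) (m + k)"
  by (rule maps_cp_sum) simp_all

lemma maps_id_cp: "maps f n m \<Longrightarrow> maps (cp k (\<lambda>i. i) (\<lambda>i. k + f i)) (k + n) (k + m)"
  by (rule maps_cp_sum) simp_all

primrec sem_tm :: "cb_term \<Rightarrow> cospan set" where
  "sem_tm Delta = delta Cospan 1"
| "sem_tm Eps = eps Cospan 1"
| "sem_tm Mu = mu Cospan 1"
| "sem_tm Eta = eta Cospan 1"
| "sem_tm Id0 = idt Cospan 0"
| "sem_tm Id1 = idt Cospan 1"
| "sem_tm Sigma1 = symm Cospan 1 1"
| "sem_tm (c \<Zsemi> d) = sem_tm c \<star> sem_tm d"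
| "sem_tm (c \<uplus> d) = sem_tm c \<boxtimes> sem_tm d"

context begin

interpretation preordered_cartesian_bicategory Cospan by (rule cospan_pcb)

lemma sem_tm_hom: "has_sort c n m \<Longrightarrow> sem_tm c \<in> hom Cospan n m"
proof (induction rule: has_sort.induct)
  case 1 show ?case using delta_hom[of 1] by (simp del: Cospan_simps(12) add: one_add_one)
next
  case 2 show ?case using eps_hom[of 1] by simp
next
  case 3 show ?case using mu_hom[of 1] by (simp add: one_add_one)
next
  case 4 show ?case using eta_hom[of 1] by simp
next
  case 5 show ?case using idt_hom[of 0] by simp
next
  case 6 show ?case using idt_hom[of 1] by simp
next
  case 7 show ?case using symm_hom[of 1 1] by (simp add: one_add_one)
next
  case 8 then show ?case by (simp add: seq_in_hom)
next
  case 9 then show ?case by (simp add: tensor_in_hom)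
qed

lemma sem_id_tm [simp]: "sem_tm (id_tm n) = fnc n n (\<lambda>i. i)"
  by (induction n) (simp_all add: One_nat_def)

lemma sem_sym1_tm: "sem_tm (sym1_tm n) = symm Cospan n 1"
proof (induction n)
  case 0
  show ?case by (simp add: cp_def)
next
  case (Suc n)
  let ?s = "\<lambda>n. cp n (\<lambda>i. 1 + i) (\<lambda>i. i)"
  have "sem_tm (sym1_tm (Suc n)) = (fnc n n (\<lambda>i. i) \<boxtimes> fnc (1 + 1) (1 + 1) (?s 1)) \<star> (fnc (n + 1) (1 + n) (?s n) \<boxtimes> fnc 1 1 (\<lambda>i. i))"
    using Suc by simp
  also have "\<dots> = fnc (n + (1 + 1)) (n + (1 + 1)) (cp n (\<lambda>i. i) (\<lambda>i. n + ?s 1 i)) \<star>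
      fnc (n + 1 + 1) (1 + n + 1) (cp (n + 1) (?s n) (\<lambda>i. 1 + n + i))"
    by (simp only: id_tensor_fnc[OF maps_braid] fnc_tensor_id[OF maps_braid])
  also have "\<dots> = fnc (n + (1 + 1)) (1 + n + 1) (\<lambda>x. cp (n + 1) (?s n) (\<lambda>i. 1 + n + i) (cp n (\<lambda>i. i) (\<lambda>i. n + ?s 1 i) x))"
    using fnc_seq[OF maps_id_cp[OF maps_braid[of 1 1], of n] maps_cp_id[OF maps_braid[of n 1], of 1, unfolded add.assoc[of n]]]
    by (simp only: add.assoc[of n])
  also have "\<dots> = fnc (n + (1 + 1)) (1 + n + 1) (?s (Suc n))"
    by (rule fnc_cong) (auto simp: cp_def)
  finally show ?case by (simp add: One_nat_def)
qed

lemma sem_sym_tm [simp]: "sem_tm (sym_tm n m) = fnc (n + m) (m + n) (cp n (\<lambda>i. m + i) (\<lambda>i. i))"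
proof (induction m)
  case 0
  show ?case unfolding sym_tm.simps sem_id_tm by simp (rule fnc_cong, simp add: cp_def)
next
  case (Suc m)
  let ?s = "\<lambda>n m. cp n (\<lambda>i. m + i) (\<lambda>i. i)"
  have "sem_tm (sym_tm n (Suc m)) = (fnc (n + m) (m + n) (?s n m) \<boxtimes> fnc 1 1 (\<lambda>i. i)) \<star> (fnc m m (\<lambda>i. i) \<boxtimes> fnc (n + 1) (1 + n) (?s n 1))"
    using Suc by (simp add: sem_sym1_tm)
  also have "\<dots> = fnc (n + m + 1) (m + n + 1) (cp (n + m) (?s n m) (\<lambda>i. m + n + i)) \<star>
      fnc (m + (n + 1)) (m + (1 + n)) (cp m (\<lambda>i. i) (\<lambda>i. m + ?s n 1 i))"
    by (simp only: id_tensor_fnc[OF maps_braid] fnc_tensor_id[OF maps_braid])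
  also have "\<dots> = fnc (n + m + 1) (m + (1 + n)) (\<lambda>x. cp m (\<lambda>i. i) (\<lambda>i. m + ?s n 1 i) (cp (n + m) (?s n m) (\<lambda>i. m + n + i) x))"
    using fnc_seq[OF maps_cp_id[OF maps_braid[of n m], of 1] maps_id_cp[OF maps_braid[of n 1], of m, folded add.assoc[of m n 1]]]
    by (simp only: add.assoc[of m n 1])
  also have "\<dots> = fnc (n + m + 1) (m + (1 + n)) (?s n (Suc m))"
    by (rule fnc_cong) (auto simp: cp_def)
  finally show ?case by (simp add: One_nat_def)
qed

text \<open>Soundness of the equations. The laws of a bicategory at the object \<open>1\<close>
  differ from the laws on terms by associators and unitors, which are identity cospans and get
  cancelled.\<close>

lemma sem_tm_eq: "cb_eq n m c d \<Longrightarrow> sem_tm c = sem_tm d"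
proof (induction rule: cb_eq.induct)
  case (cb_seq_assoc c n k d l e m)
  then show ?case by (simp add: cseq_assoc[OF sem_tm_hom sem_tm_hom sem_tm_hom])
next
  case (cb_seq_id_left c n m)
  then show ?case by (simp add: id_seq[OF sem_tm_hom])
next
  case (cb_seq_id_right c n m)
  then show ?case by (simp add: seq_id[OF sem_tm_hom])
next
  case (cb_sum_assoc c n m d p q e r s)
  then show ?case by (simp add: ctensor_assoc[OF sem_tm_hom sem_tm_hom sem_tm_hom])
next
  case (cb_sum_id_left c n m)
  then show ?case by (simp add: ctensor_id_left[OF sem_tm_hom])
next
  case (cb_sum_id_right c n m)
  then show ?case by (simp add: ctensor_id_right[OF sem_tm_hom])
next
  case (cb_interchange c n k d m c' p l d' q)
  then show ?case by (simp add: cinterchange[OF sem_tm_hom sem_tm_hom sem_tm_hom sem_tm_hom])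
next
  case (cb_sym_natural c n m d p q)
  then show ?case by (simp add: cbraid_natural[OF sem_tm_hom sem_tm_hom])
next
  case (cb_sym_sym n m)
  show ?case using symm_symm[of n m] by simp
next
  case (cb_hexagon n m k)
  have h: "symm Cospan n (m + k) \<in> hom Cospan (n + m + k) (m + k + n)"
    using symm_hom[of n "m + k"] by (simp add: add.assoc)
  have "symm Cospan n m \<boxtimes> idt Cospan k \<in> hom Cospan (n + m + k) (m + n + k)"
    using tensor_hom[OF symm_hom[of n m] idt_hom[of k]] by simp
  with seq_id[OF this] id_seq[OF h] seq_id[OF h] hexagon[of n m k] show ?case
    by (simp add: add.assoc)
next
  case cb_sym_generator
  show ?case by simp
next
  case cb_delta_assoc
  have "delta Cospan 1 \<star> (delta Cospan 1 \<boxtimes> idt Cospan 1) \<in> hom Cospan 1 (1 + 1 + 1)"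
    using seq_hom[OF delta_hom tensor_hom[OF delta_hom idt_hom], of 1] by simp
  from seq_id[OF this] delta_assoc[of 1] show ?case by simp
next
  case cb_delta_unit
  have "delta Cospan 1 \<star> (eps Cospan 1 \<boxtimes> idt Cospan 1) \<in> hom Cospan 1 1"
    using seq_hom[OF delta_hom tensor_hom[OF eps_hom idt_hom], of 1] by simp
  from seq_id[OF this] delta_lunit[of 1] show ?case by simp
next
  case cb_delta_comm
  show ?case using delta_comm[of 1] by simp
next
  case cb_mu_assoc
  have "idt Cospan 1 \<boxtimes> mu Cospan 1 \<in> hom Cospan (1 + 1 + 1) (1 + 1)"
    using tensor_hom[OF idt_hom mu_hom, of 1 1] by (simp add: add.assoc)
  from id_seq[OF this] mu_assoc[of 1] show ?case by simp
next
  case cb_mu_unit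
  show ?case using mu_lunit[of 1] by simp
next
  case cb_mu_comm
  show ?case using mu_comm[of 1] by simp
next
  case cb_frobenius_left
  have "delta Cospan 1 \<boxtimes> idt Cospan 1 \<in> hom Cospan (1 + 1) (1 + 1 + 1)"
    using tensor_hom[OF delta_hom idt_hom, of 1 1] by simp
  from seq_id[OF this] frobenius_left[of 1] show ?case by simp
next
  case cb_frobenius_right
  have "idt Cospan 1 \<boxtimes> delta Cospan 1 \<in> hom Cospan (1 + 1) (1 + 1 + 1)"
    using tensor_hom[OF idt_hom delta_hom, of 1 1] by (simp add: add.assoc)
  from seq_id[OF this] frobenius_right[of 1] show ?case by simp
next
  case cb_special
  show ?case using special[of 1] by simp
qed simp_all

lemma cb_le_sort: "cb_le n m c d \<Longrightarrow> has_sort c n m \<and> has_sort d n m"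
  by (induction rule: cb_le.induct) (auto simp: has_sort_iff dest: cb_eq_sort)

lemma sem_tm_le: "cb_le n m c d \<Longrightarrow> sem_tm c \<preceq>\<^bsub>Cospan\<^esub> sem_tm d"
proof (induction rule: cb_le.induct)
  case (cb_le_eq n m c d)
  then show ?case using leq_refl[OF sem_tm_hom] cb_eq_sort sem_tm_eq by metis
next
  case (cb_le_trans n m c d e)
  then show ?case using leq_trans[OF sem_tm_hom sem_tm_hom sem_tm_hom] cb_le_sort by blast
next
  case (cb_le_seq n k c c' m d d')
  then show ?case using seq_mono[OF sem_tm_hom sem_tm_hom sem_tm_hom sem_tm_hom] cb_le_sort by simp blast
next
  case (cb_le_sum n m c c' p q d d')
  then show ?case using tensor_mono[OF sem_tm_hom sem_tm_hom sem_tm_hom sem_tm_hom] cb_le_sort by simp blast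
next
  case cb_le_eps_eta show ?case using eps_eta[of 1] by simp
next
  case cb_le_eta_eps show ?case using eta_eps[of 1] by simp
next
  case cb_le_delta_mu show ?case using delta_mu[of 1] by simp
next
  case cb_le_mu_delta show ?case using mu_delta[of 1] by (simp add: one_add_one)
qed

end

text \<open>\<open>cbx\<close> identifies ill-typed terms without regard to their cospans, hence the
  common default value \<open>{}\<close> for them.\<close>

lift_definition sem :: "arr \<Rightarrow> cospan set" is "\<lambda>c. if wf_tm c then sem_tm c else {}"
  by (auto simp: cbx_def dest: sem_tm_eq)

lemma sem_simps [simp]:
  "ok f \<Longrightarrow> ok g \<Longrightarrow> cd f = dm g \<Longrightarrow> sem (f \<rhd> g) = sem f \<star> sem g"
  "ok f \<Longrightarrow> ok g \<Longrightarrow> sem (f \<otimes> g) = sem f \<boxtimes> sem g"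
  "sem (idn n) = fnc n n (\<lambda>i. i)"
  "sem (braid n m) = fnc (n + m) (m + n) (cp n (\<lambda>i. m + i) (\<lambda>i. i))"
  "sem cpy = delta Cospan 1" "sem dsc = eps Cospan 1" "sem mrg = mu Cospan 1" "sem unt = eta Cospan 1"
  "sem swp = symm Cospan 1 1"
  by (transfer; simp)+

lemma sem_hom: "ok f \<Longrightarrow> sem f \<in> hom Cospan (dm f) (cd f)"
  by transfer (simp add: sem_tm_hom has_sort_iff)

lift_definition le :: "arr \<Rightarrow> arr \<Rightarrow> bool" is "\<lambda>c d. wf_tm c \<and> (\<exists>n m. cb_le n m c d)"
proof -
  have "wf_tm c' \<and> (\<exists>n m. cb_le n m c' d')" if h: "cbx c c'" "cbx d d'" "wf_tm c \<and> (\<exists>n m. cb_le n m c d)" for c c' d d'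
  proof -
    obtain n m where le: "cb_le n m c d" using h(3) by blast
    have s: "has_sort c n m" "has_sort d n m" using cb_le_sort[OF le] by auto
    then have "cb_eq n m c' c" "cb_eq n m d d'" "wf_tm c'" using h by (auto simp: cbx_def has_sort_iff intro: cb_sym)
    with le show ?thesis using cb_le_trans cb_le_eq by blast
  qed
  moreover have "cbx c c' \<Longrightarrow> cbx c' c" for c c' unfolding cbx_def using cb_sym by metis
  ultimately show "cbx c c' \<Longrightarrow> cbx d d' \<Longrightarrow>
      (wf_tm c \<and> (\<exists>n m. cb_le n m c d)) = (wf_tm c' \<and> (\<exists>n m. cb_le n m c' d'))" for c c' d d'
    by blast
qed

lemma le_refl: "ok f \<Longrightarrow> le f f"
  by transfer (use cb_le_eq cb_refl has_sort_iff in blast)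

lemma le_trans: "le f g \<Longrightarrow> le g h \<Longrightarrow> le f h"
  by transfer (metis cb_le_sort cb_le_trans has_sort_iff)

lemma le_sq: "le f f' \<Longrightarrow> le g g' \<Longrightarrow> cd f = dm g \<Longrightarrow> le (f \<rhd> g) (f' \<rhd> g')"
  apply transfer
  subgoal for f f' g g'
    using cb_le_sort[of _ _ f f'] cb_le_sort[of _ _ g g'] cb_le_seq by (fastforce simp: has_sort_iff)
  done

lemma le_pr: "le f f' \<Longrightarrow> le g g' \<Longrightarrow> le (f \<otimes> g) (f' \<otimes> g')"
  apply transfer
  subgoal for f f' g g'
    using cb_le_sort[of _ _ f f'] cb_le_sort[of _ _ g g'] cb_le_sum by (fastforce simp: has_sort_iff)
  done

lemma le_mrg_cpy: "le (mrg \<rhd> cpy) (idn 2)"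
  by transfer (use cb_le_mu_delta in auto)

lemma le_unt_dsc: "le (unt \<rhd> dsc) (idn 0)"
  by transfer (use cb_le_eta_eps in auto)

lemma sem_le: "le f g \<Longrightarrow> sem f \<preceq>\<^bsub>Cospan\<^esub> sem g"
  by transfer (auto dest: cb_le_sort sem_tm_le simp: has_sort_iff)

section \<open>Duality\<close>

primrec op_tm :: "cb_term \<Rightarrow> cb_term" where
  "op_tm Delta = Mu" | "op_tm Eps = Eta" | "op_tm Mu = Delta" | "op_tm Eta = Eps"
| "op_tm Id0 = Id0" | "op_tm Id1 = Id1" | "op_tm Sigma1 = Sigma1"
| "op_tm (c \<Zsemi> d) = op_tm d \<Zsemi> op_tm c" | "op_tm (c \<uplus> d) = op_tm c \<uplus> op_tm d"

lemma op_tm_sort [simp]: "dm_tm (op_tm c) = cd_tm c" "cd_tm (op_tm c) = dm_tm c" "wf_tm (op_tm c) = wf_tm c"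
proof -
  show "dm_tm (op_tm c) = cd_tm c" for c by (induction c) simp_all
  moreover show "cd_tm (op_tm c) = dm_tm c" for c by (induction c) simp_all
  ultimately show "wf_tm (op_tm c) = wf_tm c" by (induction c) auto
qed

lemma op_tm_op_tm [simp]: "op_tm (op_tm c) = c"
  by (induction c) simp_all

lemma abs_arr_simps [simp]:
  "abs_arr (c \<Zsemi> d) = abs_arr c \<rhd> abs_arr d" "abs_arr (c \<uplus> d) = abs_arr c \<otimes> abs_arr d"
  "abs_arr Delta = cpy" "abs_arr Eps = dsc" "abs_arr Mu = mrg" "abs_arr Eta = unt" "abs_arr Sigma1 = swp"
  "abs_arr Id0 = idn 0" "abs_arr Id1 = idn 1" "abs_arr (id_tm n) = idn n" "abs_arr (sym_tm n m) = braid n m"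
  by (simp_all only: sq.abs_eq pr.abs_eq cpy.abs_eq dsc.abs_eq mrg.abs_eq unt.abs_eq swp.abs_eq
      abs_arr_sums) (simp_all only: idn.abs_eq braid.abs_eq)

lemma abs_arr_sorts [simp]: "dm (abs_arr c) = dm_tm c" "cd (abs_arr c) = cd_tm c" "ok (abs_arr c) = wf_tm c"
  by (simp_all add: dm.abs_eq cd.abs_eq ok.abs_eq)

lemma op_id_tm [simp]: "op_tm (id_tm n) = id_tm n"
  by (induction n) simp_all

text \<open>The reversal of a symmetry term is not literally a symmetry term; it equals one in the
  quotient, by the hexagon.\<close>

lemma abs_op_sym1: "abs_arr (op_tm (sym1_tm n)) = braid 1 n"
proof (induction n)
  case (Suc n)
  then show ?case using hexagon[of 1 n 1, folded Suc_eq_plus1] by (simp add: braid_1_1)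
qed simp

lemma abs_op_sym [simp]: "abs_arr (op_tm (sym_tm n m)) = braid m n"
proof (induction m)
  case (Suc m)
  then show ?case using hexagon'[of m 1 n, folded Suc_eq_plus1] by (simp add: abs_op_sym1)
qed simp

text \<open>The laws are closed under reversal: monoid and comonoid laws are exchanged, and so are
  the two Frobenius equations. Hence \<open>dual\<close> is well defined, and comonoid facts come
  for free from monoid facts.\<close>

lemma op_tm_eq: "cb_eq n m c d \<Longrightarrow> abs_arr (op_tm c) = abs_arr (op_tm d)"
proof (induction rule: cb_eq.induct)
  case (cb_sym_natural c n m d p q)
  then have "braid q m \<rhd> (abs_arr (op_tm c) \<otimes> abs_arr (op_tm d)) = (abs_arr (op_tm d) \<otimes> abs_arr (op_tm c)) \<rhd> braid p n"
    by (subst braid_natural) (simp_all add: has_sort_iff)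
  then show ?case by simp
next
  case (cb_hexagon n m k)
  show ?case by (simp add: hexagon')
next
  case cb_delta_assoc show ?case by (simp add: mrg_assoc)
next
  case cb_delta_unit show ?case by (simp add: mrg_unit)
next
  case cb_delta_comm show ?case by (simp add: mrg_comm)
next
  case cb_mu_assoc show ?case by (simp add: cpy_assoc)
next
  case cb_mu_unit show ?case by (simp add: cpy_unit)
next
  case cb_mu_comm show ?case by (simp add: cpy_comm)
next
  case cb_frobenius_left show ?case by (simp add: frobenius_r)
next
  case cb_frobenius_right show ?case by (simp add: frobenius_l)
next
  case cb_special show ?case by (simp add: cpy_mrg)
next
  case cb_sym_generator
  show ?case unfolding abs_op_sym by (simp add: braid_1_1)
qed (simp_all add: has_sort_iff interchange)

lift_definition dual :: "arr \<Rightarrow> arr" is op_tm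
proof -
  fix c d assume cd: "cbx c d"
  show "cbx (op_tm c) (op_tm d)"
  proof (cases "wf_tm c")
    case True
    then have "abs_arr (op_tm c) = abs_arr (op_tm d)" using cd op_tm_eq by (auto simp: cbx_def)
    then show ?thesis by (simp add: arr.abs_eq_iff)
  qed (use cd in \<open>simp add: cbx_def\<close>)
qed

lemma dual_simps [simp]:
  "dual (f \<rhd> g) = dual g \<rhd> dual f" "dual (f \<otimes> g) = dual f \<otimes> dual g" "dual (dual f) = f"
  "dual cpy = mrg" "dual dsc = unt" "dual mrg = cpy" "dual unt = dsc" "dual swp = swp"
  "dual (idn n) = idn n"
  by (transfer; simp add: cbx_refl)+

lemma dual_braid [simp]: "dual (braid n m) = braid m n"
  using dual.abs_eq[of "sym_tm n m"] by simp

lemma dual_sorts [simp]: "dm (dual f) = cd f" "cd (dual f) = dm f" "ok (dual f) = ok f"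
  by (transfer; simp)+

section \<open>Reversal of cospans\<close>

definition cflip :: "cospan \<Rightarrow> cospan" where
  "cflip c = \<lparr>src = tgt c, tgt = src c, apex = apex c, lleg = rleg c, rleg = lleg c\<rparr>"

definition flip :: "cospan set \<Rightarrow> cospan set" where
  "flip a = cflip ` a"

lemma cflip_cmk: "cflip (cmk n m A l r) = cmk m n A r l"
  by (simp add: cflip_def cmk_def)

lemma flip_mk:
  assumes "maps l n A" "maps r m A"
  shows "flip (mk n m A l r) = mk m n A r l"
proof -
  have *: "cflip c \<in> mk m n A r l" if h: "c \<in> mk n m A l r" "maps l n A" "maps r m A" for n m A l r c
  proof -
    obtain B l' r' h where "c = cmk n m B l' r'" "maps l' n B" "maps r' m B" "ciso n m A l r B l' r' h"
      using h(1) unfolding mem_mk[OF h(2,3)] by blast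
    then show ?thesis unfolding mem_mk[OF h(3,2)] by (auto simp: cflip_cmk ciso_def)
  qed
  have "cflip (cflip c) = c" for c by (simp add: cflip_def)
  then show ?thesis
    unfolding flip_def using *[OF _ assms] *[OF _ assms(2,1)] by (auto simp: image_iff) metis
qed

lemma flip_fnc: "maps f n m \<Longrightarrow> flip (fnc n m f) = opc n m f"
  by (simp add: fnc_def opc_def flip_mk)

lemma flip_opc: "maps f n m \<Longrightarrow> flip (opc n m f) = fnc n m f"
  by (simp add: fnc_def opc_def flip_mk)

lemma flip_seq:
  assumes "f \<in> hom Cospan n k" "g \<in> hom Cospan k m"
  shows "flip (f \<star> g) = flip g \<star> flip f"
proof -
  obtain A l r where f: "maps l n A" "maps r k A" "f = mk n k A l r" using assms(1) hom_Cospan by auto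
  obtain B l' r' where g: "maps l' k B" "maps r' m B" "g = mk k m B l' r'" using assms(2) hom_Cospan by auto
  obtain P i j where p: "po k A B r l' P i j" by (rule po_exists[OF f(2) g(1)])
  have m: "maps (\<lambda>x. i (l x)) n P" "maps (\<lambda>x. j (r' x)) m P" using p f g by (auto simp: po_def maps_def)
  show ?thesis
    unfolding f(3) g(3) flip_mk[OF f(1,2)] flip_mk[OF g(1,2)] seq_mk[OF p f(1) g(2)]
      seq_mk[OF po_flip[OF p] g(2) f(1)] flip_mk[OF m] ..
qed

lemma flip_tensor:
  assumes "f \<in> hom Cospan n k" "g \<in> hom Cospan n' k'"
  shows "flip (f \<boxtimes> g) = flip f \<boxtimes> flip g"
proof -
  obtain A l r where f: "maps l n A" "maps r k A" "f = mk n k A l r" using assms(1) hom_Cospan by auto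
  obtain B l' r' where g: "maps l' n' B" "maps r' k' B" "g = mk n' k' B l' r'" using assms(2) hom_Cospan by auto
  show ?thesis
    unfolding f(3) g(3) flip_mk[OF f(1,2)] flip_mk[OF g(1,2)] tensor_mk[OF f(1,2) g(1,2)]
      tensor_mk[OF f(2,1) g(2,1)] flip_mk[OF maps_cp_sum[OF f(1) g(1)] maps_cp_sum[OF f(2) g(2)]] ..
qed

lemma sem_op_tm: "has_sort c n m \<Longrightarrow> sem_tm (op_tm c) = flip (sem_tm c)"
proof (induction rule: has_sort.induct)
  case 7
  show ?case using braid_opc[of 1 1] flip_fnc[OF maps_braid, of 1 1] by simp
next
  case (8 c n k d m)
  then show ?case using flip_seq[OF sem_tm_hom sem_tm_hom] by simp
next
  case (9 c n m d p q)
  then show ?case using flip_tensor[OF sem_tm_hom sem_tm_hom] by simp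
qed (use maps_fold[of 1] in \<open>simp_all add: flip_fnc flip_opc one_add_one flip: fnc_id_opc\<close>)

lemma sem_dual [simp]: "ok f \<Longrightarrow> sem (dual f) = flip (sem f)"
  by transfer (simp add: sem_op_tm has_sort_iff)

section \<open>Uniqueness of monoid arrows\<close>

lemma sem_jn: "sem (jn b) = fnc (b + 2) (b + 1) (\<lambda>i. if i < b + 1 then i else 0)"
proof -
  let ?s = "cp b (\<lambda>i. 1 + i) (\<lambda>i. i)"
  let ?d = "cp 1 (\<lambda>i. i) (\<lambda>i. i)"
  have "sem (jn b) = (fnc 1 1 (\<lambda>i. i) \<boxtimes> fnc (b + 1) (1 + b) ?s) \<star> (fnc (1 + 1) 1 ?d \<boxtimes> fnc b b (\<lambda>i. i))"
    by (simp add: jn_def one_add_one)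
  also have "\<dots> = fnc (1 + (b + 1)) (1 + (1 + b)) (cp 1 (\<lambda>i. i) (\<lambda>i. 1 + ?s i)) \<star> fnc (1 + 1 + b) (1 + b) (cp (1 + 1) ?d (\<lambda>i. 1 + i))"
    by (simp only: id_tensor_fnc[OF maps_braid] fnc_tensor_id[OF maps_fold])
  also have "\<dots> = fnc (1 + (b + 1)) (1 + b) (\<lambda>x. cp (1 + 1) ?d (\<lambda>i. 1 + i) (cp 1 (\<lambda>i. i) (\<lambda>i. 1 + ?s i) x))"
    using fnc_seq[OF maps_id_cp[OF maps_braid[of b 1], of 1] maps_cp_id[OF maps_fold[of 1], of b, unfolded add.assoc]]
    by (simp only: add.assoc)
  also have "\<dots> = fnc (1 + (b + 1)) (1 + b) (\<lambda>i. if i < b + 1 then i else 0)"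
    by (rule fnc_cong) (auto simp: cp_def)
  finally show ?thesis by (simp add: One_nat_def)
qed

lemma sem_ins: "x < A \<Longrightarrow> sem (ins A x) = fnc (A + 1) A (\<lambda>i. if i < A then i else x)"
proof -
  assume x: "x < A"
  define b where "b = A - Suc x"
  have A: "A = x + (b + 1)" using x by (simp add: b_def)
  have m: "maps (\<lambda>i. if i < b + 1 then i else 0) (b + 2) (b + 1)" by (auto simp: maps_def)
  have "sem (ins A x) = fnc x x (\<lambda>i. i) \<boxtimes> fnc (b + 2) (b + 1) (\<lambda>i. if i < b + 1 then i else 0)"
    by (simp add: ins_def sem_jn b_def)
  also have "\<dots> = fnc (x + (b + 2)) A (cp x (\<lambda>i. i) (\<lambda>i. x + (if i < b + 1 then i else 0)))"
    unfolding A by (rule id_tensor_fnc[OF m])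
  also have "\<dots> = fnc (x + (b + 2)) A (\<lambda>i. if i < A then i else x)"
    by (rule fnc_cong) (auto simp: cp_def A)
  also have "x + (b + 2) = A + 1" by (simp add: A)
  finally show ?thesis .
qed

lemma maps_ins: "x < A \<Longrightarrow> maps (\<lambda>i. if i < A then i else x) (A + 1) A"
  by (auto simp: maps_def)

lemma sem_unts: "sem (unts n) = fnc 0 n (\<lambda>i. i)"
proof (induction n)
  case (Suc n)
  have "sem (unts (Suc n)) = fnc (0 + 0) (n + 1) (cp 0 (\<lambda>i. i) (\<lambda>i. n + i))"
    using Suc fnc_tensor[OF maps_0 maps_0, of n "\<lambda>i. i" 1 "\<lambda>i. i"] by simp
  also have "\<dots> = fnc 0 (n + 1) (\<lambda>i. i)" unfolding add_0 by (rule fnc_cong) simp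
  finally show ?case by (simp add: One_nat_def)
qed simp

lemma sem_can: "maps \<phi> n A \<Longrightarrow> sem (can n A \<phi>) = fnc n A \<phi>"
proof (induction n)
  case 0
  show ?case unfolding can.simps sem_unts by (rule fnc_cong) simp
next
  case (Suc n)
  then have m: "maps \<phi> n A" "\<phi> n < A" by (auto simp: maps_def)
  have "sem (can (Suc n) A \<phi>) = (fnc n A \<phi> \<boxtimes> fnc 1 1 (\<lambda>i. i)) \<star> fnc (A + 1) A (\<lambda>i. if i < A then i else \<phi> n)"
    using m Suc.IH by (simp add: sem_ins)
  also have "\<dots> = fnc (n + 1) (A + 1) (cp n \<phi> (\<lambda>i. A + i)) \<star> fnc (A + 1) A (\<lambda>i. if i < A then i else \<phi> n)"
    by (simp only: fnc_tensor_id[OF m(1)])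
  also have "\<dots> = fnc (n + 1) A (\<lambda>x. if cp n \<phi> (\<lambda>i. A + i) x < A then cp n \<phi> (\<lambda>i. A + i) x else \<phi> n)"
    by (rule fnc_seq[OF maps_cp_id[OF m(1)] maps_ins[OF m(2)]])
  also have "\<dots> = fnc (n + 1) A \<phi>"
    using m by (intro fnc_cong) (auto simp: cp_def maps_def less_Suc_eq One_nat_def)
  finally show ?case by (simp add: One_nat_def)
qed

text \<open>Both right legs are identities, so an isomorphism between the two cospans fixes every
  point of the apex and the left legs must agree.\<close>

lemma fnc_inj: "fnc n m f = fnc n m g \<Longrightarrow> maps f n m \<Longrightarrow> maps g n m \<Longrightarrow> i < n \<Longrightarrow> f i = g i"
  unfolding fnc_def by (drule mk_eqD) (auto simp: ciso_def maps_def)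

lemma Mon_sem:
  assumes "f \<in> Mon"
  obtains \<phi> where "maps \<phi> (dm f) (cd f)" "f = can (dm f) (cd f) \<phi>" "sem f = fnc (dm f) (cd f) \<phi>"
  using Mon_can[OF assms] sem_can by metis

text \<open>Each arrow is canonical for some unknown function; the interpretation shows that the two
  functions agree below the bound, and \<open>can\<close> depends on nothing else.\<close>

lemma Mon_unique:
  assumes "f \<in> Mon" "g \<in> Mon" "dm f = dm g" "cd f = cd g" "sem f = sem g"
  shows "f = g"
proof -
  obtain \<phi> where \<phi>: "maps \<phi> (dm f) (cd f)" "f = can (dm f) (cd f) \<phi>" "sem f = fnc (dm f) (cd f) \<phi>"
    using Mon_sem[OF assms(1)] .
  obtain \<psi> where \<psi>: "maps \<psi> (dm g) (cd g)" "g = can (dm g) (cd g) \<psi>" "sem g = fnc (dm g) (cd g) \<psi>"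
    using Mon_sem[OF assms(2)] .
  have "can (dm f) (cd f) \<phi> = can (dm f) (cd f) \<psi>"
    using fnc_inj[of "dm f" "cd f" \<phi> \<psi>] \<phi> \<psi> assms by (intro can_cong) metis
  then show ?thesis using \<phi>(2) \<psi>(2) assms by metis
qed

text \<open>Turns an equation between monoid arrows into a pointwise equation between functions,
  replacing diagrammatic rewriting in what follows.\<close>

lemma Mon_unique_fnc:
  assumes "f \<in> Mon" "g \<in> Mon" "sem f = fnc n m \<phi>" "sem g = fnc n m \<psi>" "dm f = n" "cd f = m" "dm g = n" "cd g = m"
    and "\<And>i. i < n \<Longrightarrow> \<phi> i = \<psi> i"
  shows "f = g"
  using assms fnc_cong[of n \<phi> \<psi> m] by (intro Mon_unique) auto

section \<open>Permutations\<close>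

text \<open>Kept apart from \<open>Mon\<close> because for these arrows reversal is
  inversion.\<close>

inductive_set Prm :: "arr set" where
  Prm_id: "idn n \<in> Prm"
| Prm_swp: "swp \<in> Prm"
| Prm_sq: "f \<in> Prm \<Longrightarrow> g \<in> Prm \<Longrightarrow> cd f = dm g \<Longrightarrow> f \<rhd> g \<in> Prm"
| Prm_pr: "f \<in> Prm \<Longrightarrow> g \<in> Prm \<Longrightarrow> f \<otimes> g \<in> Prm"

lemma Prm_Mon: "f \<in> Prm \<Longrightarrow> f \<in> Mon"
  by (induction rule: Prm.induct) (auto intro: Mon.intros)

lemma Prm_inverse: "f \<in> Prm \<Longrightarrow> f \<rhd> dual f = idn (dm f)"
proof (induction rule: Prm.induct)
  case (Prm_sq f g)
  have "(f \<rhd> g) \<rhd> dual (f \<rhd> g) = f \<rhd> (g \<rhd> dual g) \<rhd> dual f" by simp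
  also have "\<dots> = f \<rhd> dual f" using Prm_sq by simp
  finally show ?case using Prm_sq by simp
qed (simp_all add: interchange)

lemma Prm_cd: "f \<in> Prm \<Longrightarrow> cd f = dm f"
  by (induction rule: Prm.induct) auto

lemma Prm_braid1: "braid n 1 \<in> Prm"
proof (induction n)
  case (Suc n)
  have "braid (n + 1) 1 = (idn n \<otimes> swp) \<rhd> (braid n 1 \<otimes> idn 1)" by (simp add: hexagon' braid_1_1)
  moreover have "(idn n \<otimes> swp) \<rhd> (braid n 1 \<otimes> idn 1) \<in> Prm"
    using Suc by (intro Prm.intros) auto
  ultimately show ?case by (simp add: Suc_eq_plus1)
qed (auto intro: Prm.intros)

lemma Prm_braid: "braid n m \<in> Prm"
proof (induction m)
  case (Suc m)
  have "(braid n m \<otimes> idn 1) \<rhd> (idn m \<otimes> braid n 1) \<in> Prm"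
    using Suc Prm_braid1 by (intro Prm.intros) auto
  then show ?case by (simp add: Suc_eq_plus1 hexagon)
qed (auto intro: Prm.intros)

definition permutable :: "nat \<Rightarrow> (nat \<Rightarrow> nat) \<Rightarrow> bool" where
  "permutable A \<pi> \<longleftrightarrow> maps \<pi> A A \<and> (\<exists>P\<in>Prm. dm P = A \<and> sem P = fnc A A \<pi>)"

lemma permutable_comp: "permutable A p \<Longrightarrow> permutable A q \<Longrightarrow> permutable A (\<lambda>x. q (p x))"
proof -
  assume p: "permutable A p" and q: "permutable A q"
  obtain P where P: "P \<in> Prm" "dm P = A" "sem P = fnc A A p" using p by (auto simp: permutable_def)
  obtain Q where Q: "Q \<in> Prm" "dm Q = A" "sem Q = fnc A A q" using q by (auto simp: permutable_def)
  have m: "maps p A A" "maps q A A" using p q by (auto simp: permutable_def)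
  have c: "cd P = A" using P Prm_cd by simp
  have "sem (P \<rhd> Q) = fnc A A (\<lambda>x. q (p x))"
    using P Q c fnc_seq[OF m] Mon_ok[OF Prm_Mon] by simp
  moreover have "P \<rhd> Q \<in> Prm" using P Q c by (intro Prm_sq) auto
  ultimately show ?thesis unfolding permutable_def using m P(2) by (auto simp: maps_def intro!: bexI[of _ "P \<rhd> Q"])
qed

lemma permutable_cong: "permutable A p \<Longrightarrow> (\<And>i. i < A \<Longrightarrow> p i = q i) \<Longrightarrow> permutable A q"
  using fnc_cong[of A p q A] by (auto simp: permutable_def maps_def)

lemma permutable_id: "permutable A (\<lambda>i. i)"
  unfolding permutable_def by (auto intro!: bexI[of _ "idn A"] Prm.intros)

lemma permutable_adjacent: "Suc i < A \<Longrightarrow> permutable A (Transposition.transpose i (Suc i))"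
proof -
  assume i: "Suc i < A"
  define q where "q = A - i - 2"
  have A: "A = i + ((1 + 1) + q)" using i by (simp add: q_def)
  let ?s = "cp 1 (\<lambda>i. 1 + i) (\<lambda>i. i)"
  let ?P = "idn i \<otimes> swp \<otimes> idn q"
  have "sem ?P = fnc i i (\<lambda>i. i) \<boxtimes> (fnc (1 + 1) (1 + 1) ?s \<boxtimes> fnc q q (\<lambda>i. i))"
    by simp
  also have "\<dots> = fnc A A (cp i (\<lambda>i. i) (\<lambda>x. i + cp (1 + 1) ?s (\<lambda>i. (1 + 1) + i) x))"
    unfolding fnc_tensor_id[OF maps_braid] A by (rule id_tensor_fnc[OF maps_cp_id[OF maps_braid]])
  also have "\<dots> = fnc A A (Transposition.transpose i (Suc i))"
    by (rule fnc_cong) (auto simp: cp_def Transposition.transpose_def A)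
  finally have "sem ?P = fnc A A (Transposition.transpose i (Suc i))" .
  moreover have "?P \<in> Prm" by (intro Prm.intros)
  moreover have "dm ?P = A" by (simp add: A)
  moreover have "maps (Transposition.transpose i (Suc i)) A A" using i by (auto simp: maps_def Transposition.transpose_def)
  ultimately show ?thesis unfolding permutable_def by blast
qed

lemma permutable_transpose: "i + d < A \<Longrightarrow> permutable A (Transposition.transpose i (i + d))"
proof (induction d)
  case 0
  show ?case by (rule permutable_cong[OF permutable_id]) simp
next
  case (Suc d)
  show ?case
  proof (cases "d = 0")
    case True
    then show ?thesis using permutable_adjacent[of i A] Suc.prems by simp
  next
    case False
    let ?t = "Transposition.transpose (i + d) (Suc (i + d))"
    have t: "permutable A ?t" "permutable A (Transposition.transpose i (i + d))"
      using Suc permutable_adjacent[of "i + d" A] by auto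
    \<comment> \<open>Conjugating the transposition of \<open>i\<close> and \<open>i + d\<close>
      with that of \<open>i + d\<close> and its successor gives the transposition of
      \<open>i\<close> and \<open>i + Suc d\<close>; the points must be distinct, hence the separate
      case \<open>d = 0\<close>.\<close>
    have "permutable A (\<lambda>x. ?t (Transposition.transpose i (i + d) (?t x)))"
      by (rule permutable_comp[OF permutable_comp[OF t] t(1)])
    then show ?thesis
      by (rule permutable_cong) (use False in \<open>auto simp: Transposition.transpose_def\<close>)
  qed
qed

lemma permutable_transpose': "a < A \<Longrightarrow> b < A \<Longrightarrow> permutable A (Transposition.transpose a b)"
proof -
  have "permutable A (Transposition.transpose a b)" if "a \<le> b" "b < A" for a b
    using permutable_transpose[of a "b - a" A] that by simp
  then show "a < A \<Longrightarrow> b < A \<Longrightarrow> ?thesis"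
    using transpose_commute[of a b] by (cases "a \<le> b") (metis, metis nat_le_linear)
qed

lemma permutable_bij:
  assumes "bij_betw h {..<A} {..<A}"
  shows "permutable A h"
proof -
  \<comment> \<open>Extending by the identity beyond \<open>A\<close> produces a permutation of the
    whole type, so that induction over transpositions applies.\<close>
  define p where "p i = (if i < A then h i else i)" for i
  have "bij_betw p {..<A} {..<A}" using assms bij_betw_cong[of "{..<A}" p h] by (simp add: p_def)
  then have "p permutes {..<A}" by (rule bij_imp_permutes) (simp add: p_def)
  from this finite_lessThan have "permutable A p"
  proof (induction rule: permutes_induct)
    case id
    then show ?case using permutable_id[of A] by (simp add: id_def)
  next
    case (swap a b p)
    then show ?case using permutable_comp[of A p "Transposition.transpose a b"] permutable_transpose'[of a A b]
      by (simp add: comp_def)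
  qed
  then show ?thesis by (rule permutable_cong) (simp add: p_def)
qed

section \<open>Factorization\<close>

definition fac :: "arr \<Rightarrow> bool" where
  "fac f \<longleftrightarrow> (\<exists>M W. M \<in> Mon \<and> W \<in> Mon \<and> cd M = cd W \<and> f = M \<rhd> dual W)"

lemma fac_Mon: "f \<in> Mon \<Longrightarrow> fac f"
  unfolding fac_def by (intro exI[of _ f] exI[of _ "idn (cd f)"]) (auto intro: Mon.intros)

lemma Mon_fac:
  assumes "f \<in> Mon" "fac g" "cd f = dm g"
  shows "fac (f \<rhd> g)"
proof -
  obtain M W where "M \<in> Mon" "W \<in> Mon" "cd M = cd W" "g = M \<rhd> dual W" using assms by (auto simp: fac_def)
  then show ?thesis
    unfolding fac_def using assms by (intro exI[of _ "f \<rhd> M"] exI[of _ W]) (auto intro: Mon_sq)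
qed

lemma fac_dual: "fac f \<Longrightarrow> fac (dual f)"
  unfolding fac_def by (metis dual_simps(1,3))

lemma fac_Com:
  assumes "fac f" "dual g \<in> Mon" "cd f = dm g"
  shows "fac (f \<rhd> g)"
  using fac_dual[OF Mon_fac[OF assms(2) fac_dual[OF assms(1)]]] assms(3) by simp

lemma fac_whisker:
  assumes "fac f" shows "fac (idn a \<otimes> f)"
proof -
  obtain M W where "M \<in> Mon" "W \<in> Mon" "cd M = cd W" "f = M \<rhd> dual W" using assms by (auto simp: fac_def)
  then show ?thesis
    unfolding fac_def
    by (intro exI[of _ "idn a \<otimes> M"] exI[of _ "idn a \<otimes> W"]) (auto simp: interchange intro: Mon.intros)
qed

lemma braid_Mon: "braid n m \<in> Mon"
  using Prm_braid Prm_Mon by blast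

lemma ins_Mon: "ins A x \<in> Mon"
  unfolding ins_def jn_def by (intro Mon.intros braid_Mon) simp

lemma unts_Mon: "unts n \<in> Mon"
  by (induction n) (auto intro: Mon.intros)

lemma can_Mon: "maps \<phi> n A \<Longrightarrow> can n A \<phi> \<in> Mon"
proof (induction n)
  case (Suc n)
  then have "can n A \<phi> \<in> Mon" "maps \<phi> n A" "\<phi> n < A" by (auto simp: maps_def)
  then show ?case by (auto intro!: Mon.intros ins_Mon)
qed (simp add: unts_Mon)

text \<open>The core instance of moving a copy behind merges: the third of three wires is copied
  into the two others, so all three become connected and a single copy behind the merges suffices.
  Commutativity inserts a crossing before the last merge, the copy is pulled through it by
  naturality, and then each Frobenius equation is used once.\<close>

lemma cpy_mrg_mrg:
  "(idn 2 \<otimes> cpy) \<rhd> (jn 1 \<otimes> idn 1) \<rhd> (idn 1 \<otimes> mrg) = (idn 1 \<otimes> swp) \<rhd> (mrg \<otimes> idn 1) \<rhd> mrg \<rhd> cpy"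
proof -
  have "idn 1 \<otimes> mrg = (idn 1 \<otimes> swp) \<rhd> (idn 1 \<otimes> mrg)"
    by (simp add: interchange mrg_comm)
  then have "(idn 2 \<otimes> cpy) \<rhd> (jn 1 \<otimes> idn 1) \<rhd> (idn 1 \<otimes> mrg) =
      (idn 2 \<otimes> cpy) \<rhd> (jn 1 \<otimes> idn 1) \<rhd> (idn 1 \<otimes> swp) \<rhd> (idn 1 \<otimes> mrg)" by simp
  also have "\<dots> = (idn 2 \<otimes> cpy) \<rhd> (idn 1 \<otimes> swp \<otimes> idn 1) \<rhd> ((mrg \<otimes> idn 2) \<rhd> (idn 1 \<otimes> swp)) \<rhd> (idn 1 \<otimes> mrg)"
    by (simp add: jn_1 sq_pr_id)
  also have "(mrg \<otimes> idn 2) \<rhd> (idn 1 \<otimes> swp) = (idn 2 \<otimes> swp) \<rhd> (mrg \<otimes> idn 2)"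
    by (simp add: slide)
  also have "(idn 2 \<otimes> cpy) \<rhd> (idn 1 \<otimes> swp \<otimes> idn 1) \<rhd> ((idn 2 \<otimes> swp) \<rhd> (mrg \<otimes> idn 2)) \<rhd> (idn 1 \<otimes> mrg) =
     (idn 1 \<otimes> ((idn 1 \<otimes> cpy) \<rhd> (swp \<otimes> idn 1) \<rhd> (idn 1 \<otimes> swp))) \<rhd> (mrg \<otimes> idn 2) \<rhd> (idn 1 \<otimes> mrg)"
    by (simp add: id_pr_sq)
  also have "(idn 1 \<otimes> cpy) \<rhd> (swp \<otimes> idn 1) \<rhd> (idn 1 \<otimes> swp) = swp \<rhd> (cpy \<otimes> idn 1)"
    using braid_natural[of "idn 1" 1 cpy 2] by (simp add: braid_1_2 braid_1_1)
  also have "(idn 1 \<otimes> (swp \<rhd> (cpy \<otimes> idn 1))) \<rhd> (mrg \<otimes> idn 2) \<rhd> (idn 1 \<otimes> mrg) =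
     (idn 1 \<otimes> swp) \<rhd> (((idn 1 \<otimes> cpy) \<otimes> idn 1) \<rhd> ((mrg \<otimes> idn 1) \<otimes> idn 1)) \<rhd> (idn 1 \<otimes> mrg)"
    by (simp add: id_pr_sq)
  also have "((idn 1 \<otimes> cpy) \<otimes> idn 1) \<rhd> ((mrg \<otimes> idn 1) \<otimes> idn 1) = (mrg \<rhd> cpy) \<otimes> idn 1"
    by (subst sq_pr_id[symmetric]) (simp_all add: frobenius_r)
  also have "(idn 1 \<otimes> swp) \<rhd> ((mrg \<rhd> cpy) \<otimes> idn 1) \<rhd> (idn 1 \<otimes> mrg) =
      (idn 1 \<otimes> swp) \<rhd> (mrg \<otimes> idn 1) \<rhd> ((cpy \<otimes> idn 1) \<rhd> (idn 1 \<otimes> mrg))"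
    by (simp add: sq_pr_id)
  also have "\<dots> = (idn 1 \<otimes> swp) \<rhd> (mrg \<otimes> idn 1) \<rhd> mrg \<rhd> cpy"
    by (simp add: frobenius_l)
  finally show ?thesis .
qed

text \<open>\<open>spread A x y\<close> copies the last of \<open>A + 1\<close> wires and merges the copies into wires \<open>x\<close> and \<open>y\<close>.
  It is what remains when the dual of \<open>id + Mu\<close> meets a canonical term.\<close>

definition spread :: "nat \<Rightarrow> nat \<Rightarrow> nat \<Rightarrow> arr" where
  "spread A x y = (idn A \<otimes> cpy) \<rhd> (ins A x \<otimes> idn 1) \<rhd> ins A y"

text \<open>When both copies go to one wire, they may be merged with each other first, an equation
  between monoid arrows; speciality then removes the copy altogether.\<close>

lemma fac_spread_same:
  assumes "x < A" shows "fac (spread A x x)"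
proof -
  have "(ins A x \<otimes> idn 1) \<rhd> ins A x = (idn A \<otimes> mrg) \<rhd> ins A x"
  proof (rule Mon_unique_fnc)
    let ?i = "\<lambda>i. if i < A then i else x"
    have m: "maps ?i (A + 1) A" using maps_ins[OF assms] .
    have "sem ((ins A x \<otimes> idn 1) \<rhd> ins A x) = fnc (A + 1 + 1) (A + 1) (cp (A + 1) ?i (\<lambda>i. A + i)) \<star> fnc (A + 1) A ?i"
      using assms by (simp only: sem_simps arr_sorts ins_sorts sem_ins fnc_tensor_id[OF m])
    also have "\<dots> = fnc (A + 1 + 1) A (\<lambda>i. ?i (cp (A + 1) ?i (\<lambda>i. A + i) i))"
      by (rule fnc_seq[OF maps_cp_id[OF m] m])
    finally show "sem ((ins A x \<otimes> idn 1) \<rhd> ins A x) = fnc (A + 1 + 1) A (\<lambda>i. ?i (cp (A + 1) ?i (\<lambda>i. A + i) i))" .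
    let ?d = "cp 1 (\<lambda>i. i) (\<lambda>i. i)"
    have "sem ((idn A \<otimes> mrg) \<rhd> ins A x) = (fnc A A (\<lambda>i. i) \<boxtimes> fnc (1 + 1) 1 ?d) \<star> fnc (A + 1) A ?i"
      using assms by (simp add: sem_ins)
    also have "\<dots> = fnc (A + (1 + 1)) A (\<lambda>i. ?i (cp A (\<lambda>i. i) (\<lambda>i. A + ?d i) i))"
      unfolding id_tensor_fnc[OF maps_fold] by (rule fnc_seq[OF maps_id_cp[OF maps_fold] m])
    finally show "sem ((idn A \<otimes> mrg) \<rhd> ins A x) = fnc (A + 1 + 1) A (\<lambda>i. ?i (cp A (\<lambda>i. i) (\<lambda>i. A + ?d i) i))"
      by (simp only: add.assoc)
    show "?i (cp (A + 1) ?i (\<lambda>i. A + i) i) = ?i (cp A (\<lambda>i. i) (\<lambda>i. A + ?d i) i)" if "i < A + 1 + 1" for i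
      using that assms by (auto simp: cp_def)
  qed (use assms in \<open>auto intro!: Mon.intros ins_Mon\<close>)
  then have "spread A x x = ((idn A \<otimes> cpy) \<rhd> (idn A \<otimes> mrg)) \<rhd> ins A x"
    by (simp add: spread_def)
  also have "(idn A \<otimes> cpy) \<rhd> (idn A \<otimes> mrg) = idn (A + 1)"
    by (simp add: interchange cpy_mrg)
  finally show ?thesis using assms by (simp add: fac_Mon ins_Mon)
qed

text \<open>With the last two wires as targets, only the last three inputs interact and the other
  \<open>k\<close> wires are mere context for \<open>cpy_mrg_mrg\<close>.\<close>

lemma fac_spread_last: "fac (spread (k + 2) k (k + 1))"
proof -
  let ?M = "(idn 1 \<otimes> swp) \<rhd> (mrg \<otimes> idn 1) \<rhd> mrg"
  have 2: "k + 2 - Suc k = 1" "k + 2 - Suc (k + 1) = 0" by auto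
  have "spread (k + 2) k (k + 1) = (idn k \<otimes> (idn 2 \<otimes> cpy)) \<rhd> (idn k \<otimes> (jn 1 \<otimes> idn 1)) \<rhd> (idn k \<otimes> (idn 1 \<otimes> mrg))"
    by (simp add: spread_def ins_def 2 One_nat_def)
  also have "\<dots> = idn k \<otimes> ((idn 2 \<otimes> cpy) \<rhd> (jn 1 \<otimes> idn 1) \<rhd> (idn 1 \<otimes> mrg))"
    by (simp add: interchange del: id_pr_id_pr)
  also have "\<dots> = idn k \<otimes> (?M \<rhd> dual mrg)"
    unfolding cpy_mrg_mrg by simp
  finally show ?thesis
    by (simp only:) (intro fac_whisker fac_Com fac_Mon Mon.intros, auto intro: Mon.intros)
qed

text \<open>Permuting the outputs first and merging afterwards only renames the target of the
  merge.\<close>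

lemma ins_Prm:
  assumes "P \<in> Prm" "dm P = A" "sem P = fnc A A \<pi>" "maps \<pi> A A" "x < A"
  shows "ins A x \<rhd> P = (P \<otimes> idn 1) \<rhd> ins A (\<pi> x)"
proof (rule Mon_unique_fnc)
  have P: "cd P = A" "ok P" "P \<in> Mon" using assms Prm_cd Prm_Mon Mon_ok by auto
  have px: "\<pi> x < A" using assms by (auto simp: maps_def)
  note m = maps_ins[OF assms(5)] maps_ins[OF px]
  show "sem (ins A x \<rhd> P) = fnc (A + 1) A (\<lambda>i. \<pi> (if i < A then i else x))"
    using assms P fnc_seq[OF m(1) assms(4)] by (simp add: sem_ins)
  have "sem ((P \<otimes> idn 1) \<rhd> ins A (\<pi> x)) = (fnc A A \<pi> \<boxtimes> fnc 1 1 (\<lambda>i. i)) \<star> fnc (A + 1) A (\<lambda>i. if i < A then i else \<pi> x)"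
    using assms P px by (simp add: sem_ins)
  also have "\<dots> = fnc (A + 1) A (\<lambda>i. if cp A \<pi> (\<lambda>i. A + i) i < A then cp A \<pi> (\<lambda>i. A + i) i else \<pi> x)"
    unfolding fnc_tensor_id[OF assms(4)] by (rule fnc_seq[OF maps_cp_id[OF assms(4)] m(2)])
  finally show "sem ((P \<otimes> idn 1) \<rhd> ins A (\<pi> x)) = fnc (A + 1) A (\<lambda>i. if cp A \<pi> (\<lambda>i. A + i) i < A then cp A \<pi> (\<lambda>i. A + i) i else \<pi> x)" .
  show "\<pi> (if i < A then i else x) = (if cp A \<pi> (\<lambda>i. A + i) i < A then cp A \<pi> (\<lambda>i. A + i) i else \<pi> x)" if "i < A + 1" for i
    using that assms by (auto simp: cp_def maps_def)
  show "ins A x \<rhd> P \<in> Mon" "(P \<otimes> idn 1) \<rhd> ins A (\<pi> x) \<in> Mon" "dm (ins A x \<rhd> P) = A + 1" "cd (ins A x \<rhd> P) = A"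
    "dm ((P \<otimes> idn 1) \<rhd> ins A (\<pi> x)) = A + 1" "cd ((P \<otimes> idn 1) \<rhd> ins A (\<pi> x)) = A"
    using assms P px by (auto intro!: Mon.intros ins_Mon)
qed

text \<open>Distinct targets are moved to the last two wires: insert \<open>P\<close> and its
  inverse \<open>dual P\<close> at the end, then pull \<open>P\<close> to the front through both
  merges and the copy.\<close>

lemma fac_spread:
  assumes "x < A" "y < A" shows "fac (spread A x y)"
proof (cases "x = y")
  case False
  define k where "k = A - 2"
  have A: "A = k + 2" using False assms by (simp add: k_def)
  \<comment> \<open>The first transposition sends \<open>y\<close> to \<open>k + 1\<close> and
    \<open>x\<close> to \<open>x'\<close>; the second sends \<open>x'\<close> to \<open>k\<close>.
    Since \<open>x'\<close> differs from \<open>k + 1\<close>, it leaves the image of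
    \<open>y\<close> in place.\<close>
  define x' where "x' = Transposition.transpose y (k + 1) x"
  define \<pi> where "\<pi> = (\<lambda>i. Transposition.transpose x' k (Transposition.transpose y (k + 1) i))"
  have x': "x' < A" "x' \<noteq> k + 1"
    using False assms A by (auto simp: x'_def Transposition.transpose_def)
  have "permutable A \<pi>"
    unfolding \<pi>_def by (rule permutable_comp) (use x' assms A in \<open>auto intro: permutable_transpose'\<close>)
  then obtain P where P: "P \<in> Prm" "dm P = A" "sem P = fnc A A \<pi>" and m: "maps \<pi> A A"
    by (auto simp: permutable_def)
  have \<pi>: "\<pi> x = k" "\<pi> y = k + 1"
    using x' by (auto simp: \<pi>_def x'_def Transposition.transpose_def)
  have cP: "cd P = A" "cd (dual P) = A" "P \<in> Mon" using P Prm_cd Prm_Mon by auto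
  have "spread A x y = (idn A \<otimes> cpy) \<rhd> (ins A x \<otimes> idn 1) \<rhd> (ins A y \<rhd> P) \<rhd> dual P"
    using P Prm_inverse[OF P(1)] assms by (simp add: spread_def)
  also have "ins A y \<rhd> P = (P \<otimes> idn 1) \<rhd> ins A (k + 1)"
    using ins_Prm[OF P m assms(2)] \<pi> by simp
  also have "(idn A \<otimes> cpy) \<rhd> (ins A x \<otimes> idn 1) \<rhd> ((P \<otimes> idn 1) \<rhd> ins A (k + 1)) \<rhd> dual P =
      (idn A \<otimes> cpy) \<rhd> ((ins A x \<rhd> P) \<otimes> idn 1) \<rhd> ins A (k + 1) \<rhd> dual P"
    using P assms by (simp add: interchange')
  also have "ins A x \<rhd> P = (P \<otimes> idn 1) \<rhd> ins A k"
    using ins_Prm[OF P m assms(1)] \<pi> by simp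
  also have "(idn A \<otimes> cpy) \<rhd> (((P \<otimes> idn 1) \<rhd> ins A k) \<otimes> idn 1) \<rhd> ins A (k + 1) \<rhd> dual P =
     ((idn A \<otimes> cpy) \<rhd> (P \<otimes> idn 2)) \<rhd> (ins A k \<otimes> idn 1) \<rhd> ins A (k + 1) \<rhd> dual P"
    using cP P A by (simp add: sq_pr_id)
  also have "(idn A \<otimes> cpy) \<rhd> (P \<otimes> idn 2) = (P \<otimes> idn 1) \<rhd> (idn A \<otimes> cpy)"
    using P cP by (simp add: interchange)
  finally have "spread A x y = (P \<otimes> idn 1) \<rhd> spread A k (k + 1) \<rhd> dual P"
    by (simp add: spread_def)
  moreover have "dm (spread A k (k + 1)) = A + 1" "cd (spread A k (k + 1)) = A" by (simp_all add: spread_def A)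
  ultimately show ?thesis
    using fac_spread_last[of k] cP P unfolding A[symmetric]
    by (simp only:) (intro Mon_fac fac_Com, auto intro: Mon.intros)
qed (use fac_spread_same assms in simp)

text \<open>The dual statement has a copy in front of the canonical form of \<open>W\<close>. The
  last two insertions of that form receive the two copies and make up \<open>spread\<close>, while
  the copy slides past the canonical term on the first \<open>p\<close> inputs.\<close>

lemma fac_mrg:
  assumes "W \<in> Mon" "dm W = p + 2"
  shows "fac (dual W \<rhd> (idn p \<otimes> mrg))"
proof -
  define A where "A = cd W"
  obtain \<phi> where \<phi>: "maps \<phi> (p + 2) A" "W = can (p + 2) A \<phi>"
    using Mon_can[OF assms(1)] assms(2) A_def by metis
  define x where "x = \<phi> p"
  define y where "y = \<phi> (p + 1)"
  have xy: "x < A" "y < A" "maps \<phi> p A" using \<phi>(1) by (auto simp: x_def y_def maps_def)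
  have "W = (((can p A \<phi> \<otimes> idn 1) \<rhd> ins A x) \<otimes> idn 1) \<rhd> ins A y"
    by (simp add: \<phi>(2) x_def y_def numeral_2_eq_2 One_nat_def)
  then have "(idn p \<otimes> cpy) \<rhd> W = ((idn p \<otimes> cpy) \<rhd> (can p A \<phi> \<otimes> idn 2)) \<rhd> (ins A x \<otimes> idn 1) \<rhd> ins A y"
    using xy by (simp add: sq_pr_id)
  also have "(idn p \<otimes> cpy) \<rhd> (can p A \<phi> \<otimes> idn 2) = (can p A \<phi> \<otimes> idn 1) \<rhd> (idn A \<otimes> cpy)"
    using xy by (simp add: interchange)
  finally have "(idn p \<otimes> cpy) \<rhd> W = (can p A \<phi> \<otimes> idn 1) \<rhd> spread A x y"
    by (simp add: spread_def)
  moreover have "fac ((can p A \<phi> \<otimes> idn 1) \<rhd> spread A x y)"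
    using xy by (intro Mon_fac fac_spread) (auto intro!: Mon.intros can_Mon simp: spread_def)
  ultimately have "fac ((idn p \<otimes> cpy) \<rhd> W)" by (simp only:)
  from fac_dual[OF this] show ?thesis by simp
qed

text \<open>A factored arrow absorbs a whole term generator by generator. \<open>Delta\<close>,
  \<open>Eps\<close> and \<open>Sigma1\<close> are reversed monoid arrows and simply join the right
  factor; the cases \<open>Mu\<close> and \<open>Eta\<close> carry the content.\<close>

lemma fac_layer:
  "wf_tm c \<Longrightarrow> fac f \<Longrightarrow> cd f = a + dm_tm c + b \<Longrightarrow> fac (f \<rhd> (idn a \<otimes> abs_arr c \<otimes> idn b))"
proof (induction c arbitrary: f a b)
  case Delta
  then show ?case by (intro fac_Com) (auto intro: Mon.intros)
next
  case Eps
  then show ?case by (intro fac_Com) (auto intro: Mon.intros)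
next
  case Mu
  obtain M W where MW: "M \<in> Mon" "W \<in> Mon" "cd M = cd W" "f = M \<rhd> dual W" using Mu by (auto simp: fac_def)
  \<comment> \<open>The \<open>b\<close> wires on the right are braided past \<open>Mu\<close>,
    which then acts on the last two wires. The braid in front is absorbed into
    \<open>dual W\<close>; the one behind is a reversed monoid arrow.\<close>
  let ?W = "(idn a \<otimes> braid b 2) \<rhd> W"
  have dW: "dm W = a + 2 + b" using Mu MW by simp
  have W: "?W \<in> Mon" "dm ?W = (a + b) + 2" using MW dW by (auto intro!: Mon.intros braid_Mon)
  have "mrg \<otimes> idn b = braid 2 b \<rhd> (idn b \<otimes> mrg) \<rhd> braid b 1"
  proof -
    have "(mrg \<otimes> idn b) \<rhd> braid 1 b = braid 2 b \<rhd> (idn b \<otimes> mrg)"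
      using braid_natural[of mrg 1 "idn b" b] by simp
    then have "((mrg \<otimes> idn b) \<rhd> braid 1 b) \<rhd> braid b 1 = (braid 2 b \<rhd> (idn b \<otimes> mrg)) \<rhd> braid b 1"
      by (rule arg_cong)
    then show ?thesis by simp
  qed
  then have "idn a \<otimes> mrg \<otimes> idn b = (idn a \<otimes> braid 2 b) \<rhd> (idn (a + b) \<otimes> mrg) \<rhd> (idn a \<otimes> braid b 1)"
    by (simp add: id_pr_sq)
  then have "f \<rhd> (idn a \<otimes> mrg \<otimes> idn b) = (M \<rhd> (dual ?W \<rhd> (idn (a + b) \<otimes> mrg))) \<rhd> (idn a \<otimes> braid b 1)"
    using MW by simp
  moreover have "fac (M \<rhd> (dual ?W \<rhd> (idn (a + b) \<otimes> mrg)))"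
    using MW by (intro Mon_fac fac_mrg[OF W]) auto
  ultimately show ?case
    by simp (intro fac_Com[of "M \<rhd> (dual ?W \<rhd> (idn (a + b) \<otimes> mrg))", simplified], auto intro!: Mon.intros braid_Mon)
next
  case Eta
  obtain M W where MW: "M \<in> Mon" "W \<in> Mon" "cd M = cd W" "f = M \<rhd> dual W" using Eta by (auto simp: fac_def)
  let ?A = "cd W"
  have dW: "dm W = a + b" using Eta MW by simp
  \<comment> \<open>Brought to the last position, the unit slides in front of \<open>dual W\<close>,
    having no inputs, and is absorbed into \<open>M\<close>.\<close>
  have u: "unt \<otimes> idn b = (idn b \<otimes> unt) \<rhd> braid b 1"
    using braid_natural[of "idn b" b unt 1] by simp
  have "f \<rhd> (idn a \<otimes> unt \<otimes> idn b) = M \<rhd> (dual W \<rhd> (idn (a + b) \<otimes> unt)) \<rhd> (idn a \<otimes> braid b 1)"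
    unfolding u MW(4) by (simp add: id_pr_sq)
  also have "dual W \<rhd> (idn (a + b) \<otimes> unt) = (idn ?A \<otimes> unt) \<rhd> (dual W \<otimes> idn 1)"
    using slide[of "dual W" ?A "a + b" unt 0 1] dW by simp
  also have "M \<rhd> ((idn ?A \<otimes> unt) \<rhd> (dual W \<otimes> idn 1)) \<rhd> (idn a \<otimes> braid b 1) =
      ((M \<rhd> (idn ?A \<otimes> unt)) \<rhd> (dual W \<otimes> idn 1)) \<rhd> (idn a \<otimes> braid b 1)" by simp
  finally show ?case
    using MW dW
    by (simp only: abs_arr_simps) (intro fac_Com fac_Mon, auto intro!: Mon.intros braid_Mon)
next
  case Id0
  then show ?case by simp
next
  case Id1
  then show ?case by simp
next
  case Sigma1
  then show ?case by (intro fac_Com) (auto intro: Mon.intros)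
next
  case (Seq c d)
  have "fac ((f \<rhd> (idn a \<otimes> abs_arr c \<otimes> idn b)) \<rhd> (idn a \<otimes> abs_arr d \<otimes> idn b))"
    by (intro Seq.IH) (use Seq.prems in auto)
  then show ?case using Seq.prems by (simp add: interchange)
next
  case (Sum c d)
  have "fac ((f \<rhd> (idn a \<otimes> abs_arr c \<otimes> idn (dm_tm d + b))) \<rhd> (idn (a + cd_tm c) \<otimes> abs_arr d \<otimes> idn b))"
    by (intro Sum.IH) (use Sum.prems in \<open>auto simp: add.assoc\<close>)
  moreover have "idn a \<otimes> (abs_arr c \<otimes> abs_arr d) \<otimes> idn b =
      (idn a \<otimes> abs_arr c \<otimes> idn (dm_tm d + b)) \<rhd> (idn (a + cd_tm c) \<otimes> abs_arr d \<otimes> idn b)"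
    by (simp add: interchange flip: id_pr id_pr_id_pr)
  ultimately show ?case by simp
qed

lemma ok_fac: "ok f \<Longrightarrow> fac f"
proof -
  assume f: "ok f"
  obtain c where c: "f = abs_arr c" using Quotient_abs_rep[OF Quotient_arr] by metis
  have "fac (idn (dm_tm c) \<rhd> (idn 0 \<otimes> abs_arr c \<otimes> idn 0))"
    using f c by (intro fac_layer fac_Mon) (auto intro: Mon.intros)
  then show ?thesis using c by simp
qed

section \<open>Completeness\<close>

lemma normal_form:
  assumes "ok f"
  obtains A l r where "maps l (dm f) A" "maps r (cd f) A" "f = can (dm f) A l \<rhd> dual (can (cd f) A r)"
    "sem f = mk (dm f) (cd f) A l r"
proof -
  obtain M W where MW: "M \<in> Mon" "W \<in> Mon" "cd M = cd W" "f = M \<rhd> dual W"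
    using ok_fac[OF assms] by (auto simp: fac_def)
  obtain l where l: "maps l (dm M) (cd M)" "M = can (dm M) (cd M) l" "sem M = fnc (dm M) (cd M) l"
    using Mon_sem[OF MW(1)] .
  obtain r where r: "maps r (dm W) (cd W)" "W = can (dm W) (cd W) r" "sem W = fnc (dm W) (cd W) r"
    using Mon_sem[OF MW(2)] .
  have s: "dm f = dm M" "cd f = dm W" using MW by auto
  have "sem f = mk (dm M) (dm W) (cd M) l r"
    using MW(1-3) l(1,3) r(1,3) Mon_ok by (simp add: MW(4) flip_fnc fnc_seq_opc)
  then show thesis using that[of l "cd M" r] l r MW s by metis
qed

lemma sem_inj:
  assumes "ok f" "ok g" "sem f = sem g"
  shows "f = g"
proof -
  obtain A l r where f: "maps l (dm f) A" "maps r (cd f) A" "f = can (dm f) A l \<rhd> dual (can (cd f) A r)"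
    "sem f = mk (dm f) (cd f) A l r" using normal_form[OF assms(1)] .
  obtain B l' r' where g: "maps l' (dm g) B" "maps r' (cd g) B" "g = can (dm g) B l' \<rhd> dual (can (cd g) B r')"
    "sem g = mk (dm g) (cd g) B l' r'" using normal_form[OF assms(2)] .
  obtain h where s: "dm f = dm g" "cd f = cd g" and h: "ciso (dm f) (cd f) A l r B l' r' h"
    using mk_eqD[of "dm f" "cd f" A l r "dm g" "cd g" B l' r'] assms(3) f g by auto
  have "card {..<A} = card {..<B}" using h bij_betw_same_card unfolding ciso_def by blast
  then have AB: "A = B" by simp
  then have "permutable A h" using h by (intro permutable_bij) (simp add: ciso_def)
  then obtain P where P: "P \<in> Prm" "dm P = A" "sem P = fnc A A h" "maps h A A" by (auto simp: permutable_def)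
  have cP: "cd P = A" "P \<in> Mon" "ok P" using P Prm_cd Prm_Mon Mon_ok by auto
  have *: "can n A k \<rhd> P = can n A k'" if "maps k n A" "maps k' n A" "\<And>i. i < n \<Longrightarrow> h (k i) = k' i" for n k k'
  proof (rule Mon_unique_fnc)
    show "sem (can n A k \<rhd> P) = fnc n A (\<lambda>i. h (k i))"
      using that P cP fnc_seq[OF that(1) P(4)] by (simp add: sem_can)
    show "sem (can n A k') = fnc n A k'" using that by (simp add: sem_can)
  qed (use that cP P in \<open>auto intro: Mon.intros can_Mon\<close>)
  have "g = can (dm g) A l' \<rhd> dual (can (cd g) A r')" using g(3) AB by simp
  also have "\<dots> = (can (dm f) A l \<rhd> P) \<rhd> dual (can (cd f) A r \<rhd> P)"
    using *[OF f(1), of l'] *[OF f(2), of r'] g(1,2) s AB h by (simp add: ciso_def)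
  also have "\<dots> = can (dm f) A l \<rhd> (P \<rhd> dual P) \<rhd> dual (can (cd f) A r)" by simp
  also have "\<dots> = can (dm f) A l \<rhd> dual (can (cd f) A r)"
    using Prm_inverse[OF P(1)] P f(1,2) by simp
  finally show ?thesis using f(3) by simp
qed

lemma sem_surj:
  assumes "a \<in> hom Cospan n m"
  obtains f where "ok f" "dm f = n" "cd f = m" "sem f = a"
proof -
  obtain A l r where a: "maps l n A" "maps r m A" "a = mk n m A l r" using assms hom_Cospan by auto
  then show thesis
    by (intro that[of "can n A l \<rhd> dual (can m A r)"]) (simp_all add: sem_can flip_fnc fnc_seq_opc)
qed

text \<open>Two of the generating inequalities are the cases \<open>mrg\<close> and
  \<open>unt\<close>, and a crossing is its own inverse. In a composite the inner pair
  \<open>g \<rhd> dual g\<close> is removed first, which exposes the outer one.\<close>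

lemma Mon_lax: "f \<in> Mon \<Longrightarrow> le (f \<rhd> dual f) (idn (dm f))"
proof (induction rule: Mon.induct)
  case (Mon_id n)
  show ?case by (simp add: le_refl)
next
  case Mon_mrg
  show ?case using le_mrg_cpy by simp
next
  case Mon_unt
  show ?case using le_unt_dsc by simp
next
  case Mon_swp
  show ?case by (simp add: le_refl)
next
  case (Mon_sq f g)
  have "le (f \<rhd> (g \<rhd> dual g) \<rhd> dual f) (f \<rhd> idn (dm g) \<rhd> dual f)"
    using Mon_sq Mon_ok by (intro le_sq le_refl) auto
  with Mon_sq show ?case by (auto intro: le_trans)
next
  case (Mon_pr f g)
  then show ?case using le_pr[of "f \<rhd> dual f" "idn (dm f)" "g \<rhd> dual g" "idn (dm g)"] by (simp add: interchange)
qed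

lemma le_complete:
  assumes "ok f" "ok g" "dm f = dm g" "cd f = cd g" "sem f \<preceq>\<^bsub>Cospan\<^esub> sem g"
  shows "le f g"
proof -
  obtain A l r where f: "maps l (dm f) A" "maps r (cd f) A" "f = can (dm f) A l \<rhd> dual (can (cd f) A r)"
    "sem f = mk (dm f) (cd f) A l r" using normal_form[OF assms(1)] .
  obtain B l' r' where g: "maps l' (dm g) B" "maps r' (cd g) B" "g = can (dm g) B l' \<rhd> dual (can (cd g) B r')"
    "sem g = mk (dm g) (cd g) B l' r'" using normal_form[OF assms(2)] .
  obtain h where h: "maps h B A" "\<And>i. i < dm f \<Longrightarrow> h (l' i) = l i" "\<And>i. i < cd f \<Longrightarrow> h (r' i) = r i"
    using assms(5) f g leq_mk[OF f(1,2), of l' B r'] assms(3,4) by auto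
  let ?H = "can B A h"
  \<comment> \<open>Composition with \<open>?H\<close> turns the legs of the larger arrow into those
    of the smaller one, since \<open>h\<close> is a map of cospans.\<close>
  have *: "can n B k' \<rhd> ?H = can n A k" if "maps k' n B" "maps k n A" "\<And>i. i < n \<Longrightarrow> h (k' i) = k i" for n k k'
  proof (rule Mon_unique_fnc)
    show "sem (can n B k' \<rhd> ?H) = fnc n A (\<lambda>i. h (k' i))"
      using that h fnc_seq[OF that(1) h(1)] by (simp add: sem_can)
    show "sem (can n A k) = fnc n A k" using that by (simp add: sem_can)
  qed (use that h in \<open>auto intro: Mon.intros can_Mon\<close>)
  have "f = can (dm f) A l \<rhd> dual (can (cd f) A r)" by (rule f(3))
  also have "\<dots> = (can (dm f) B l' \<rhd> ?H) \<rhd> dual (can (cd f) B r' \<rhd> ?H)"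
    using *[of l' "dm f" l] *[of r' "cd f" r] f(1,2) g(1,2) h assms(3,4) by simp
  also have "\<dots> = can (dm f) B l' \<rhd> (?H \<rhd> dual ?H) \<rhd> dual (can (cd f) B r')" by simp
  finally have fe: "f = can (dm f) B l' \<rhd> (?H \<rhd> dual ?H) \<rhd> dual (can (cd f) B r')" .
  have "le (?H \<rhd> dual ?H) (idn B)" using Mon_lax[OF can_Mon[OF h(1)]] h(1) by simp
  then have "le (can (dm f) B l' \<rhd> (?H \<rhd> dual ?H) \<rhd> dual (can (cd f) B r')) (can (dm f) B l' \<rhd> idn B \<rhd> dual (can (cd f) B r'))"
    using g(1,2) h(1) assms(3,4) by (intro le_sq le_refl) auto
  moreover have "can (dm f) B l' \<rhd> idn B \<rhd> dual (can (cd f) B r') = g"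
    using g assms(3,4) by simp
  ultimately show ?thesis using fe by simp
qed

section \<open>The syntactic bicategory\<close>

text \<open>The comonoids on \<open>n\<close> wires are the duals of \<open>muN\<close> and
  \<open>etaN\<close>, so their laws are obtained by applying \<open>dual\<close> to the monoid
  laws.\<close>

definition muN :: "nat \<Rightarrow> arr" where "muN n = abs_arr (mu_tm n)"
definition etaN :: "nat \<Rightarrow> arr" where "etaN n = abs_arr (eta_tm n)"

lemma mu_tm_sort [simp]: "dm_tm (mu_tm n) = n + n" "cd_tm (mu_tm n) = n" "wf_tm (mu_tm n)"
proof -
  show d: "dm_tm (mu_tm n) = n + n" for n by (induction n) (auto simp: One_nat_def)
  show c: "cd_tm (mu_tm n) = n" for n by (induction n) (auto simp: One_nat_def)
  show "wf_tm (mu_tm n)" by (induction n) (auto simp: c d)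
qed

lemma eta_tm_sort [simp]: "dm_tm (eta_tm n) = 0" "cd_tm (eta_tm n) = n" "wf_tm (eta_tm n)"
  by (induction n) (auto simp: One_nat_def)

lemma delta_tm_sort [simp]: "wf_tm (delta_tm n)" "dm_tm (delta_tm n) = n" "cd_tm (delta_tm n) = n + n"
proof -
  show d: "dm_tm (delta_tm n) = n" for n by (induction n) (auto simp: One_nat_def)
  show c: "cd_tm (delta_tm n) = n + n" for n by (induction n) (auto simp: One_nat_def)
  show "wf_tm (delta_tm n)" by (induction n) (auto simp: c d)
qed

lemma eps_tm_sort [simp]: "dm_tm (eps_tm n) = n" "cd_tm (eps_tm n) = 0" "wf_tm (eps_tm n)"
  by (induction n) (auto simp: One_nat_def)

lemma abs_delta_tm: "abs_arr (delta_tm n) = dual (muN n)"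
  by (induction n) (simp_all add: muN_def)

lemma abs_eps_tm: "abs_arr (eps_tm n) = dual (etaN n)"
  by (induction n) (simp_all add: etaN_def)

lemma N_sorts [simp]: "dm (muN n) = n + n" "cd (muN n) = n" "ok (muN n)" "dm (etaN n) = 0" "cd (etaN n) = n" "ok (etaN n)"
  by (simp_all add: muN_def etaN_def)

lemma sem_abs_arr: "wf_tm c \<Longrightarrow> sem (abs_arr c) = sem_tm c"
  by (simp add: sem.abs_eq)

lemma sem_muN [simp]: "sem (muN n) = mu Cospan n"
proof (induction n)
  case 0
  show ?case unfolding muN_def by (simp add: sem_abs_arr) (rule fnc_cong, simp)
next
  case (Suc n)
  let ?I = "\<lambda>i. i :: nat"
  let ?d = "\<lambda>n. cp n ?I ?I"
  let ?s = "cp 1 (\<lambda>i. n + i) ?I"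
  note m1 = maps_id_cp[OF maps_braid[of 1 n], of n]
  note m2 = maps_cp_id[OF m1, of 1]
  note m3 = maps_cp_sum[OF maps_fold[of n] maps_fold[of 1]]
  have IH: "sem_tm (mu_tm n) = fnc (n + n) n (?d n)" using Suc by (simp add: muN_def sem_abs_arr)
  have "sem (muN (Suc n)) = (fnc n n ?I \<boxtimes> fnc (1 + n) (n + 1) ?s \<boxtimes> fnc 1 1 ?I) \<star> (fnc (n + n) n (?d n) \<boxtimes> fnc (1 + 1) 1 (?d 1))"
    unfolding muN_def sem_abs_arr[OF mu_tm_sort(3)] by (simp add: IH)
  also have "\<dots> = fnc (n + (1 + n) + 1) (n + (n + 1) + 1) (cp (n + (1 + n)) (cp n ?I (\<lambda>i. n + ?s i)) (\<lambda>i. n + (n + 1) + i)) \<star>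
      fnc (n + n + (1 + 1)) (n + 1) (cp (n + n) (?d n) (\<lambda>i. n + ?d 1 i))"
    by (simp only: id_tensor_fnc[OF maps_braid] fnc_tensor_id[OF m1] fnc_tensor[OF maps_fold maps_fold])
  also have "\<dots> = fnc (n + (1 + n) + 1) (n + 1) (\<lambda>x. cp (n + n) (?d n) (\<lambda>i. n + ?d 1 i)
      (cp (n + (1 + n)) (cp n ?I (\<lambda>i. n + ?s i)) (\<lambda>i. n + (n + 1) + i) x))"
  proof -
    have e: "n + n + (1 + 1) = n + (n + 1) + 1" by simp
    show ?thesis unfolding e by (rule fnc_seq[OF m2 m3[unfolded e]])
  qed
  also have "\<dots> = fnc (n + (1 + n) + 1) (n + 1) (?d (n + 1))"
    by (rule fnc_cong) (auto simp: cp_def)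
  finally show ?case by (simp add: One_nat_def)
qed

lemma sem_etaN [simp]: "sem (etaN n) = eta Cospan n"
proof (induction n)
  case 0
  show ?case unfolding etaN_def by (simp add: sem_abs_arr)
next
  case (Suc n)
  have "sem (etaN (Suc n)) = fnc 0 n (\<lambda>i. i) \<boxtimes> fnc 0 1 (\<lambda>i. i)"
    using Suc by (simp add: etaN_def sem_abs_arr)
  also have "\<dots> = fnc (0 + 0) (n + 1) (cp 0 (\<lambda>i. i) (\<lambda>i. n + i))" by (rule fnc_tensor) simp_all
  also have "\<dots> = fnc 0 (n + 1) (\<lambda>i. i)" unfolding add_0 by (rule fnc_cong) simp
  finally show ?case by (simp add: One_nat_def)
qed

text \<open>Passes from the quotient type to sets of terms, the form that arrows of
  \<open>CB\<close> have. On well-typed arrows it agrees with \<open>cb_class\<close>.\<close>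

definition cls :: "arr \<Rightarrow> cb_term set" where
  "cls f = {c. abs_arr c = f}"

lemma cb_class_cls: "wf_tm c \<Longrightarrow> cb_class c = cls (abs_arr c)"
proof -
  assume c: "wf_tm c"
  have "(\<exists>n m. cb_eq n m c d) \<longleftrightarrow> cbx c d" for d
    using c cb_eq_cbx[of _ _ c d] by (auto simp: cbx_def)
  then show ?thesis by (auto simp: cb_class_def cls_def arr.abs_eq_iff[symmetric])
qed

lemma arr_rep: obtains c where "f = abs_arr c"
  using Quotient_abs_rep[OF Quotient_arr] by metis

lemma cls_eq [simp]: "cls f = cls g \<longleftrightarrow> f = g"
proof
  assume e: "cls f = cls g"
  obtain c where c: "f = abs_arr c" by (rule arr_rep)
  then have "c \<in> cls g" using e by (auto simp: cls_def)
  then show "f = g" using c by (simp add: cls_def)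
qed simp

lemma hom_CB: "a \<in> hom CB n m \<longleftrightarrow> (\<exists>f. ok f \<and> dm f = n \<and> cd f = m \<and> a = cls f)"
proof
  assume "a \<in> hom CB n m"
  then obtain c where "has_sort c n m" "a = cb_class c" by (auto simp: CB_def)
  then show "\<exists>f. ok f \<and> dm f = n \<and> cd f = m \<and> a = cls f"
    by (intro exI[of _ "abs_arr c"]) (simp add: cb_class_cls has_sort_iff)
next
  assume "\<exists>f. ok f \<and> dm f = n \<and> cd f = m \<and> a = cls f"
  then obtain f where f: "ok f" "dm f = n" "cd f = m" "a = cls f" by blast
  obtain c where "f = abs_arr c" by (rule arr_rep)
  then have "has_sort c n m" "a = cb_class c" using f by (auto simp: has_sort_iff cb_class_cls)
  then show "a \<in> hom CB n m" by (auto simp: CB_def)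
qed

lemma cls_sq: "ok (f \<rhd> g) \<Longrightarrow> cls f ;;\<^bsub>CB\<^esub> cls g = cls (f \<rhd> g)"
proof -
  assume ok: "ok (f \<rhd> g)"
  have "cb_class (c \<Zsemi> d) = cls (f \<rhd> g)" if "c \<in> cls f" "d \<in> cls g" for c d
    using that ok by (subst cb_class_cls) (auto simp: cls_def)
  moreover obtain c d where "f = abs_arr c" "g = abs_arr d" using arr_rep by metis
  then have "c \<in> cls f" "d \<in> cls g" by (auto simp: cls_def)
  ultimately show ?thesis unfolding CB_def by (simp; blast)
qed

lemma cls_pr: "ok (f \<otimes> g) \<Longrightarrow> cls f \<oplus>\<^bsub>CB\<^esub> cls g = cls (f \<otimes> g)"
proof -
  assume ok: "ok (f \<otimes> g)"
  have "cb_class (c \<uplus> d) = cls (f \<otimes> g)" if "c \<in> cls f" "d \<in> cls g" for c d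
    using that ok by (subst cb_class_cls) (auto simp: cls_def)
  moreover obtain c d where "f = abs_arr c" "g = abs_arr d" using arr_rep by metis
  then have "c \<in> cls f" "d \<in> cls g" by (auto simp: cls_def)
  ultimately show ?thesis unfolding CB_def by (simp; blast)
qed

lemma cls_le: "ok f \<Longrightarrow> cls f \<preceq>\<^bsub>CB\<^esub> cls g \<longleftrightarrow> le f g"
proof -
  assume ok: "ok f"
  have *: "le (abs_arr c) (abs_arr d) \<longleftrightarrow> wf_tm c \<and> (\<exists>n m. cb_le n m c d)" for c d
    by (simp add: le.abs_eq)
  obtain c d where cd: "f = abs_arr c" "g = abs_arr d" using arr_rep by metis
  show ?thesis
  proof
    assume "cls f \<preceq>\<^bsub>CB\<^esub> cls g"
    then obtain c' d' n m where c': "abs_arr c' = f" "abs_arr d' = g" "cb_le n m c' d'"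
      by (auto simp: CB_def cls_def)
    then have "wf_tm c'" using ok by auto
    then show "le f g" using *[of c' d'] c' by auto
  next
    assume "le f g"
    then obtain n m where "cb_le n m c d" using * cd by auto
    then show "cls f \<preceq>\<^bsub>CB\<^esub> cls g" using cd by (auto simp: CB_def cls_def)
  qed
qed

lemma CB_simps [simp]:
  "obj CB = UNIV" "unit_obj CB = 0" "n \<boxplus>\<^bsub>CB\<^esub> m = n + m"
  "idt CB n = cls (idn n)"
  "assoc CB n m k = cls (idn (n + m + k))" "assoc_inv CB n m k = cls (idn (n + m + k))"
  "lunit CB n = cls (idn n)" "runit CB n = cls (idn n)" "symm CB n m = cls (braid n m)"
  "mu CB n = cls (muN n)" "eta CB n = cls (etaN n)" "delta CB n = cls (dual (muN n))" "eps CB n = cls (dual (etaN n))"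
  by (simp_all add: CB_def cb_class_cls abs_delta_tm abs_eps_tm, simp_all add: muN_def etaN_def)

lemma cls_hom: "ok f \<Longrightarrow> dm f = n \<Longrightarrow> cd f = m \<Longrightarrow> cls f \<in> hom CB n m"
  by (auto simp: hom_CB)

context begin

interpretation C: preordered_cartesian_bicategory Cospan by (rule cospan_pcb)

section \<open>Laws on arbitrary objects\<close>

lemma muN_assoc: "(muN n \<otimes> idn n) \<rhd> muN n = (idn n \<otimes> muN n) \<rhd> muN n"
proof (rule sem_inj)
  have "idt Cospan n \<boxtimes> mu Cospan n \<in> hom Cospan (n + n + n) (n + n)"
    using C.tensor_hom[OF C.idt_hom C.mu_hom, of n n] by (simp add: add.assoc)
  from id_seq[OF this] C.mu_assoc[of n]
  show "sem ((muN n \<otimes> idn n) \<rhd> muN n) = sem ((idn n \<otimes> muN n) \<rhd> muN n)" by simp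
qed (simp_all add: add.assoc)

lemma muN_unit: "(etaN n \<otimes> idn n) \<rhd> muN n = idn n" "(idn n \<otimes> etaN n) \<rhd> muN n = idn n"
  using C.mu_lunit[of n] C.mu_runit[of n] by (auto intro!: sem_inj)

lemma muN_comm: "braid n n \<rhd> muN n = muN n"
  using C.mu_comm[of n] by (auto intro!: sem_inj)

lemma muN_special: "dual (muN n) \<rhd> muN n = idn n"
  using C.special[of n] by (auto intro!: sem_inj simp: flip_fnc)

lemma muN_frobenius: "(dual (muN n) \<otimes> idn n) \<rhd> (idn n \<otimes> muN n) = muN n \<rhd> dual (muN n)"
proof (rule sem_inj)
  have "delta Cospan n \<boxtimes> idt Cospan n \<in> hom Cospan (n + n) (n + n + n)"
    using C.tensor_hom[OF C.delta_hom C.idt_hom, of n n] by simp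
  from seq_id[OF this] C.frobenius_left[of n]
  show "sem ((dual (muN n) \<otimes> idn n) \<rhd> (idn n \<otimes> muN n)) = sem (muN n \<rhd> dual (muN n))"
    by (simp add: flip_fnc add.assoc)
qed (simp_all add: add.assoc)

lemma CB_ineqs:
  "le (idn n) (dual (etaN n) \<rhd> etaN n)" "le (etaN n \<rhd> dual (etaN n)) (idn 0)"
  "le (muN n \<rhd> dual (muN n)) (idn (n + n))"
  using C.eps_eta[of n] C.eta_eps[of n] C.mu_delta[of n]
  by (auto intro!: le_complete simp: flip_fnc)

text \<open>These inequalities for arbitrary \<open>R\<close> are not generators of
  \<open>cb_le\<close>; completeness of the order imports them from cospans without an induction
  over \<open>R\<close>.\<close>

lemma CB_lax:
  assumes "ok R"
  shows "le (R \<rhd> dual (muN (cd R))) (dual (muN (dm R)) \<rhd> (R \<otimes> R))" "le (R \<rhd> dual (etaN (cd R))) (dual (etaN (dm R)))"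
  using C.delta_lax[OF sem_hom[OF assms]] C.eps_lax[OF sem_hom[OF assms]] assms
  by (auto intro!: le_complete simp: flip_fnc)

end

section \<open>Bicategory axioms for \<open>CB\<close>\<close>

lemma CB_category: "category CB"
  by unfold_locales (auto simp: hom_CB cls_sq)

lemma cls_idn_invertible: "invertible CB n n (cls (idn n))"
  unfolding invertible_def by (auto simp: cls_hom cls_sq intro!: bexI[of _ "cls (idn n)"])

lemma CB_smc: "symmetric_monoidal_category CB"
proof -
  interpret category CB by (rule CB_category)
  show ?thesis
  proof (unfold_locales, goal_cases)
    case 18
    then show ?case by (auto simp: hom_CB cls_sq cls_pr braid_natural)
  next
    case (20 X Y Z)
    show ?case by (simp add: cls_sq cls_pr hexagon add.assoc)
  qed (auto simp: hom_CB cls_sq cls_pr cls_hom cls_idn_invertible interchange add.assoc)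
qed

lemma dual_cong: "f = g \<Longrightarrow> dual f = dual g" by simp

lemma CB_pcb: "preordered_cartesian_bicategory CB"
proof -
  interpret symmetric_monoidal_category CB by (rule CB_smc)
  show ?thesis
  proof (unfold_locales, goal_cases)
    case 1
    then show ?case by (auto simp: hom_CB cls_le le_refl)
  next
    case 2
    then show ?case by (auto simp: hom_CB cls_le intro: le_trans)
  next
    case 3
    then show ?case by (auto simp: hom_CB cls_sq cls_le intro: le_sq)
  next
    case 4
    then show ?case by (auto simp: hom_CB cls_pr cls_le intro: le_pr)
  next
    case 7
    show ?case by (simp add: cls_sq cls_pr muN_assoc add.assoc)
  next
    case 13
    show ?case using dual_cong[OF muN_assoc] by (simp add: cls_sq cls_pr add.assoc)
  next
    case 14
    show ?case using dual_cong[OF muN_unit(1)] by (simp add: cls_sq cls_pr)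
  next
    case 15
    show ?case using dual_cong[OF muN_unit(2)] by (simp add: cls_sq cls_pr)
  next
    case 16
    show ?case using dual_cong[OF muN_comm] by (simp add: cls_sq)
  next
    case 17
    show ?case by (simp add: cls_sq cls_pr muN_frobenius add.assoc)
  next
    case 18
    \<comment> \<open>Reversing the left Frobenius equation gives the right one, because
      \<open>muN n \<rhd> dual (muN n)\<close> is its own dual.\<close>
    show ?case using dual_cong[OF muN_frobenius] by (simp add: cls_sq cls_pr add.assoc)
  next
    case 24
    then show ?case using CB_lax(1) by (auto simp: hom_CB cls_sq cls_pr cls_le)
  next
    case 25
    then show ?case using CB_lax(2) by (auto simp: hom_CB cls_sq cls_le)
  qed (simp_all add: cls_sq cls_pr cls_le cls_hom muN_unit muN_comm muN_special CB_ineqs le_refl)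
qed

section \<open>The isomorphism\<close>

text \<open>Both bicategories have the natural numbers as objects and addition as product, so
  identities can serve as comparison arrows. The coherence conditions then reduce to identity laws
  and strict preservation of the structure.\<close>

lemma strict_pcb_morphism:
  fixes B :: "(nat, 'a) pcb_sig" and C :: "(nat, 'b) pcb_sig"
  assumes "preordered_cartesian_bicategory B" "preordered_cartesian_bicategory C"
    and obj: "obj B = UNIV" "obj C = UNIV" "unit_obj B = 0" "unit_obj C = 0"
      "\<And>X Y. X \<boxplus>\<^bsub>B\<^esub> Y = X + Y" "\<And>X Y. X \<boxplus>\<^bsub>C\<^esub> Y = X + Y"
    and hom: "\<And>f X Y. f \<in> hom B X Y \<Longrightarrow> \<phi> f \<in> hom C X Y"
    and idt: "\<And>X. \<phi> (idt B X) = idt C X"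
    and seq: "\<And>f g X Y Z. f \<in> hom B X Y \<Longrightarrow> g \<in> hom B Y Z \<Longrightarrow> \<phi> (f ;;\<^bsub>B\<^esub> g) = \<phi> f ;;\<^bsub>C\<^esub> \<phi> g"
    and tens: "\<And>f g X Y X' Y'. f \<in> hom B X Y \<Longrightarrow> g \<in> hom B X' Y' \<Longrightarrow> \<phi> (f \<oplus>\<^bsub>B\<^esub> g) = \<phi> f \<oplus>\<^bsub>C\<^esub> \<phi> g"
    and leq: "\<And>f g X Y. f \<in> hom B X Y \<Longrightarrow> g \<in> hom B X Y \<Longrightarrow> f \<preceq>\<^bsub>B\<^esub> g \<Longrightarrow> \<phi> f \<preceq>\<^bsub>C\<^esub> \<phi> g"
    and struct: "\<And>X Y Z. \<phi> (assoc B X Y Z) = assoc C X Y Z" "\<And>X. \<phi> (lunit B X) = lunit C X"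
      "\<And>X. \<phi> (runit B X) = runit C X" "\<And>X Y. \<phi> (symm B X Y) = symm C X Y"
      "\<And>X. \<phi> (mu B X) = mu C X" "\<And>X. \<phi> (eta B X) = eta C X"
      "\<And>X. \<phi> (delta B X) = delta C X" "\<And>X. \<phi> (eps B X) = eps C X"
  shows "pcb_morphism B C \<lparr>on_obj = (\<lambda>X. X), on_arr = \<phi>, on_tensor = (\<lambda>X Y. idt C (X + Y)), on_unit = idt C 0\<rparr>"
proof -
  interpret B: preordered_cartesian_bicategory B by fact
  interpret C: preordered_cartesian_bicategory C by fact
  have I: "idt C X \<in> hom C X X" for X using C.idt_hom obj by simp
  have inv: "invertible C X X (idt C X)" for X
    unfolding invertible_def using I C.idt_left[OF I] by blast
  have T: "idt C X \<oplus>\<^bsub>C\<^esub> idt C Y = idt C (X + Y)" for X Y using C.tensor_idt obj by simp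
  have lu: "lunit C X \<in> hom C X X" "runit C X \<in> hom C X X" for X
    using C.lunit_invertible[of X] C.runit_invertible[of X] obj by (auto simp: invertible_def)
  note hs = C.symm_hom[unfolded obj, OF UNIV_I UNIV_I] C.mu_hom[unfolded obj, OF UNIV_I] C.eta_hom[unfolded obj, OF UNIV_I]
    C.delta_hom[unfolded obj, OF UNIV_I] C.eps_hom[unfolded obj, OF UNIV_I] C.assoc_hom[unfolded obj, OF UNIV_I UNIV_I UNIV_I] lu
  note simps = obj idt struct inv T C.idt_left[OF hs(1)] C.idt_left[OF hs(2)] C.idt_left[OF hs(3)]
    C.idt_right[OF hs(1)] C.idt_right[OF hs(4)] C.idt_right[OF hs(5)] C.idt_left[OF hs(6)]
    C.idt_right[OF hs(6)] C.idt_left[OF hs(7)] C.idt_left[OF hs(8)] C.idt_left[OF I]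
  show ?thesis
  proof (unfold_locales, goal_cases)
    case (8 f X X' g Y Y')
    have "\<phi> f \<oplus>\<^bsub>C\<^esub> \<phi> g \<in> hom C (X + Y) (X' + Y')" using C.tensor_hom[OF hom[OF 8(1)] hom[OF 8(2)]] obj by simp
    from C.idt_left[OF this] C.idt_right[OF this] show ?case using tens[OF 8] by simp
  next
    case (9 X Y Z)
    have a: "assoc C X Y Z \<in> hom C (X + Y + Z) (X + Y + Z)" using hs(6)[of X Y Z] by (simp add: add.assoc)
    show ?case using C.idt_left[OF a] C.idt_right[OF a] C.idt_left[OF I]
      by (simp add: simps add.assoc[symmetric])
  qed (simp_all add: simps hom seq leq)
qed

section \<open>The two inverse functors\<close>

definition arr_of :: "cb_term set \<Rightarrow> arr" where
  "arr_of t = (THE f. cls f = t)"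

definition unsem :: "cospan set \<Rightarrow> arr" where
  "unsem a = (THE f. ok f \<and> sem f = a)"

lemma arr_of_cls [simp]: "arr_of (cls f) = f"
  by (simp add: arr_of_def)

lemma unsem_sem: "ok f \<Longrightarrow> unsem (sem f) = f"
  unfolding unsem_def by (rule the_equality) (auto intro: sem_inj)

lemma hom_Cospan_sem: "a \<in> hom Cospan n m \<longleftrightarrow> (\<exists>f. ok f \<and> dm f = n \<and> cd f = m \<and> a = sem f)"
  using sem_surj sem_hom by metis

text \<open>Presents the structural arrows of \<open>Cospan\<close> as values of \<open>sem\<close>,
  where \<open>unsem\<close> can be evaluated.\<close>

lemma sem_struct:
  "idt Cospan n = sem (idn n)" "assoc Cospan n m k = sem (idn (n + m + k))"
  "lunit Cospan n = sem (idn n)" "runit Cospan n = sem (idn n)" "symm Cospan n m = sem (braid n m)"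
  "mu Cospan n = sem (muN n)" "eta Cospan n = sem (etaN n)"
  "delta Cospan n = sem (dual (muN n))" "eps Cospan n = sem (dual (etaN n))"
  by (simp_all add: flip_fnc)

lemma Cospan_to_CB: "pcb_morphism Cospan CB \<lparr>on_obj = (\<lambda>X. X), on_arr = (\<lambda>a. cls (unsem a)),
    on_tensor = (\<lambda>X Y. idt CB (X + Y)), on_unit = idt CB 0\<rparr>"
proof (rule strict_pcb_morphism[OF cospan_pcb CB_pcb])
  fix f g X Y assume "f \<in> hom Cospan X Y" "g \<in> hom Cospan X Y" "f \<preceq>\<^bsub>Cospan\<^esub> g"
  then show "cls (unsem f) \<preceq>\<^bsub>CB\<^esub> cls (unsem g)"
    unfolding hom_Cospan_sem by (auto simp: unsem_sem cls_le intro!: le_complete)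
next
  fix f g X Y Z assume "f \<in> hom Cospan X Y" "g \<in> hom Cospan Y Z"
  then obtain F G where "ok F" "ok G" "cd F = dm G" "f = sem F" "g = sem G"
    unfolding hom_Cospan_sem by auto
  then show "cls (unsem (f \<star> g)) = cls (unsem f) ;;\<^bsub>CB\<^esub> cls (unsem g)"
    using unsem_sem[of "F \<rhd> G"] by (simp add: unsem_sem cls_sq)
next
  fix f g X Y X' Y' assume "f \<in> hom Cospan X Y" "g \<in> hom Cospan X' Y'"
  then obtain F G where "ok F" "ok G" "f = sem F" "g = sem G"
    unfolding hom_Cospan_sem by auto
  then show "cls (unsem (f \<boxtimes> g)) = cls (unsem f) \<oplus>\<^bsub>CB\<^esub> cls (unsem g)"
    using unsem_sem[of "F \<otimes> G"] by (simp add: unsem_sem cls_pr)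
next
  fix f X Y assume "f \<in> hom Cospan X Y"
  then show "cls (unsem f) \<in> hom CB X Y"
    unfolding hom_Cospan_sem by (auto simp: unsem_sem cls_hom)
qed (simp_all only: sem_struct CB_simps, simp_all add: unsem_sem del: sem_simps sem_muN sem_etaN sem_dual)

lemma CB_to_Cospan: "pcb_morphism CB Cospan \<lparr>on_obj = (\<lambda>X. X), on_arr = (\<lambda>t. sem (arr_of t)),
    on_tensor = (\<lambda>X Y. idt Cospan (X + Y)), on_unit = idt Cospan 0\<rparr>"
proof (rule strict_pcb_morphism[OF CB_pcb cospan_pcb])
  fix f X Y assume "f \<in> hom CB X Y"
  then show "sem (arr_of f) \<in> hom Cospan X Y" by (auto simp: hom_CB intro: sem_hom)
qed (auto simp: hom_CB cls_sq cls_pr cls_le flip_fnc intro: sem_le)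

theorem mainTheorem4:
  shows "preordered_cartesian_bicategory Cospan \<and> preordered_cartesian_bicategory CB \<and>
         Cospan \<cong>\<^sub>p\<^sub>c\<^sub>b CB"
proof -
  let ?F = "\<lparr>on_obj = (\<lambda>X. X), on_arr = (\<lambda>a. cls (unsem a)), on_tensor = (\<lambda>X Y. idt CB (X + Y)), on_unit = idt CB 0\<rparr>"
  let ?G = "\<lparr>on_obj = (\<lambda>X. X), on_arr = (\<lambda>t. sem (arr_of t)), on_tensor = (\<lambda>X Y. idt Cospan (X + Y)), on_unit = idt Cospan 0\<rparr>"
  have "left_inverse Cospan ?F ?G"
    by (auto simp: left_inverse_def hom_Cospan_sem unsem_sem fnc_seq)
  \<comment> \<open>The comparison arrows of \<open>?G\<close> are identity cospans, and the inverse
    law for comparison arrows evaluates \<open>?F\<close> on them.\<close>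
  moreover have u: "unsem (fnc n n (\<lambda>i. i)) = idn n" for n
    using unsem_sem[of "idn n"] by simp
  have "left_inverse CB ?G ?F"
    by (auto simp: left_inverse_def hom_CB unsem_sem u cls_sq)
  ultimately show ?thesis
    unfolding pcb_isomorphic_def using cospan_pcb CB_pcb Cospan_to_CB CB_to_Cospan by blast
qed

end
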